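(* Let $\mathcal C$ be a $\mathbf k$-linear 2-Calabi--Yau triangulated category with a stability condition $\tau$. Let $X$ be a spherical $\tau$-stable object of $\mathcal C$ such that $X$ is (up to isomorphism) the unique $\tau$-stable object of its phase. Let $Y$ be any object of $\mathcal C$. Then: (1) If $\phi(X)\le\phi^-(Y)$, then $\phi(X)<\phi^-(\sigma_X^{-1}(Y))$. (2) If $\phi^+(Y)\le\phi(X)$, then $\phi^+(\sigma_X(Y))<\phi(X)$.
   Context: $\mathbf k$ is a field. Write $\operatorname{Hom}^i(X,Y)=\operatorname{Hom}(X,Y[i])$ and $\operatorname{Hom}^*(X,Y)=\bigoplus_i\operatorname{Hom}^i(X,Y)$, which is assumed finite-dimensional. 2-Calabi--Yau means there are natural isomorphisms $\operatorname{Hom}^i(X,Y)\cong\operatorname{Hom}^{2-i}(Y,X)^\vee$. An object $X$ is spherical if $\operatorname{Hom}^*(X,X)\cong H^*(S^2,\mathbf k)$ as graded $\mathbf k$-algebras. A spherical object $X$ gives an auto-equivalence $\sigma_X$ of $\mathcal C$, the spherical twist, with exact triangles $$\operatorname{Hom}^*(X,Y)\otimes X\to Y\to\sigma_X(Y)\xrightarrow{+1},\qquad \sigma_X^{-1}(Y)\to Y\to X\otimes\operatorname{Hom}^*(Y,X)^\vee\xrightarrow{+1},$$ whose maps $\operatorname{Hom}^*(X,Y)\otimes X\to Y$ and $Y\to X\otimes \operatorname{Hom}^*(Y,X)^\vee$ are evaluation and coevaluation. Stability conditions are in the sense of Bridgeland; $\phi(X)$ is the phase of a $\tau$-semistable object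 $X$. For an object $Y$ with Harder--Narasimhan factors $Z_1,\dots,Z_n$ of phases $\phi(Z_1)>\dots>\phi(Z_n)$, put $\phi^+(Y)=\phi(Z_1)$ and $\phi^-(Y)=\phi(Z_n)$. Objects to which $\phi^\pm$ is applied are understood to be nonzero. *)

theory Defs
  imports Complex_Main "HOL-Library.Product_Plus"
begin

section \<open>Linear and triangulated categories\<close>

text \<open>
  A category has object class the type \<open>'o\<close>; all its morphisms live in one
  \<open>'k\<close>-vector space \<open>'m\<close>, and each \<open>Hom C X Y\<close> is a linear subspace of \<open>'m\<close>.
  Every small linear category is of this form: take for \<open>'m\<close> the direct sum of all Hom spaces,
  with composition extended as matrix multiplication. Nothing is assumed about
  composition (or about the action of functors) outside the relevant Hom spaces.

  The translation functor is an automorphism of the category, given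
  with all its powers: \<open>shO C i X\<close> is \<open>X[i]\<close> and \<open>shM C i f\<close> is \<open>f[i]\<close> for an integer \<open>i\<close>.
  \<open>dtri C X Y Z f g h\<close> says that \<open>X \<rightarrow> Y \<rightarrow> Z \<rightarrow> X[1]\<close>, with maps \<open>f\<close>, \<open>g\<close>, \<open>h\<close>, is distinguished.
\<close>

record ('k, 'o, 'm) tricat_data =
  smul :: "'k \<Rightarrow> 'm \<Rightarrow> 'm"
  Hom  :: "'o \<Rightarrow> 'o \<Rightarrow> 'm set"
  cmp  :: "'m \<Rightarrow> 'm \<Rightarrow> 'm"  (infixl \<open>\<cdot>\<index>\<close> 70)
  idm  :: "'o \<Rightarrow> 'm"
  shO  :: "int \<Rightarrow> 'o \<Rightarrow> 'o"
  shM  :: "int \<Rightarrow> 'm \<Rightarrow> 'm"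
  dtri :: "'o \<Rightarrow> 'o \<Rightarrow> 'o \<Rightarrow> 'm \<Rightarrow> 'm \<Rightarrow> 'm \<Rightarrow> bool"

definition iso_mor :: "('k::field, 'o, 'm::ab_group_add) tricat_data \<Rightarrow> 'o \<Rightarrow> 'o \<Rightarrow> 'm \<Rightarrow> bool" where
  "iso_mor C X Y f \<longleftrightarrow> f \<in> Hom C X Y \<and>
     (\<exists>g\<in>Hom C Y X. g \<cdot>\<^bsub>C\<^esub> f = idm C X \<and> f \<cdot>\<^bsub>C\<^esub> g = idm C Y)"

definition isomorphic :: "('k::field, 'o, 'm::ab_group_add) tricat_data \<Rightarrow> 'o \<Rightarrow> 'o \<Rightarrow> bool" where
  "isomorphic C X Y \<longleftrightarrow> (\<exists>f. iso_mor C X Y f)"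

definition zero_obj :: "('k::field, 'o, 'm::ab_group_add) tricat_data \<Rightarrow> 'o \<Rightarrow> bool" where
  "zero_obj C N \<longleftrightarrow> (\<forall>X. Hom C X N = {0} \<and> Hom C N X = {0})"

definition is_biproduct ::
  "('k::field, 'o, 'm::ab_group_add) tricat_data \<Rightarrow> 'i set \<Rightarrow> ('i \<Rightarrow> 'o) \<Rightarrow> 'o \<Rightarrow>
     ('i \<Rightarrow> 'm) \<Rightarrow> ('i \<Rightarrow> 'm) \<Rightarrow> bool" where
  "is_biproduct C I S T \<iota> \<pi> \<longleftrightarrow> finite I \<and>
     (\<forall>j\<in>I. \<iota> j \<in> Hom C (S j) T \<and> \<pi> j \<in> Hom C T (S j)) \<and>
     (\<forall>j\<in>I. \<forall>l\<in>I. \<pi> j \<cdot>\<^bsub>C\<^esub> \<iota> l = (if j = l then idm C (S j) else 0)) \<and>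
     (\<Sum>j\<in>I. \<iota> j \<cdot>\<^bsub>C\<^esub> \<pi> j) = idm C T"

locale linear_category = vector_space "smul C"
  for C :: "('k::field, 'o, 'm::ab_group_add) tricat_data" (structure) +
  assumes Hom_subspace: "subspace (Hom C X Y)"
    and idm_Hom: "idm C X \<in> Hom C X X"
    and cmp_Hom: "f \<in> Hom C X Y \<Longrightarrow> g \<in> Hom C Y Z \<Longrightarrow> g \<cdot> f \<in> Hom C X Z"
    and cmp_idm_right: "f \<in> Hom C X Y \<Longrightarrow> f \<cdot> idm C X = f"
    and cmp_idm_left: "f \<in> Hom C X Y \<Longrightarrow> idm C Y \<cdot> f = f"
    and cmp_assoc: "f \<in> Hom C X Y \<Longrightarrow> g \<in> Hom C Y Z \<Longrightarrow> h \<in> Hom C Z W \<Longrightarrow>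
          (h \<cdot> g) \<cdot> f = h \<cdot> (g \<cdot> f)"
    and cmp_add_right: "f \<in> Hom C X Y \<Longrightarrow> f' \<in> Hom C X Y \<Longrightarrow> g \<in> Hom C Y Z \<Longrightarrow>
          g \<cdot> (f + f') = g \<cdot> f + g \<cdot> f'"
    and cmp_add_left: "f \<in> Hom C X Y \<Longrightarrow> g \<in> Hom C Y Z \<Longrightarrow> g' \<in> Hom C Y Z \<Longrightarrow>
          (g + g') \<cdot> f = g \<cdot> f + g' \<cdot> f"
    and cmp_smul_right: "f \<in> Hom C X Y \<Longrightarrow> g \<in> Hom C Y Z \<Longrightarrow> g \<cdot> smul C r f = smul C r (g \<cdot> f)"
    and cmp_smul_left: "f \<in> Hom C X Y \<Longrightarrow> g \<in> Hom C Y Z \<Longrightarrow> smul C r g \<cdot> f = smul C r (g \<cdot> f)"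

locale additive_linear_category = linear_category C
  for C :: "('k::field, 'o, 'm::ab_group_add) tricat_data" (structure) +
  assumes zero_ex: "\<exists>N. zero_obj C N"
    and biproduct_ex:
      "\<exists>T \<iota> \<pi>. is_biproduct C (UNIV :: bool set) (\<lambda>b. if b then X else Y) T \<iota> \<pi>"

locale triangulated_category = additive_linear_category C
  for C :: "('k::field, 'o, 'm::ab_group_add) tricat_data" (structure) +
  assumes shM_Hom: "f \<in> Hom C X Y \<Longrightarrow> shM C m f \<in> Hom C (shO C m X) (shO C m Y)"
    and shM_idm: "shM C m (idm C X) = idm C (shO C m X)"
    and shM_cmp: "f \<in> Hom C X Y \<Longrightarrow> g \<in> Hom C Y Z \<Longrightarrow> shM C m (g \<cdot> f) = shM C m g \<cdot> shM C m f"
    and shM_add: "f \<in> Hom C X Y \<Longrightarrow> g \<in> Hom C X Y \<Longrightarrow> shM C m (f + g) = shM C m f + shM C m g"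
    and shM_smul: "f \<in> Hom C X Y \<Longrightarrow> shM C m (smul C r f) = smul C r (shM C m f)"
    and shO_0: "shO C 0 X = X"
    and shO_plus: "shO C (m + n) X = shO C m (shO C n X)"
    and shM_0: "f \<in> Hom C X Y \<Longrightarrow> shM C 0 f = f"
    and shM_plus: "f \<in> Hom C X Y \<Longrightarrow> shM C (m + n) f = shM C m (shM C n f)"
    and dtri_Hom: "dtri C X Y Z f g h \<Longrightarrow>
          f \<in> Hom C X Y \<and> g \<in> Hom C Y Z \<and> h \<in> Hom C Z (shO C 1 X)"
    and TR1_iso: "dtri C X Y Z f g h \<Longrightarrow>
          f' \<in> Hom C X' Y' \<Longrightarrow> g' \<in> Hom C Y' Z' \<Longrightarrow> h' \<in> Hom C Z' (shO C 1 X') \<Longrightarrow>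
          iso_mor C X X' a \<Longrightarrow> iso_mor C Y Y' b \<Longrightarrow> iso_mor C Z Z' c \<Longrightarrow>
          b \<cdot> f = f' \<cdot> a \<Longrightarrow> c \<cdot> g = g' \<cdot> b \<Longrightarrow> shM C 1 a \<cdot> h = h' \<cdot> c \<Longrightarrow>
          dtri C X' Y' Z' f' g' h'"
    and TR1_idm: "zero_obj C N \<Longrightarrow> dtri C X X N (idm C X) 0 0"
    and TR1_cone: "f \<in> Hom C X Y \<Longrightarrow> \<exists>Z g h. dtri C X Y Z f g h"
    and TR2: "f \<in> Hom C X Y \<Longrightarrow>
          dtri C X Y Z f g h \<longleftrightarrow> dtri C Y Z (shO C 1 X) g h (- shM C 1 f)"
    and TR3: "dtri C X Y Z f g h \<Longrightarrow> dtri C X' Y' Z' f' g' h' \<Longrightarrow>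
          a \<in> Hom C X X' \<Longrightarrow> b \<in> Hom C Y Y' \<Longrightarrow> b \<cdot> f = f' \<cdot> a \<Longrightarrow>
          \<exists>c\<in>Hom C Z Z'. c \<cdot> g = g' \<cdot> b \<and> shM C 1 a \<cdot> h = h' \<cdot> c"
    and TR4: "dtri C X Y Z' f i i' \<Longrightarrow> dtri C Y Z X' g j j' \<Longrightarrow> dtri C X Z Y' (g \<cdot> f) k k' \<Longrightarrow>
          \<exists>u v. dtri C Z' Y' X' u v (shM C 1 i \<cdot> j') \<and>
            u \<cdot> i = k \<cdot> g \<and> k' \<cdot> u = i' \<and> v \<cdot> k = j \<and> j' \<cdot> v = shM C 1 f \<cdot> k'"

section \<open>Graded Hom spaces, Calabi--Yau property, spherical objects\<close>

definition Hom_deg :: "('k::field, 'o, 'm::ab_group_add) tricat_data \<Rightarrow> int \<Rightarrow> 'o \<Rightarrow> 'o \<Rightarrow> 'm set" where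
  "Hom_deg C i X Y = Hom C X (shO C i Y)"

text \<open>Finite-dimensionality of the total space \<open>\<Oplus>\<^sub>i Hom\<^sup>i(X,Y)\<close>.\<close>

definition Hom_finite :: "('k::field, 'o, 'm::ab_group_add) tricat_data \<Rightarrow> bool" where
  "Hom_finite C \<longleftrightarrow> (\<forall>X Y.
     (\<forall>i. \<exists>B. finite B \<and> module.span (smul C) B = Hom_deg C i X Y) \<and>
     finite {i. Hom_deg C i X Y \<noteq> {0}})"

definition linear_on ::
  "('k \<Rightarrow> 'v \<Rightarrow> 'v) \<Rightarrow> ('k \<Rightarrow> 'w \<Rightarrow> 'w) \<Rightarrow> 'v::plus set \<Rightarrow> ('v \<Rightarrow> 'w::plus) \<Rightarrow> bool" where
  "linear_on s t V f \<longleftrightarrow> (\<forall>u\<in>V. \<forall>v\<in>V. f (u + v) = f u + f v) \<and> (\<forall>c. \<forall>u\<in>V. f (s c u) = t c (f u))"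

text \<open>The dual of a subspace; functionals are normalised to vanish off it, so that
  equality of functions is equality of functionals.\<close>

definition dual_space ::
  "('k::field, 'o, 'm::ab_group_add) tricat_data \<Rightarrow> 'm set \<Rightarrow> ('m \<Rightarrow> 'k) set" where
  "dual_space C V = {\<xi>. linear_on (smul C) (*) V \<xi> \<and> (\<forall>x. x \<notin> V \<longrightarrow> \<xi> x = 0)}"

text \<open>Isomorphisms \<open>D i X Y : Hom\<^sup>i(X,Y) \<rightarrow> Hom\<^bsup>n-i\<^esup>(Y,X)\<^sup>\<or>\<close>, natural in \<open>X\<close> and \<open>Y\<close>.\<close>

definition calabi_yau :: "int \<Rightarrow> ('k::field, 'o, 'm::ab_group_add) tricat_data \<Rightarrow> bool" where
  "calabi_yau n C \<longleftrightarrow> (\<exists>D :: int \<Rightarrow> 'o \<Rightarrow> 'o \<Rightarrow> 'm \<Rightarrow> 'm \<Rightarrow> 'k.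
     (\<forall>i X Y.
        bij_betw (D i X Y) (Hom_deg C i X Y) (dual_space C (Hom_deg C (n - i) Y X)) \<and>
        (\<forall>f\<in>Hom_deg C i X Y. \<forall>g\<in>Hom_deg C i X Y.
           D i X Y (f + g) = (\<lambda>x. D i X Y f x + D i X Y g x)) \<and>
        (\<forall>c. \<forall>f\<in>Hom_deg C i X Y. D i X Y (smul C c f) = (\<lambda>x. c * D i X Y f x))) \<and>
     (\<forall>i X X' Y Y'. \<forall>a\<in>Hom C X' X. \<forall>b\<in>Hom C Y Y'.
        \<forall>f\<in>Hom_deg C i X Y. \<forall>g\<in>Hom_deg C (n - i) Y' X'.
          D i X' Y' (shM C i b \<cdot>\<^bsub>C\<^esub> f \<cdot>\<^bsub>C\<^esub> a) g = D i X Y f (shM C (n - i) a \<cdot>\<^bsub>C\<^esub> g \<cdot>\<^bsub>C\<^esub> b)))"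

text \<open>The graded algebra \<open>H\<^sup>*(S\<^sup>2,k) = k[x]/(x\<^sup>2)\<close> with \<open>x\<close> in degree \<open>2\<close>; the pair \<open>(a,b)\<close>
  stands for \<open>a + b x\<close>.\<close>

definition HS2 :: "int \<Rightarrow> ('k::field \<times> 'k) set" where
  "HS2 i = (if i = 0 then UNIV \<times> {0} else if i = 2 then {0} \<times> UNIV else {(0, 0)})"

definition HS2_smul :: "'k::field \<Rightarrow> 'k \<times> 'k \<Rightarrow> 'k \<times> 'k" where
  "HS2_smul c p = (c * fst p, c * snd p)"

definition HS2_mult :: "'k::field \<times> 'k \<Rightarrow> 'k \<times> 'k \<Rightarrow> 'k \<times> 'k" where
  "HS2_mult p q = (fst p * fst q, fst p * snd q + snd p * fst q)"

text \<open>The product of \<open>f \<in> Hom\<^sup>i(X,X)\<close> and \<open>g \<in> Hom\<^sup>j(X,X)\<close> is \<open>f[j] \<circ> g \<in> Hom\<^bsup>i+j\<^esup>(X,X)\<close>.\<close>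

definition spherical :: "('k::field, 'o, 'm::ab_group_add) tricat_data \<Rightarrow> 'o \<Rightarrow> bool" where
  "spherical C X \<longleftrightarrow> (\<exists>\<Phi> :: int \<Rightarrow> 'm \<Rightarrow> 'k \<times> 'k.
     (\<forall>i. linear_on (smul C) HS2_smul (Hom_deg C i X X) (\<Phi> i) \<and>
          bij_betw (\<Phi> i) (Hom_deg C i X X) (HS2 i)) \<and>
     \<Phi> 0 (idm C X) = (1, 0) \<and>
     (\<forall>i j. \<forall>f\<in>Hom_deg C i X X. \<forall>g\<in>Hom_deg C j X X.
        \<Phi> (i + j) (shM C j f \<cdot>\<^bsub>C\<^esub> g) = HS2_mult (\<Phi> i f) (\<Phi> j g)))"

section \<open>Auto-equivalences and spherical twists\<close>

record ('o, 'm) endofunctor =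
  omap :: "'o \<Rightarrow> 'o"
  mmap :: "'m \<Rightarrow> 'm"

definition linear_functor ::
  "('k::field, 'o, 'm::ab_group_add) tricat_data \<Rightarrow> ('o, 'm) endofunctor \<Rightarrow> bool" where
  "linear_functor C F \<longleftrightarrow>
     (\<forall>X. mmap F (idm C X) = idm C (omap F X)) \<and>
     (\<forall>X Y. \<forall>f\<in>Hom C X Y. mmap F f \<in> Hom C (omap F X) (omap F Y)) \<and>
     (\<forall>X Y. linear_on (smul C) (smul C) (Hom C X Y) (mmap F)) \<and>
     (\<forall>X Y Z. \<forall>f\<in>Hom C X Y. \<forall>g\<in>Hom C Y Z. mmap F (g \<cdot>\<^bsub>C\<^esub> f) = mmap F g \<cdot>\<^bsub>C\<^esub> mmap F f)"

text \<open>\<open>\<eta> X : F(X[1]) \<rightarrow> F(X)[1]\<close> is the commutation isomorphism of a triangulated functor.\<close>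

definition exact_functor ::
  "('k::field, 'o, 'm::ab_group_add) tricat_data \<Rightarrow> ('o, 'm) endofunctor \<Rightarrow> bool" where
  "exact_functor C F \<longleftrightarrow> linear_functor C F \<and> (\<exists>\<eta>.
     (\<forall>X. iso_mor C (omap F (shO C 1 X)) (shO C 1 (omap F X)) (\<eta> X)) \<and>
     (\<forall>X Y. \<forall>f\<in>Hom C X Y. \<eta> Y \<cdot>\<^bsub>C\<^esub> mmap F (shM C 1 f) = shM C 1 (mmap F f) \<cdot>\<^bsub>C\<^esub> \<eta> X) \<and>
     (\<forall>X Y Z f g h. dtri C X Y Z f g h \<longrightarrow>
        dtri C (omap F X) (omap F Y) (omap F Z) (mmap F f) (mmap F g) (\<eta> X \<cdot>\<^bsub>C\<^esub> mmap F h)))"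

definition comp_iso_identity ::
  "('k::field, 'o, 'm::ab_group_add) tricat_data \<Rightarrow> ('o, 'm) endofunctor \<Rightarrow> ('o, 'm) endofunctor \<Rightarrow> bool"
  where
  "comp_iso_identity C G F \<longleftrightarrow> (\<exists>\<theta>.
     (\<forall>X. iso_mor C (omap G (omap F X)) X (\<theta> X)) \<and>
     (\<forall>X Y. \<forall>f\<in>Hom C X Y. \<theta> Y \<cdot>\<^bsub>C\<^esub> mmap G (mmap F f) = f \<cdot>\<^bsub>C\<^esub> \<theta> X))"

definition inverse_autoequivalences ::
  "('k::field, 'o, 'm::ab_group_add) tricat_data \<Rightarrow> ('o, 'm) endofunctor \<Rightarrow> ('o, 'm) endofunctor \<Rightarrow> bool"
  where
  "inverse_autoequivalences C F G \<longleftrightarrow> exact_functor C F \<and> exact_functor C G \<and>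
     comp_iso_identity C G F \<and> comp_iso_identity C F G"

text \<open>\<open>B i\<close> is a basis of \<open>Hom\<^sup>i(X,Y)\<close> for every \<open>i\<close>.\<close>

definition homogeneous_basis ::
  "('k::field, 'o, 'm::ab_group_add) tricat_data \<Rightarrow> 'o \<Rightarrow> 'o \<Rightarrow> (int \<Rightarrow> 'm set) \<Rightarrow> bool" where
  "homogeneous_basis C X Y B \<longleftrightarrow>
     (\<forall>i. \<not> module.dependent (smul C) (B i) \<and> module.span (smul C) (B i) = Hom_deg C i X Y)"

text \<open>
  \<open>Hom\<^sup>*(X,Y) \<otimes> X = \<Oplus>\<^sub>i Hom\<^sup>i(X,Y) \<otimes> X[-i]\<close> is a direct sum with one copy of \<open>X[-i]\<close> for each
  element \<open>b\<close> of a basis of \<open>Hom\<^sup>i(X,Y)\<close>; the evaluation map is \<open>b[-i] : X[-i] \<rightarrow> Y\<close> on that summand.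
  A change of basis induces an isomorphism of such sums that is compatible with evaluation,
  so the predicate does not depend on \<open>B\<close>.
\<close>

definition evaluation ::
  "('k::field, 'o, 'm::ab_group_add) tricat_data \<Rightarrow> 'o \<Rightarrow> 'o \<Rightarrow> 'o \<Rightarrow> 'm \<Rightarrow> bool" where
  "evaluation C X Y T e \<longleftrightarrow> (\<exists>B \<iota> \<pi>. homogeneous_basis C X Y B \<and>
     is_biproduct C (SIGMA i:UNIV. B i) (\<lambda>(i, b). shO C (- i) X) T \<iota> \<pi> \<and>
     e \<in> Hom C T Y \<and> (\<forall>i. \<forall>b\<in>B i. e \<cdot>\<^bsub>C\<^esub> \<iota> (i, b) = shM C (- i) b))"

text \<open>
  Dually, \<open>X \<otimes> Hom\<^sup>*(Y,X)\<^sup>\<or> = \<Oplus>\<^sub>i X[i] \<otimes> Hom\<^sup>i(Y,X)\<^sup>\<or>\<close>, with summands indexed by the basis dual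
  to a basis of \<open>Hom\<^sup>i(Y,X)\<close>; the component of the coevaluation map \<open>\<Sum> b\<^sup>\<or> \<otimes> b\<close> at the
  summand of the dual vector of \<open>b\<close> is \<open>b : Y \<rightarrow> X[i]\<close>.
\<close>

definition coevaluation ::
  "('k::field, 'o, 'm::ab_group_add) tricat_data \<Rightarrow> 'o \<Rightarrow> 'o \<Rightarrow> 'o \<Rightarrow> 'm \<Rightarrow> bool" where
  "coevaluation C X Y T e \<longleftrightarrow> (\<exists>B \<iota> \<pi>. homogeneous_basis C Y X B \<and>
     is_biproduct C (SIGMA i:UNIV. B i) (\<lambda>(i, b). shO C i X) T \<iota> \<pi> \<and>
     e \<in> Hom C Y T \<and> (\<forall>i. \<forall>b\<in>B i. \<pi> (i, b) \<cdot>\<^bsub>C\<^esub> e = b))"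

text \<open>\<open>\<sigma>\<close> is the twist \<open>\<sigma>\<^sub>X\<close> and \<open>\<sigma>'\<close> its inverse. Cones are not functorial in a bare
  triangulated category, so the twist is a datum; on objects the triangles determine both
  functors up to isomorphism.\<close>

definition spherical_twist ::
  "('k::field, 'o, 'm::ab_group_add) tricat_data \<Rightarrow> 'o \<Rightarrow>
     ('o, 'm) endofunctor \<Rightarrow> ('o, 'm) endofunctor \<Rightarrow> bool" where
  "spherical_twist C X \<sigma> \<sigma>' \<longleftrightarrow> inverse_autoequivalences C \<sigma> \<sigma>' \<and>
     (\<forall>Y. \<exists>T e p q. evaluation C X Y T e \<and> dtri C T Y (omap \<sigma> Y) e p q) \<and>
     (\<forall>Y. \<exists>T e p q. coevaluation C X Y T e \<and> dtri C (omap \<sigma>' Y) Y T p e q)"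

section \<open>Bridgeland stability conditions\<close>

text \<open>\<open>semist \<tau> \<phi>\<close> is the full subcategory \<open>P(\<phi>)\<close>. A homomorphism \<open>K(C) \<rightarrow> \<complex>\<close> is a
  function on objects that is additive on distinguished triangles.\<close>

record 'o stab_data =
  semist :: "real \<Rightarrow> 'o set"
  charge :: "'o \<Rightarrow> complex"

definition full_additive_subcat ::
  "('k::field, 'o, 'm::ab_group_add) tricat_data \<Rightarrow> 'o set \<Rightarrow> bool" where
  "full_additive_subcat C S \<longleftrightarrow>
     (\<forall>N. zero_obj C N \<longrightarrow> N \<in> S) \<and>
     (\<forall>X Y. X \<in> S \<longrightarrow> isomorphic C X Y \<longrightarrow> Y \<in> S) \<and>
     (\<forall>X Y T \<iota> \<pi>. X \<in> S \<longrightarrow> Y \<in> S \<longrightarrow>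
        is_biproduct C (UNIV :: bool set) (\<lambda>b. if b then X else Y) T \<iota> \<pi> \<longrightarrow> T \<in> S)"

text \<open>A Harder--Narasimhan filtration \<open>0 = E 0 \<rightarrow> \<dots> \<rightarrow> E n = Y\<close> with nonzero factors \<open>A j\<close> of
  phases \<open>\<phi> 0 > \<dots> > \<phi> (n - 1)\<close>.\<close>

definition HN_filtration ::
  "('k::field, 'o, 'm::ab_group_add) tricat_data \<Rightarrow> 'o stab_data \<Rightarrow> 'o \<Rightarrow>
     nat \<Rightarrow> (nat \<Rightarrow> real) \<Rightarrow> (nat \<Rightarrow> 'o) \<Rightarrow> bool" where
  "HN_filtration C \<tau> Y n \<phi> A \<longleftrightarrow> 0 < n \<and> (\<forall>i j. i < j \<longrightarrow> j < n \<longrightarrow> \<phi> j < \<phi> i) \<and>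
     (\<forall>j<n. A j \<in> semist \<tau> (\<phi> j) \<and> \<not> zero_obj C (A j)) \<and>
     (\<exists>E f g h. zero_obj C (E 0) \<and> E n = Y \<and>
        (\<forall>j<n. dtri C (E j) (E (Suc j)) (A j) (f j) (g j) (h j)))"

subsection \<open>Local finiteness\<close>

inductive_set extension_closure ::
  "('k::field, 'o, 'm::ab_group_add) tricat_data \<Rightarrow> 'o set \<Rightarrow> 'o set"
  for C :: "('k::field, 'o, 'm::ab_group_add) tricat_data" and S :: "'o set" where
  zero: "zero_obj C N \<Longrightarrow> N \<in> extension_closure C S"
| base: "X \<in> S \<Longrightarrow> X \<in> extension_closure C S"
| ext: "X \<in> extension_closure C S \<Longrightarrow> Z \<in> extension_closure C S \<Longrightarrow> dtri C X Y Z f g h \<Longrightarrow>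
    Y \<in> extension_closure C S"

definition semist_interval ::
  "('k::field, 'o, 'm::ab_group_add) tricat_data \<Rightarrow> 'o stab_data \<Rightarrow> real set \<Rightarrow> 'o set" where
  "semist_interval C \<tau> I = extension_closure C (\<Union>\<phi>\<in>I. semist \<tau> \<phi>)"

definition kernel_in ::
  "('k::field, 'o, 'm::ab_group_add) tricat_data \<Rightarrow> 'o set \<Rightarrow> 'o \<Rightarrow> 'o \<Rightarrow> 'o \<Rightarrow> 'm \<Rightarrow> 'm \<Rightarrow> bool" where
  "kernel_in C S A E B i p \<longleftrightarrow> i \<in> Hom C A E \<and> p \<in> Hom C E B \<and> p \<cdot>\<^bsub>C\<^esub> i = 0 \<and>
     (\<forall>W\<in>S. \<forall>w\<in>Hom C W E. p \<cdot>\<^bsub>C\<^esub> w = 0 \<longrightarrow> (\<exists>!u. u \<in> Hom C W A \<and> i \<cdot>\<^bsub>C\<^esub> u = w))"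

definition cokernel_in ::
  "('k::field, 'o, 'm::ab_group_add) tricat_data \<Rightarrow> 'o set \<Rightarrow> 'o \<Rightarrow> 'o \<Rightarrow> 'o \<Rightarrow> 'm \<Rightarrow> 'm \<Rightarrow> bool" where
  "cokernel_in C S A E B i p \<longleftrightarrow> i \<in> Hom C A E \<and> p \<in> Hom C E B \<and> p \<cdot>\<^bsub>C\<^esub> i = 0 \<and>
     (\<forall>W\<in>S. \<forall>w\<in>Hom C E W. w \<cdot>\<^bsub>C\<^esub> i = 0 \<longrightarrow> (\<exists>!u. u \<in> Hom C B W \<and> u \<cdot>\<^bsub>C\<^esub> p = w))"

text \<open>\<open>i : A \<rightarrow> E\<close> is a strict monomorphism of the quasi-abelian category \<open>S\<close>:
  it is the kernel of its cokernel.\<close>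

definition strict_mono_in ::
  "('k::field, 'o, 'm::ab_group_add) tricat_data \<Rightarrow> 'o set \<Rightarrow> 'o \<Rightarrow> 'o \<Rightarrow> 'm \<Rightarrow> bool" where
  "strict_mono_in C S A E i \<longleftrightarrow> A \<in> S \<and> E \<in> S \<and>
     (\<exists>B\<in>S. \<exists>p. cokernel_in C S A E B i p \<and> kernel_in C S A E B i p)"

text \<open>Descending and ascending chains of strict subobjects of any object of \<open>S\<close> stabilise.\<close>

definition finite_length_cat ::
  "('k::field, 'o, 'm::ab_group_add) tricat_data \<Rightarrow> 'o set \<Rightarrow> bool" where
  "finite_length_cat C S \<longleftrightarrow> (\<forall>E\<in>S. \<forall>A i u. (\<forall>n. strict_mono_in C S (A n) E (i n)) \<longrightarrow>
     ((\<forall>n. u n \<in> Hom C (A (Suc n)) (A n) \<and> i n \<cdot>\<^bsub>C\<^esub> u n = i (Suc n)) \<longrightarrow>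
        (\<exists>N. \<forall>n\<ge>N. iso_mor C (A (Suc n)) (A n) (u n))) \<and>
     ((\<forall>n. u n \<in> Hom C (A n) (A (Suc n)) \<and> i (Suc n) \<cdot>\<^bsub>C\<^esub> u n = i n) \<longrightarrow>
        (\<exists>N. \<forall>n\<ge>N. iso_mor C (A n) (A (Suc n)) (u n))))"

text \<open>The bound \<open>\<eta> < 1/2\<close> is implicit in Bridgeland's definition: \<open>P(I)\<close> is quasi-abelian
  for intervals \<open>I\<close> of length less than \<open>1\<close>.\<close>

definition locally_finite ::
  "('k::field, 'o, 'm::ab_group_add) tricat_data \<Rightarrow> 'o stab_data \<Rightarrow> bool" where
  "locally_finite C \<tau> \<longleftrightarrow> (\<exists>\<eta>>0. \<eta> < 1/2 \<and>
     (\<forall>t. finite_length_cat C (semist_interval C \<tau> {t - \<eta> <..< t + \<eta>})))"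

subsection \<open>Stability conditions, stable objects, phases\<close>

text \<open>Local finiteness is part of the notion, as for the points of Bridgeland's space of stability
  conditions; it provides Jordan--Hoelder filtrations in every \<open>P(\<phi>)\<close>.\<close>

definition stability_condition ::
  "('k::field, 'o, 'm::ab_group_add) tricat_data \<Rightarrow> 'o stab_data \<Rightarrow> bool" where
  "stability_condition C \<tau> \<longleftrightarrow>
     (\<forall>X Y Z f g h. dtri C X Y Z f g h \<longrightarrow> charge \<tau> Y = charge \<tau> X + charge \<tau> Z) \<and>
     (\<forall>\<phi>. full_additive_subcat C (semist \<tau> \<phi>)) \<and>
     (\<forall>\<phi> E. E \<in> semist \<tau> \<phi> \<longrightarrow> \<not> zero_obj C E \<longrightarrow>
        (\<exists>m>0. charge \<tau> E = of_real m * exp (\<i> * of_real (pi * \<phi>)))) \<and>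
     (\<forall>\<phi>. semist \<tau> (\<phi> + 1) = shO C 1 ` semist \<tau> \<phi>) \<and>
     (\<forall>\<phi> \<psi> A B. \<psi> < \<phi> \<longrightarrow> A \<in> semist \<tau> \<phi> \<longrightarrow> B \<in> semist \<tau> \<psi> \<longrightarrow> Hom C A B = {0}) \<and>
     (\<forall>Y. \<not> zero_obj C Y \<longrightarrow> (\<exists>n \<phi> A. HN_filtration C \<tau> Y n \<phi> A)) \<and>
     locally_finite C \<tau>"

definition mono_in ::
  "('k::field, 'o, 'm::ab_group_add) tricat_data \<Rightarrow> 'o set \<Rightarrow> 'o \<Rightarrow> 'o \<Rightarrow> 'm \<Rightarrow> bool" where
  "mono_in C S A E f \<longleftrightarrow> f \<in> Hom C A E \<and>
     (\<forall>W\<in>S. \<forall>u\<in>Hom C W A. \<forall>v\<in>Hom C W A. f \<cdot>\<^bsub>C\<^esub> u = f \<cdot>\<^bsub>C\<^esub> v \<longrightarrow> u = v)"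

text \<open>Stable objects are the simple objects of the abelian categories \<open>P(\<phi>)\<close>.\<close>

definition stable_obj ::
  "('k::field, 'o, 'm::ab_group_add) tricat_data \<Rightarrow> 'o stab_data \<Rightarrow> 'o \<Rightarrow> bool" where
  "stable_obj C \<tau> X \<longleftrightarrow> (\<exists>\<phi>. X \<in> semist \<tau> \<phi> \<and> \<not> zero_obj C X \<and>
     (\<forall>A\<in>semist \<tau> \<phi>. \<forall>f. mono_in C (semist \<tau> \<phi>) A X f \<longrightarrow> zero_obj C A \<or> iso_mor C A X f))"

text \<open>The following are meaningful for nonzero objects only, semistable ones for \<open>phase\<close>.\<close>

definition phase :: "'o stab_data \<Rightarrow> 'o \<Rightarrow> real" where
  "phase \<tau> X = (THE \<phi>. X \<in> semist \<tau> \<phi>)"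

definition phase_plus ::
  "('k::field, 'o, 'm::ab_group_add) tricat_data \<Rightarrow> 'o stab_data \<Rightarrow> 'o \<Rightarrow> real" where
  "phase_plus C \<tau> Y = (THE a. \<exists>n \<phi> A. HN_filtration C \<tau> Y n \<phi> A \<and> a = \<phi> 0)"

definition phase_minus ::
  "('k::field, 'o, 'm::ab_group_add) tricat_data \<Rightarrow> 'o stab_data \<Rightarrow> 'o \<Rightarrow> real" where
  "phase_minus C \<tau> Y = (THE a. \<exists>n \<phi> A. HN_filtration C \<tau> Y n \<phi> A \<and> a = \<phi> (n - 1))"

end

theory Submission
  imports Defs
begin

text \<open>
  Let \<open>t = \<phi>(X)\<close>. For part (1) let \<open>Y \<rightarrow> T\<close> be the coevaluation, where \<open>T\<close> is a sum of copies of
  \<open>X[i]\<close> with \<open>i \<ge> 0\<close>, and let \<open>F = \<sigma>\<^sub>X\<^sup>-\<^sup>1(Y)\<close> be its fibre. A map from \<open>F\<close> to a semistable object \<open>Z\<close> of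
  phase less than \<open>t\<close> is determined by the induced map \<open>T \<rightarrow> F[1] \<rightarrow> Z[1]\<close>, since \<open>Hom(Y,Z) = 0\<close>. The
  latter vanishes on \<open>Y\<close> and, for reasons of phase, lives on the summand
  \<open>X \<otimes> Hom(Y,X)\<^sup>\<or>\<close> of \<open>T\<close>; it is zero because the composition map
  \<open>Hom(X,Z[1]) \<otimes> Hom(Y,X) \<rightarrow> Hom(Y,Z[1])\<close> is injective: \<open>X\<close> is a simple object of the heart
  \<open>P[t,t+1)\<close>. So all phases of \<open>F\<close> are at least \<open>t\<close>. Moreover \<open>Hom(F,X) = 0\<close>, since the
  coevaluation induces isomorphisms on \<open>Hom(-,X)\<close> and \<open>Hom(-,X[1])\<close>. Every nonzero object of \<open>P(t)\<close>
  has a stable quotient, which must be \<open>X\<close>, so \<open>t\<close> is not a phase of \<open>F\<close> either.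
  Part (2) is part (1) in the opposite category.
\<close>

section \<open>Exact triangles\<close>

text \<open>Neither the heart \<open>P[t,t+1)\<close> nor the abelian structure of
  \<open>P(s)\<close> is constructed. Bounds on phases are vanishing statements for maps to or from
  semistable objects, and exactness is always that of a long exact Hom sequence. Simplicity of X in
  the heart is used in this form: let \<open>g : X \<rightarrow> W\<close> be nonzero with cone Q. A
  top factor of Q of phase at least \<open>t + 1\<close> would map monomorphically to
  \<open>X[1]\<close>, which by stability of X makes the connecting map
  \<open>Q \<rightarrow> X[1]\<close> a split epimorphism; since it is killed by
  \<open>g[1]\<close>, this forces \<open>g = 0\<close>. Injectivity on the tensor product, and not
  just on single compositions, comes from \<open>End(X) = k\<close>: a map that vanishes on the
  fibre of c is a scalar multiple of c. The existence of a stable quotient rests on two facts. The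
  central charge forces the cone of a monomorphism and the fibre of an epimorphism of
  \<open>P(s)\<close> back into \<open>P(s)\<close>, and local finiteness then stops chains of
  subobjects.\<close>

context linear_category
begin

lemma zero_Hom [simp, intro]: "0 \<in> Hom C X Y"
  using Hom_subspace subspace_0 by blast

lemma diff_Hom: "f \<in> Hom C X Y \<Longrightarrow> g \<in> Hom C X Y \<Longrightarrow> f - g \<in> Hom C X Y"
  using Hom_subspace subspace_diff by blast

lemma uminus_Hom: "f \<in> Hom C X Y \<Longrightarrow> - f \<in> Hom C X Y"
  using Hom_subspace subspace_neg by blast

lemma smul_Hom: "f \<in> Hom C X Y \<Longrightarrow> smul C r f \<in> Hom C X Y"
  using Hom_subspace subspace_scale by blast

lemma sum_Hom: "(\<And>j. j \<in> I \<Longrightarrow> f j \<in> Hom C X Y) \<Longrightarrow> sum f I \<in> Hom C X Y"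
  using Hom_subspace subspace_sum by blast

lemma cmp_zero_right [simp]: "g \<in> Hom C Y Z \<Longrightarrow> g \<cdot> 0 = 0"
  using cmp_add_right[of 0 Y Y 0 g Z] by simp

lemma cmp_zero_left [simp]: "f \<in> Hom C X Y \<Longrightarrow> 0 \<cdot> f = 0"
  using cmp_add_left[of f X Y 0 Y 0] by simp

lemma cmp_uminus_right: "f \<in> Hom C X Y \<Longrightarrow> g \<in> Hom C Y Z \<Longrightarrow> g \<cdot> (- f) = - (g \<cdot> f)"
  using cmp_add_right[of f X Y "- f" g Z] by (simp add: uminus_Hom eq_neg_iff_add_eq_0 add.commute)

lemma cmp_uminus_left: "f \<in> Hom C X Y \<Longrightarrow> g \<in> Hom C Y Z \<Longrightarrow> (- g) \<cdot> f = - (g \<cdot> f)"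
  using cmp_add_left[of f X Y g Z "- g"] by (simp add: uminus_Hom eq_neg_iff_add_eq_0 add.commute)

lemma cmp_diff_right:
  "f \<in> Hom C X Y \<Longrightarrow> f' \<in> Hom C X Y \<Longrightarrow> g \<in> Hom C Y Z \<Longrightarrow> g \<cdot> (f - f') = g \<cdot> f - g \<cdot> f'"
  using cmp_add_right[of f X Y "- f'" g Z] by (simp add: uminus_Hom cmp_uminus_right)

lemma cmp_diff_left:
  "f \<in> Hom C X Y \<Longrightarrow> g \<in> Hom C Y Z \<Longrightarrow> g' \<in> Hom C Y Z \<Longrightarrow> (g - g') \<cdot> f = g \<cdot> f - g' \<cdot> f"
  using cmp_add_left[of f X Y g Z "- g'"] by (simp add: uminus_Hom cmp_uminus_left)

lemma cmp_sum_left: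
  assumes "finite I" "f \<in> Hom C X Y" "\<And>j. j \<in> I \<Longrightarrow> g j \<in> Hom C Y Z"
  shows "sum g I \<cdot> f = (\<Sum>j\<in>I. g j \<cdot> f)"
  using assms(1,3)
proof induction
  case empty
  then show ?case using assms(2) by simp
next
  case (insert x I)
  then have "(g x + sum g I) \<cdot> f = g x \<cdot> f + sum g I \<cdot> f"
    by (intro cmp_add_left[OF assms(2)] sum_Hom) auto
  with insert show ?case by simp
qed

lemma cmp_sum_right:
  assumes "finite I" "g \<in> Hom C Y Z" "\<And>j. j \<in> I \<Longrightarrow> f j \<in> Hom C X Y"
  shows "g \<cdot> sum f I = (\<Sum>j\<in>I. g \<cdot> f j)"
  using assms(1,3)
proof induction
  case empty
  then show ?case using assms(2) by simp
next
  case (insert x I)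
  then have "g \<cdot> (f x + sum f I) = g \<cdot> f x + g \<cdot> sum f I"
    by (intro cmp_add_right[OF _ _ assms(2)] sum_Hom) auto
  with insert show ?case by simp
qed

lemma zero_obj_iff: "zero_obj C N \<longleftrightarrow> idm C N = 0"
proof
  show "zero_obj C N \<Longrightarrow> idm C N = 0"
    using idm_Hom[of N] unfolding zero_obj_def by auto
  assume 0: "idm C N = 0"
  show "zero_obj C N"
    unfolding zero_obj_def
    using cmp_idm_left[of _ _ N] cmp_idm_right[of _ N] cmp_zero_left cmp_zero_right
    by (auto simp: 0)
qed

lemma Hom_zero_obj: "zero_obj C N \<Longrightarrow> f \<in> Hom C N X \<Longrightarrow> f = 0"
  "zero_obj C N \<Longrightarrow> f \<in> Hom C X N \<Longrightarrow> f = 0"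
  by (auto simp: zero_obj_def)

lemma iso_mor_zero_obj:
  assumes "iso_mor C X Y f" "zero_obj C X" shows "zero_obj C Y"
proof -
  obtain g where g: "g \<in> Hom C Y X" "f \<cdot> g = idm C Y" and f: "f \<in> Hom C X Y"
    using assms(1) unfolding iso_mor_def by blast
  have "g = 0" using Hom_zero_obj(2)[OF assms(2) g(1)] .
  with g f show ?thesis by (simp add: zero_obj_iff)
qed

lemma split_mono_cancel:
  assumes "i \<in> Hom C A B" "r \<in> Hom C B A" "r \<cdot> i = idm C A" "x \<in> Hom C U A" "i \<cdot> x = 0"
  shows "x = 0"
  using cmp_assoc[OF assms(4,1,2)] assms cmp_idm_left[OF assms(4)] by simp

end

text \<open>A self-dual extract of a triangulated structure: the \<open>tri_lift\<close> axioms are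
  exactness of \<open>Hom(W,-)\<close> at three consecutive places of a triangle, the
  \<open>tri_fact\<close> axioms that of \<open>Hom(-,W)\<close>. Listing all three places instead
  of a rotation axiom keeps signs out of the passage to the opposite category.\<close>

locale exact_triangles = linear_category C
  for C :: "('k::field, 'o, 'm::ab_group_add) tricat_data" (structure) +
  assumes sh_Hom: "f \<in> Hom C X Y \<Longrightarrow> shM C m f \<in> Hom C (shO C m X) (shO C m Y)"
    and sh_idm: "shM C m (idm C X) = idm C (shO C m X)"
    and sh_cmp: "f \<in> Hom C X Y \<Longrightarrow> g \<in> Hom C Y Z \<Longrightarrow> shM C m (g \<cdot> f) = shM C m g \<cdot> shM C m f"
    and sh_add: "f \<in> Hom C X Y \<Longrightarrow> g \<in> Hom C X Y \<Longrightarrow> shM C m (f + g) = shM C m f + shM C m g"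
    and sh_smul: "f \<in> Hom C X Y \<Longrightarrow> shM C m (smul C r f) = smul C r (shM C m f)"
    and shO_0 [simp]: "shO C 0 X = X"
    and shO_add: "shO C (m + n) X = shO C m (shO C n X)"
    and shM_0: "f \<in> Hom C X Y \<Longrightarrow> shM C 0 f = f"
    and shM_add: "f \<in> Hom C X Y \<Longrightarrow> shM C (m + n) f = shM C m (shM C n f)"
    and tri_Hom: "dtri C X Y Z f g h \<Longrightarrow>
          f \<in> Hom C X Y \<and> g \<in> Hom C Y Z \<and> h \<in> Hom C Z (shO C 1 X)"
    and tri_comp1: "dtri C X Y Z f g h \<Longrightarrow> g \<cdot> f = 0"
    and tri_comp2: "dtri C X Y Z f g h \<Longrightarrow> h \<cdot> g = 0"
    and tri_comp3: "dtri C X Y Z f g h \<Longrightarrow> shM C 1 f \<cdot> h = 0"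
    and tri_lift1: "dtri C X Y Z f g h \<Longrightarrow> w \<in> Hom C W Y \<Longrightarrow> g \<cdot> w = 0 \<Longrightarrow>
          \<exists>u\<in>Hom C W X. w = f \<cdot> u"
    and tri_lift2: "dtri C X Y Z f g h \<Longrightarrow> w \<in> Hom C W Z \<Longrightarrow> h \<cdot> w = 0 \<Longrightarrow>
          \<exists>u\<in>Hom C W Y. w = g \<cdot> u"
    and tri_lift3: "dtri C X Y Z f g h \<Longrightarrow> w \<in> Hom C W (shO C 1 X) \<Longrightarrow> shM C 1 f \<cdot> w = 0 \<Longrightarrow>
          \<exists>u\<in>Hom C W Z. w = h \<cdot> u"
    and tri_fact1: "dtri C X Y Z f g h \<Longrightarrow> w \<in> Hom C Y W \<Longrightarrow> w \<cdot> f = 0 \<Longrightarrow>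
          \<exists>u\<in>Hom C Z W. w = u \<cdot> g"
    and tri_fact2: "dtri C X Y Z f g h \<Longrightarrow> w \<in> Hom C Z W \<Longrightarrow> w \<cdot> g = 0 \<Longrightarrow>
          \<exists>u\<in>Hom C (shO C 1 X) W. w = u \<cdot> h"
    and tri_fact3: "dtri C X Y Z f g h \<Longrightarrow> w \<in> Hom C (shO C 1 X) W \<Longrightarrow> w \<cdot> h = 0 \<Longrightarrow>
          \<exists>u\<in>Hom C (shO C 1 Y) W. w = u \<cdot> shM C 1 f"
    and cone_ex: "f \<in> Hom C X Y \<Longrightarrow> \<exists>Z g h. dtri C X Y Z f g h"
    and fibre_ex: "g \<in> Hom C Y Z \<Longrightarrow> \<exists>X f h. dtri C X Y Z f g h"
begin

lemma shO_inverse [simp]: "shO C (- m) (shO C m X) = X" "shO C m (shO C (- m) X) = X"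
  using shO_add[of "- m" m X] shO_add[of m "- m" X] by simp_all

lemma shM_inverse:
  assumes "f \<in> Hom C X Y" 
  shows "shM C (- m) (shM C m f) = f" "shM C m (shM C (- m) f) = f"
  using shM_add[OF assms, of "- m" m] shM_add[OF assms, of m "- m"] shM_0[OF assms] by simp_all

lemma sh_zero [simp]: "shM C m 0 = 0"
  using sh_add[OF zero_Hom zero_Hom, of m] by simp

lemma sh_eq_zero_iff: "f \<in> Hom C X Y \<Longrightarrow> shM C m f = 0 \<longleftrightarrow> f = 0"
  using shM_inverse(1) sh_zero by metis

lemma shM_Hom_minus:
  "f \<in> Hom C (shO C m X) Y \<Longrightarrow> shM C (- m) f \<in> Hom C X (shO C (- m) Y)"
  "f \<in> Hom C X (shO C m Y) \<Longrightarrow> shM C (- m) f \<in> Hom C (shO C (- m) X) Y"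
  using sh_Hom[of f "shO C m X" Y "- m"] sh_Hom[of f X "shO C m Y" "- m"] by simp_all

lemma Hom_shift_zero_iff: "Hom C (shO C m X) (shO C m Y) = {0} \<longleftrightarrow> Hom C X Y = {0}"
proof
  assume *: "Hom C (shO C m X) (shO C m Y) = {0}"
  have "f = 0" if "f \<in> Hom C X Y" for f
    using sh_Hom[OF that, of m] * sh_eq_zero_iff[OF that, of m] by simp
  then show "Hom C X Y = {0}" using zero_Hom by blast
next
  assume *: "Hom C X Y = {0}"
  have "f = 0" if "f \<in> Hom C (shO C m X) (shO C m Y)" for f
    using sh_Hom[OF that, of "- m"] * sh_eq_zero_iff[OF that, of "- m"] by simp
  then show "Hom C (shO C m X) (shO C m Y) = {0}" using zero_Hom by blast
qed

lemma zero_obj_shift: "zero_obj C (shO C m X) \<longleftrightarrow> zero_obj C X"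
  using sh_eq_zero_iff[OF idm_Hom, of m X] by (simp add: zero_obj_iff sh_idm)

end

text \<open>Everything is TR3 applied to a given triangle and a trivial one. Rotation moves the
  result to the other places; the sign it introduces is absorbed into the lift or the
  factorisation.\<close>

sublocale triangulated_category \<subseteq> et: exact_triangles C
proof -
  have sh_zero: "shM C m 0 = 0" for m
    using shM_add[OF zero_Hom zero_Hom, of m] by simp
  have sh_uminus: "shM C m (- f) = - shM C m f" if "f \<in> Hom C X Y" for f X Y m
    using shM_add[OF that uminus_Hom[OF that], of m] sh_zero
    by (simp add: eq_neg_iff_add_eq_0 add.commute)
  have inv: "shO C (- m) (shO C m X) = X" "shO C m (shO C (- m) X) = X" for m X
    using shO_plus[of "- m" m X] shO_plus[of m "- m" X] by (simp_all add: shO_0)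
  have invM: "shM C (- m) (shM C m f) = f" "shM C m (shM C (- m) f) = f" if "f \<in> Hom C X Y" for m f X Y
    using shM_plus[OF that, of "- m" m] shM_plus[OF that, of m "- m"] shM_0[OF that] by simp_all
  note dH = dtri_Hom
  have rot: "dtri C Y Z (shO C 1 X) g h (- shM C 1 f)" if "dtri C X Y Z f g h" for X Y Z f g h
    using that TR2 dH by blast
  have c1: "g \<cdot> f = 0" if t: "dtri C X Y Z f g h" for X Y Z f g h
  proof -
    obtain N where N: "zero_obj C N" using zero_ex by blast
    have "\<exists>c\<in>Hom C N Z. c \<cdot> 0 = g \<cdot> f \<and> shM C 1 (idm C X) \<cdot> 0 = h \<cdot> c"
      by (rule TR3[OF TR1_idm[OF N] t idm_Hom]) (use dH[OF t] in auto)
    then show ?thesis by auto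
  qed
  have l1: "\<exists>u\<in>Hom C W X. w = f \<cdot> u"
    if t: "dtri C X Y Z f g h" and w: "w \<in> Hom C W Y" "g \<cdot> w = 0" for X Y Z f g h W w
  proof -
    obtain N where N: "zero_obj C N" using zero_ex by blast
    \<comment> \<open>TR3 fills in the third map of a morphism of triangles, whereas the first one
      is wanted. Both triangles are therefore rotated once, and the fill-in \<open>c\<close> is
      shifted back by one.\<close>
    have "\<exists>c\<in>Hom C (shO C 1 W) (shO C 1 X). c \<cdot> 0 = h \<cdot> 0 \<and>
        shM C 1 w \<cdot> (- shM C 1 (idm C W)) = (- shM C 1 f) \<cdot> c"
      by (rule TR3[OF rot[OF TR1_idm[OF N]] rot[OF t] w(1)])
        (use dH[OF t] w in \<open>auto simp: cmp_zero_left[OF idm_Hom] cmp_zero_left[OF zero_Hom]\<close>)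
    then obtain c where c: "c \<in> Hom C (shO C 1 W) (shO C 1 X)"
      "shM C 1 w \<cdot> (- shM C 1 (idm C W)) = (- shM C 1 f) \<cdot> c" by blast
    have f: "f \<in> Hom C X Y" using dH[OF t] by blast
    have "shM C 1 w = shM C 1 f \<cdot> c"
      using c(2) cmp_uminus_right[OF shM_Hom[OF idm_Hom] shM_Hom[OF w(1)], of 1]
        cmp_uminus_left[OF c(1) shM_Hom[OF f]] cmp_idm_right[OF shM_Hom[OF w(1)], of 1]
      by (simp add: shM_idm)
    then have "shM C (- 1) (shM C 1 w) = shM C (- 1) (shM C 1 f) \<cdot> shM C (- 1) c"
      using shM_cmp[OF c(1) shM_Hom[OF f]] by simp
    moreover have "shM C (- 1) c \<in> Hom C W X" using shM_Hom[OF c(1), of "- 1"] by (simp only: inv)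
    ultimately show ?thesis using invM f w by metis
  qed
  have f1: "\<exists>u\<in>Hom C Z W. w = u \<cdot> g"
    if t: "dtri C X Y Z f g h" and w: "w \<in> Hom C Y W" "w \<cdot> f = 0" for X Y Z f g h W w
  proof -
    obtain N where N: "zero_obj C N" using zero_ex by blast
    have N1: "zero_obj C (shO C 1 N)" using N shM_idm[of 1 N] by (simp add: zero_obj_iff sh_zero)
    \<comment> \<open>The identity triangle on \<open>W\<close> rotated backwards; its zero vertex
      has to be written as a shift, hence \<open>N1\<close>.\<close>
    have t': "dtri C N W W 0 (idm C W) 0"
      using TR2[of 0 N W W "idm C W" 0] TR1_idm[OF N1, of W] by (simp add: sh_zero)
    have "\<exists>c\<in>Hom C Z W. c \<cdot> g = idm C W \<cdot> w \<and> shM C 1 0 \<cdot> h = 0 \<cdot> c"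
      by (rule TR3[OF t t' zero_Hom w(1)]) (use w dH[OF t] in \<open>auto simp: cmp_zero_left[of 0 X N]\<close>)
    then show ?thesis using cmp_idm_left[OF w(1)] by force
  qed
  show "exact_triangles C"
  proof
    show "\<exists>u\<in>Hom C W X. w = f \<cdot> u" if "dtri C X Y Z f g h" "w \<in> Hom C W Y" "g \<cdot> w = 0" for X Y Z f g h W w
      using l1 that .
    show "\<exists>u\<in>Hom C Z W. w = u \<cdot> g" if "dtri C X Y Z f g h" "w \<in> Hom C Y W" "w \<cdot> f = 0" for X Y Z f g h W w
      using f1 that .
    show "g \<cdot> f = 0" "h \<cdot> g = 0" if "dtri C X Y Z f g h" for X Y Z f g h
      using c1 rot that by blast+
    show "shM C 1 f \<cdot> h = 0" if t: "dtri C X Y Z f g h" for X Y Z f g h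
      using c1[OF rot[OF rot[OF t]]] dH[OF t] cmp_uminus_left[of h Z _ "shM C 1 f"] shM_Hom by fastforce
    show "\<exists>u\<in>Hom C W Y. w = g \<cdot> u" if t: "dtri C X Y Z f g h" "w \<in> Hom C W Z" "h \<cdot> w = 0" for X Y Z f g h W w
      using l1[OF rot[OF t(1)]] t by blast
    show "\<exists>u\<in>Hom C W Z. w = h \<cdot> u"
      if t: "dtri C X Y Z f g h" "w \<in> Hom C W (shO C 1 X)" "shM C 1 f \<cdot> w = 0" for X Y Z f g h W w
      using l1[OF rot[OF rot[OF t(1)]] t(2)] t dH[OF t(1)] cmp_uminus_left[OF t(2) shM_Hom] by fastforce
    show "\<exists>u\<in>Hom C (shO C 1 X) W. w = u \<cdot> h"
      if t: "dtri C X Y Z f g h" "w \<in> Hom C Z W" "w \<cdot> g = 0" for X Y Z f g h W w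
      using f1[OF rot[OF t(1)]] t by blast
    show "\<exists>u\<in>Hom C (shO C 1 Y) W. w = u \<cdot> shM C 1 f"
      if t: "dtri C X Y Z f g h" "w \<in> Hom C (shO C 1 X) W" "w \<cdot> h = 0" for X Y Z f g h W w
    proof -
      have f: "f \<in> Hom C X Y" using dH[OF t(1)] by blast
      obtain u where u: "u \<in> Hom C (shO C 1 Y) W" "w = u \<cdot> (- shM C 1 f)"
        using f1[OF rot[OF rot[OF t(1)]] t(2,3)] by blast
      then have "w = (- u) \<cdot> shM C 1 f"
        using cmp_uminus_right[OF shM_Hom[OF f] u(1)] cmp_uminus_left[OF shM_Hom[OF f] u(1)] by simp
      then show ?thesis using uminus_Hom[OF u(1)] by blast
    qed
    show "\<exists>X f h. dtri C X Y Z f g h" if g: "g \<in> Hom C Y Z" for Y Z g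
    proof -
      obtain V k l where t: "dtri C Y Z V g k l" using TR1_cone[OF g] by blast
      \<comment> \<open>The cone of \<open>g\<close> rotated backwards. The sign in \<open>f\<close>
        cancels the one in TR2.\<close>
      define X where "X = shO C (- 1) V"
      define f where "f = - shM C (- 1) l"
      have l: "l \<in> Hom C V (shO C 1 Y)" using dH[OF t] by blast
      have X: "shO C 1 X = V" by (simp add: X_def inv)
      have f: "f \<in> Hom C X Y"
        using uminus_Hom[OF shM_Hom[OF l, of "- 1"]] unfolding f_def X_def by (simp only: inv)
      have "- shM C 1 f = l"
        using sh_uminus[OF f, of 1] invM(2)[OF l, of 1] unfolding f_def by simp
      then show ?thesis using TR2[OF f, of Z g k] t X by metis
    qed
  qed (fact shM_Hom shM_idm shM_cmp shM_add shM_smul shO_0 shO_plus shM_0 shM_plus dtri_Hom TR1_cone)+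
qed

section \<open>A simple object of a slicing\<close>

text \<open>
  The abstract setting is stable under passing to the opposite category, so that the second half
  of the theorem is the first one for the opposite. This is why it uses only the two extreme
  Harder--Narasimhan factors of an object: the opposite of a whole filtration would need the
  octahedral axiom.
\<close>

locale simple_object = exact_triangles C
  for C :: "('k::field, 'o, 'm::ab_group_add) tricat_data" (structure)
    and P :: "real \<Rightarrow> 'o set" and X :: 'o and t :: real +
  assumes P_shift: "A \<in> P s \<Longrightarrow> shO C m A \<in> P (s + of_int m)"
    and P_Hom: "r < s \<Longrightarrow> A \<in> P s \<Longrightarrow> B \<in> P r \<Longrightarrow> Hom C A B = {0}"
    and max_factor: "\<not> zero_obj C Y \<Longrightarrow> \<exists>s A i. A \<in> P s \<and> \<not> zero_obj C A \<and> i \<in> Hom C A Y \<and>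
          (\<forall>U. (\<forall>r\<le>s. \<forall>B\<in>P r. Hom C U B = {0}) \<longrightarrow> Hom C U Y = {0}) \<and>
          (\<forall>U h. (\<forall>r<s. \<forall>B\<in>P r. Hom C U B = {0}) \<longrightarrow> h \<in> Hom C U A \<longrightarrow> i \<cdot> h = 0 \<longrightarrow> h = 0)"
    and min_factor: "\<not> zero_obj C Y \<Longrightarrow> \<exists>s A p. A \<in> P s \<and> \<not> zero_obj C A \<and> p \<in> Hom C Y A \<and>
          (\<forall>U. (\<forall>r\<ge>s. \<forall>B\<in>P r. Hom C B U = {0}) \<longrightarrow> Hom C Y U = {0}) \<and>
          (\<forall>U h. (\<forall>r>s. \<forall>B\<in>P r. Hom C B U = {0}) \<longrightarrow> h \<in> Hom C A U \<longrightarrow> h \<cdot> p = 0 \<longrightarrow> h = 0)"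
    and X_P: "X \<in> P t"
    and mono_split: "A \<in> P t \<Longrightarrow> \<not> zero_obj C A \<Longrightarrow> f \<in> Hom C A X \<Longrightarrow>
          (\<And>U h. U \<in> P t \<Longrightarrow> h \<in> Hom C U A \<Longrightarrow> f \<cdot> h = 0 \<Longrightarrow> h = 0) \<Longrightarrow>
          \<exists>k\<in>Hom C X A. f \<cdot> k = idm C X"
    and epi_split: "A \<in> P t \<Longrightarrow> \<not> zero_obj C A \<Longrightarrow> f \<in> Hom C X A \<Longrightarrow>
          (\<And>U h. U \<in> P t \<Longrightarrow> h \<in> Hom C A U \<Longrightarrow> h \<cdot> f = 0 \<Longrightarrow> h = 0) \<Longrightarrow>
          \<exists>k\<in>Hom C A X. k \<cdot> f = idm C X"
    and generates: "A \<in> P t \<Longrightarrow> \<not> zero_obj C A \<Longrightarrow> Hom C X A \<noteq> {0}"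
    and cogenerates: "A \<in> P t \<Longrightarrow> \<not> zero_obj C A \<Longrightarrow> Hom C A X \<noteq> {0}"
    and End_scalar: "f \<in> Hom C X X \<Longrightarrow> \<exists>c. f = smul C c (idm C X)"
    and Ext1_zero: "Hom C X (shO C 1 X) = {0}"
begin

text \<open>For nonzero \<open>U\<close> this is the bound \<open>s \<le> phase_minus\<close>, and
  \<open>gt\<close> is the strict bound, stated through orthogonality. In this form it also makes
  sense for zero objects and passes through triangles without any filtration.\<close>

definition ge :: "real \<Rightarrow> 'o \<Rightarrow> bool" where
  "ge s U \<longleftrightarrow> (\<forall>r<s. \<forall>B\<in>P r. Hom C U B = {0})"

definition gt :: "real \<Rightarrow> 'o \<Rightarrow> bool" where
  "gt s U \<longleftrightarrow> (\<forall>r\<le>s. \<forall>B\<in>P r. Hom C U B = {0})"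

lemma ge_zero: "ge s U \<Longrightarrow> r < s \<Longrightarrow> B \<in> P r \<Longrightarrow> f \<in> Hom C U B \<Longrightarrow> f = 0"
  unfolding ge_def by blast

lemma P_zero: "r < s \<Longrightarrow> A \<in> P s \<Longrightarrow> B \<in> P r \<Longrightarrow> f \<in> Hom C A B \<Longrightarrow> f = 0"
  using P_Hom by blast

lemma P_ge: "A \<in> P s \<Longrightarrow> r \<le> s \<Longrightarrow> ge r A"
  unfolding ge_def using P_Hom[of _ s A] less_le_trans[of _ r s] by blast

lemma ge_gt: "ge s U \<Longrightarrow> r < s \<Longrightarrow> gt r U"
  unfolding ge_def gt_def using le_less_trans[of _ r s] by blast

lemma max_factor_gt:
  "\<not> zero_obj C Y \<Longrightarrow> \<exists>s A i. A \<in> P s \<and> \<not> zero_obj C A \<and> i \<in> Hom C A Y \<and>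
    (\<forall>U. gt s U \<longrightarrow> Hom C U Y = {0}) \<and>
    (\<forall>U h. ge s U \<longrightarrow> h \<in> Hom C U A \<longrightarrow> i \<cdot> h = 0 \<longrightarrow> h = 0)"
  unfolding gt_def ge_def by (fact max_factor)

lemma P_unshift: "B \<in> P r \<Longrightarrow> shO C (- m) B \<in> P (r - of_int m)"
  using P_shift[of B r "- m"] by simp

lemma ge_shift: "ge s U \<Longrightarrow> ge (s + of_int m) (shO C m U)"
  unfolding ge_def
proof (intro allI impI ballI)
  fix r B assume *: "\<forall>r<s. \<forall>B\<in>P r. Hom C U B = {0}" and r: "r < s + of_int m" and B: "B \<in> P r"
  have "Hom C U (shO C (- m) B) = {0}" using *[rule_format, OF _ P_unshift[OF B]] r by simp
  then show "Hom C (shO C m U) B = {0}" using Hom_shift_zero_iff[of m U "shO C (- m) B"] by simp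
qed

text \<open>A nonzero map from \<open>X\<close> to an object of the heart \<open>P[t,t+1)\<close> is a monomorphism there,
  because \<open>X\<close> is simple of the lowest phase of that heart.\<close>

lemma cone_of_nonzero:
  assumes g: "dtri C X W Q g g' g''" "g \<noteq> 0" and W: "W \<in> P s" "s < t + 1"
    and U: "ge (t + 1) U"
  shows "Hom C U Q = {0}"
proof (cases "zero_obj C Q")
  case True
  then show ?thesis by (simp add: zero_obj_def)
next
  case False
  have H: "g \<in> Hom C X W" "g' \<in> Hom C W Q" "g'' \<in> Hom C Q (shO C 1 X)" using tri_Hom[OF g(1)] by auto
  obtain \<eta> A i where A: "A \<in> P \<eta>" "\<not> zero_obj C A" "i \<in> Hom C A Q"
    and up: "\<And>U. gt \<eta> U \<Longrightarrow> Hom C U Q = {0}"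
    and inj: "\<And>U h. ge \<eta> U \<Longrightarrow> h \<in> Hom C U A \<Longrightarrow> i \<cdot> h = 0 \<Longrightarrow> h = 0"
    using max_factor_gt[OF False] by blast
  show ?thesis
  proof (cases "\<eta> < t + 1")
    case True
    with ge_gt[OF U] up show ?thesis by blast
  next
    case False
    \<comment> \<open>\<open>A\<close> is the top factor of \<open>Q\<close> and is now assumed to
      have phase at least \<open>t + 1\<close>. A map into \<open>A\<close> killed by
      \<open>f\<close> lifts, after composition with \<open>i\<close>, to \<open>W\<close>, whose
      phase is too small to receive it; so \<open>f\<close> behaves as a monomorphism on test
      objects of phase at least \<open>\<eta>\<close>.\<close>
    define f where "f = g'' \<cdot> i"
    have f: "f \<in> Hom C A (shO C 1 X)" unfolding f_def using cmp_Hom A(3) H(3) .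
    have mono: "h = 0" if "V \<in> P r" "r \<ge> \<eta>" "h \<in> Hom C V A" "f \<cdot> h = 0" for V r h
    proof -
      have ih: "i \<cdot> h \<in> Hom C V Q" using cmp_Hom that A by blast
      have "g'' \<cdot> (i \<cdot> h) = 0" using that cmp_assoc[OF that(3) A(3) H(3)] unfolding f_def by simp
      then obtain y where y: "y \<in> Hom C V W" "i \<cdot> h = g' \<cdot> y" using tri_lift2[OF g(1) ih] by blast
      have "y = 0" using P_zero[OF _ that(1) W(1) y(1)] that(2) W(2) False by simp
      then have "i \<cdot> h = 0" using y H by simp
      then show ?thesis using inj[of V h] P_ge[OF that(1,2)] that(3) by blast
    qed
    have X1: "shO C 1 X \<in> P (t + 1)" using P_shift[OF X_P, of 1] by simp
    have "\<not> \<eta> > t + 1"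
    proof
      assume "\<eta> > t + 1"
      then have "f = 0" using P_zero[OF _ A(1) X1 f] by simp
      then have "idm C A = 0" using mono[OF A(1) order.refl idm_Hom] by (simp add: cmp_zero_left[OF idm_Hom])
      then show False using A(2) by (simp add: zero_obj_iff)
    qed
    with False have \<eta>: "\<eta> = t + 1" by simp
    have A': "shO C (- 1) A \<in> P t" using P_unshift[OF A(1), of 1] \<eta> by simp
    have f': "shM C (- 1) f \<in> Hom C (shO C (- 1) A) X" using shM_Hom_minus(2)[OF f] by simp
    \<comment> \<open>At the one remaining phase \<open>t + 1\<close>, the shift of \<open>f\<close>
      is a monomorphism of \<open>P t\<close> from a nonzero object into the simple object
      X.\<close>
    have "\<exists>k\<in>Hom C X (shO C (- 1) A). shM C (- 1) f \<cdot> k = idm C X"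
    proof (rule mono_split[OF A' _ f'])
      show "\<not> zero_obj C (shO C (- 1) A)" using A(2) zero_obj_shift by blast
      fix U h assume h: "U \<in> P t" "h \<in> Hom C U (shO C (- 1) A)" "shM C (- 1) f \<cdot> h = 0"
      have h1: "shM C 1 h \<in> Hom C (shO C 1 U) A" using sh_Hom[OF h(2), of 1] shO_inverse(2)[of 1 A] by simp
      have U1: "shO C 1 U \<in> P (t + 1)" using P_shift[OF h(1), of 1] by simp
      have "f \<cdot> shM C 1 h = shM C 1 (shM C (- 1) f \<cdot> h)"
        using sh_cmp[OF h(2) f', of 1] shM_inverse(2)[OF f, of 1] by simp
      then have "shM C 1 h = 0" using mono[OF U1 _ h1] h(3) \<eta> by simp
      then show "h = 0" using sh_eq_zero_iff[OF h(2)] by blast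
    qed
    then obtain k where k: "k \<in> Hom C X (shO C (- 1) A)" "shM C (- 1) f \<cdot> k = idm C X" by blast
    have k1: "shM C 1 k \<in> Hom C (shO C 1 X) A" using sh_Hom[OF k(1), of 1] shO_inverse(2)[of 1 A] by simp
    have fk: "f \<cdot> shM C 1 k = idm C (shO C 1 X)"
      using sh_cmp[OF k(1) f', of 1] k(2) shM_inverse(2)[OF f, of 1] by (simp add: sh_idm)
    have g1: "shM C 1 g \<in> Hom C (shO C 1 X) (shO C 1 W)" using sh_Hom[OF H(1)] .
    \<comment> \<open>The section makes \<open>g'' \<cdot> i\<close> a split epimorphism onto
      \<open>X[1]\<close>, while consecutive maps of a triangle compose to zero; hence
      \<open>g\<close> itself vanishes.\<close>
    have "shM C 1 g = shM C 1 g \<cdot> (f \<cdot> shM C 1 k)" using cmp_idm_right[OF g1] fk by simp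
    also have "\<dots> = (shM C 1 g \<cdot> f) \<cdot> shM C 1 k" using cmp_assoc[OF k1 f g1] by simp
    also have "shM C 1 g \<cdot> f = (shM C 1 g \<cdot> g'') \<cdot> i"
      unfolding f_def using cmp_assoc[OF A(3) H(3) g1] by simp
    also have "\<dots> = 0" using tri_comp3[OF g(1)] cmp_zero_left[OF A(3)] by simp
    finally have "shM C 1 g = 0" using cmp_zero_left[OF k1] by simp
    then show ?thesis using g(2) sh_eq_zero_iff[OF H(1)] by blast
  qed
qed

text \<open>If the composite were zero, \<open>c[1]\<close> would factor through the connecting map
  of the cone of \<open>g\<close>. But \<open>Y[1]\<close> has phases at least \<open>t + 1\<close>,
  and by \<open>cone_of_nonzero\<close> it has no maps to that cone. This is the rank-one case of
  the injectivity in \<open>independent_comp\<close>.\<close>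

lemma comp_nonzero:
  assumes Y: "ge t Y" and c: "c \<in> Hom C Y X" "c \<noteq> 0" and g: "g \<in> Hom C X W" "g \<noteq> 0"
    and W: "W \<in> P s" "s < t + 1"
  shows "g \<cdot> c \<noteq> 0"
proof
  assume gc: "g \<cdot> c = 0"
  obtain Q g' g'' where T: "dtri C X W Q g g' g''" using cone_ex[OF g(1)] by blast
  have c1: "shM C 1 c \<in> Hom C (shO C 1 Y) (shO C 1 X)" using sh_Hom[OF c(1)] .
  have "shM C 1 g \<cdot> shM C 1 c = 0" using sh_cmp[OF c(1) g(1), of 1] gc by simp
  then obtain k where k: "k \<in> Hom C (shO C 1 Y) Q" "shM C 1 c = g'' \<cdot> k"
    using tri_lift3[OF T c1] by blast
  have "k = 0" using cone_of_nonzero[OF T g(2) W, of "shO C 1 Y"] ge_shift[OF Y, of 1] k(1) by simp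
  then have "shM C 1 c = 0" using k(2) tri_Hom[OF T] cmp_zero_right by metis
  then show False using c sh_eq_zero_iff by blast
qed

text \<open>This keeps the induction in \<open>independent_comp\<close> inside its hypotheses. A map
  \<open>u\<close> from \<open>F\<close> to phase below \<open>t\<close> induces
  \<open>u[1] \<cdot> \<delta>\<close> on X, which is killed by \<open>c\<close> and hence zero by
  \<open>comp_nonzero\<close>; so \<open>u[1]\<close> comes from \<open>Y[1]\<close>, where phases
  leave no room for it.\<close>

lemma fibre_ge:
  assumes Y: "ge t Y" and T: "dtri C F Y X j c \<delta>" and c: "c \<noteq> 0"
  shows "ge t F"
  unfolding ge_def
proof (intro allI impI ballI)
  fix s Z assume s: "s < t" and Z: "Z \<in> P s"
  have H: "j \<in> Hom C F Y" "c \<in> Hom C Y X" "\<delta> \<in> Hom C X (shO C 1 F)" using tri_Hom[OF T] by auto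
  have "u = 0" if u: "u \<in> Hom C F Z" for u
  proof -
    have u1: "shM C 1 u \<in> Hom C (shO C 1 F) (shO C 1 Z)" using sh_Hom[OF u] .
    have Z1: "shO C 1 Z \<in> P (s + 1)" using P_shift[OF Z, of 1] by simp
    have "shM C 1 u \<cdot> \<delta> \<cdot> c = 0"
      using cmp_assoc[OF H(2,3) u1] tri_comp2[OF T] cmp_zero_right[OF u1] by simp
    then have "shM C 1 u \<cdot> \<delta> = 0"
      using comp_nonzero[OF Y H(2) c cmp_Hom[OF H(3) u1] _ Z1] s by auto
    then obtain w where w: "w \<in> Hom C (shO C 1 Y) (shO C 1 Z)" "shM C 1 u = w \<cdot> shM C 1 j"
      using tri_fact3[OF T u1] by blast
    have "w = 0" using ge_zero[OF ge_shift[OF Y, of 1] _ Z1 w(1)] s by simp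
    then have "shM C 1 u = 0" using w cmp_zero_left[OF sh_Hom[OF H(1)]] by simp
    then show ?thesis using sh_eq_zero_iff[OF u] by blast
  qed
  then show "Hom C F Z = {0}" using zero_Hom by blast
qed

text \<open>The induction replaces \<open>Y\<close> by the fibre of one of the maps \<open>c j\<close>, on which the others remain
  independent.\<close>

lemma independent_comp:
  assumes "finite I" and "ge t Y" and "\<And>j. j \<in> I \<Longrightarrow> c j \<in> Hom C Y X"
    and "\<And>a. (\<Sum>j\<in>I. smul C (a j) (c j)) = 0 \<Longrightarrow> \<forall>j\<in>I. a j = 0"
    and W: "W \<in> P s" "s < t + 1" and "\<And>j. j \<in> I \<Longrightarrow> g j \<in> Hom C X W"
    and "(\<Sum>j\<in>I. g j \<cdot> c j) = 0"
  shows "\<forall>j\<in>I. g j = 0"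
  using assms(1-4,7-)
proof (induction I arbitrary: Y c)
  case empty
  then show ?case by simp
next
  case (insert x I)
  have cx: "c x \<in> Hom C Y X" and gx: "g x \<in> Hom C X W" using insert.prems by auto
  have cI: "c j \<in> Hom C Y X" and gI: "g j \<in> Hom C X W" if "j \<in> I" for j
    using that insert.prems by auto
  have cx0: "c x \<noteq> 0"
  proof
    assume "c x = 0"
    then have "(\<Sum>j\<in>insert x I. smul C (if j = x then 1 else 0) (c j)) = 0"
      by (intro sum.neutral) auto
    then have "\<forall>j\<in>insert x I. (if j = x then 1 else 0) = (0::'k)" by (rule insert.prems(3))
    then show False by simp
  qed
  obtain F i \<delta> where T: "dtri C F Y X i (c x) \<delta>" using fibre_ex[OF cx] by blast
  have i: "i \<in> Hom C F Y" using tri_Hom[OF T] by blast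
  have ci: "c x \<cdot> i = 0" using tri_comp1[OF T] .
  have gI0: "\<forall>j\<in>I. g j = 0"
  proof (rule insert.IH[of F "\<lambda>j. c j \<cdot> i"])
    show "ge t F" using fibre_ge[OF insert.prems(1) T cx0] .
    show "c j \<cdot> i \<in> Hom C F X" if "j \<in> I" for j using cmp_Hom[OF i cI[OF that]] .
    show "g j \<in> Hom C X W" if "j \<in> I" for j using gI[OF that] .
    show "\<forall>j\<in>I. a j = 0" if a: "(\<Sum>j\<in>I. smul C (a j) (c j \<cdot> i)) = 0" for a
    proof -
      \<comment> \<open>A linear relation among the restrictions to \<open>F\<close> says that
        \<open>S\<close> vanishes on \<open>F\<close>. Then \<open>S\<close> factors through
        \<open>c x\<close>, and since endomorphisms of X are scalars it is a multiple of
        \<open>c x\<close>.\<close>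
      define S where "S = (\<Sum>j\<in>I. smul C (a j) (c j))"
      have S: "S \<in> Hom C Y X" unfolding S_def using cI by (intro sum_Hom smul_Hom)
      have "S \<cdot> i = (\<Sum>j\<in>I. smul C (a j) (c j) \<cdot> i)"
        unfolding S_def using insert.hyps(1) i cI by (intro cmp_sum_left smul_Hom)
      also have "\<dots> = 0" unfolding a[symmetric]
        using cmp_smul_left[OF i cI] by (intro sum.cong) auto
      finally obtain u where u: "u \<in> Hom C X X" "S = u \<cdot> c x" using tri_fact1[OF T S] by blast
      obtain b where "u = smul C b (idm C X)" using End_scalar[OF u(1)] by blast
      then have "S = smul C b (c x)"
        using u(2) cmp_smul_left[OF cx idm_Hom] cmp_idm_left[OF cx] by simp
      \<comment> \<open>The relation on \<open>F\<close> thus extends to one among all the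
        \<open>c j\<close> on \<open>Y\<close>, with coefficient \<open>- b\<close> at the new
        index.\<close>
      then have "(\<Sum>j\<in>insert x I. smul C ((a(x := - b)) j) (c j)) = 0"
      proof -
        have "(\<Sum>j\<in>I. smul C ((a(x := - b)) j) (c j)) = S"
          unfolding S_def using insert.hyps(2) by (intro sum.cong) auto
        then show ?thesis using insert.hyps \<open>S = smul C b (c x)\<close> by (simp add: scale_minus_left)
      qed
      then have "\<forall>j\<in>insert x I. (a(x := - b)) j = 0" by (rule insert.prems(3))
      then show ?thesis using insert.hyps(2) by (auto split: if_splits)
    qed
    \<comment> \<open>The term at \<open>x\<close> may be added freely, because \<open>c x\<close>
      vanishes on its own fibre; the full sum is then the given relation restricted to
      \<open>F\<close>.\<close>
    have "(\<Sum>j\<in>I. g j \<cdot> (c j \<cdot> i)) = (\<Sum>j\<in>insert x I. g j \<cdot> (c j \<cdot> i))"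
      using insert.hyps ci cmp_zero_right[OF gx] by simp
    also have "\<dots> = (\<Sum>j\<in>insert x I. g j \<cdot> c j \<cdot> i)"
      using cmp_assoc[OF i insert.prems(2,4)] by (intro sum.cong) simp_all
    also have "\<dots> = (\<Sum>j\<in>insert x I. g j \<cdot> c j) \<cdot> i"
      using insert.hyps(1) by (intro cmp_sum_left[OF _ i cmp_Hom[OF insert.prems(2,4)], symmetric]) simp_all
    also have "\<dots> = 0" using insert.prems(5) cmp_zero_left[OF i] by simp
    finally show "(\<Sum>j\<in>I. g j \<cdot> (c j \<cdot> i)) = 0" .
  qed
  then have "(\<Sum>j\<in>I. g j \<cdot> c j) = 0"
    using cI by (intro sum.neutral) (auto intro: cmp_zero_left)
  then have "g x \<cdot> c x = 0" using insert.prems(5) insert.hyps by simp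
  then have "g x = 0" using comp_nonzero[OF insert.prems(1) cx cx0 gx _ W] by blast
  then show ?case using gI0 by simp
qed

lemma biproduct_expand:
  assumes "is_biproduct C I S T \<iota> \<pi>" and v: "v \<in> Hom C T W"
  shows "v = (\<Sum>j\<in>I. (v \<cdot> \<iota> j) \<cdot> \<pi> j)"
proof -
  have B: "finite I" "\<And>j. j \<in> I \<Longrightarrow> \<iota> j \<in> Hom C (S j) T" "\<And>j. j \<in> I \<Longrightarrow> \<pi> j \<in> Hom C T (S j)"
    "(\<Sum>j\<in>I. \<iota> j \<cdot> \<pi> j) = idm C T"
    using assms(1) unfolding is_biproduct_def by auto
  have "v = v \<cdot> (\<Sum>j\<in>I. \<iota> j \<cdot> \<pi> j)" using B(4) cmp_idm_right[OF v] by simp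
  also have "\<dots> = (\<Sum>j\<in>I. v \<cdot> (\<iota> j \<cdot> \<pi> j))"
    using B cmp_Hom by (intro cmp_sum_right[OF _ v]) blast+
  also have "\<dots> = (\<Sum>j\<in>I. (v \<cdot> \<iota> j) \<cdot> \<pi> j)"
    using cmp_assoc[OF B(3,2) v] by (intro sum.cong) simp_all
  finally show ?thesis .
qed

section \<open>The fibre of the coevaluation map\<close>

lemma X_shift_P: "shO C i X \<in> P (t + of_int i)"
  using P_shift[OF X_P] .

text \<open>The bound on \<open>j\<close> excludes the degree 2 class of the sphere. In the degrees
  that remain, negative ones vanish by phase, degree 1 by \<open>Ext1_zero\<close>, and degree 0
  consists of scalars.\<close>

lemma Hom_X_shift:
  assumes "j \<le> i + 1" and f: "f \<in> Hom C (shO C i X) (shO C j X)"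
  shows "\<exists>a. f = smul C a (idm C (shO C i X))" "i \<noteq> j \<Longrightarrow> f = 0"
proof -
  have f': "shM C (- i) f \<in> Hom C X (shO C (j - i) X)"
    using shM_Hom_minus(1)[OF f] shO_add[of "- i" j X] by simp
  show 0: "f = 0" if "i \<noteq> j"
  proof (cases "j = i + 1")
    case True
    then have "shM C (- i) f = 0" using f' Ext1_zero by simp
    then show ?thesis using sh_eq_zero_iff[OF f] by blast
  next
    case False
    then show ?thesis using P_zero[OF _ X_shift_P X_shift_P f] assms(1) that by simp
  qed
  show "\<exists>a. f = smul C a (idm C (shO C i X))"
  proof (cases "i = j")
    case True
    then obtain a where "shM C (- i) f = smul C a (idm C X)" using f' End_scalar by auto
    then have "f = smul C a (idm C (shO C i X))"
      using shM_inverse(2)[OF f, of i] sh_smul[OF idm_Hom, of i a X] by (simp add: sh_idm)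
    then show ?thesis ..
  next
    case False
    with 0 have "f = smul C 0 (idm C (shO C i X))" by simp
    then show ?thesis ..
  qed
qed

text \<open>\<open>span\<close> and \<open>indep\<close> say that the components
  \<open>\<pi> j \<cdot> e\<close> of degree \<open>i\<close> form a basis of the maps from
  \<open>Y\<close> to \<open>X[i]\<close>. Stated this way, with a degree function \<open>d\<close>
  on an arbitrary index set, the result also applies to evaluation in the opposite category, where
  \<open>\<iota>\<close> and \<open>\<pi>\<close> are exchanged.\<close>

theorem coevaluation_fibre_gt:
  assumes Y: "ge t Y"
    and bip: "is_biproduct C I (\<lambda>j. shO C (d j) X) T \<iota> \<pi>"
    and tri: "dtri C F Y T p e q"
    and span: "\<And>i f. f \<in> Hom C Y (shO C i X) \<Longrightarrow>
      \<exists>a. f = (\<Sum>j | j \<in> I \<and> d j = i. smul C (a j) (\<pi> j \<cdot> e))"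
    and indep: "\<And>i a. (\<Sum>j | j \<in> I \<and> d j = i. smul C (a j) (\<pi> j \<cdot> e)) = 0 \<Longrightarrow>
      \<forall>j\<in>I. d j = i \<longrightarrow> a j = 0"
  shows "gt t F"
proof -
  have B: "finite I" "\<And>j. j \<in> I \<Longrightarrow> \<iota> j \<in> Hom C (shO C (d j) X) T"
    "\<And>j. j \<in> I \<Longrightarrow> \<pi> j \<in> Hom C T (shO C (d j) X)"
    using bip unfolding is_biproduct_def by auto
  have p: "p \<in> Hom C F Y" and e: "e \<in> Hom C Y T" and q: "q \<in> Hom C T (shO C 1 F)"
    using tri_Hom[OF tri] by auto
  have pe: "\<pi> j \<cdot> e \<in> Hom C Y (shO C (d j) X)" if "j \<in> I" for j
    using cmp_Hom[OF e B(3)[OF that]] .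
  \<comment> \<open>A summand of negative degree has phase below \<open>t\<close>, so its component
    of \<open>e\<close> would be zero, against independence.\<close>
  have d: "0 \<le> d j" if j: "j \<in> I" for j
  proof (rule ccontr)
    assume neg: "\<not> 0 \<le> d j"
    have "\<pi> l \<cdot> e = 0" if "l \<in> I" "d l = d j" for l
      using ge_zero[OF Y _ X_shift_P pe[OF that(1)]] neg that(2) by simp
    then have "(\<Sum>l | l \<in> I \<and> d l = d j. smul C 1 (\<pi> l \<cdot> e)) = 0" by (intro sum.neutral) auto
    then show False using indep[of "\<lambda>_. 1" "d j"] j by auto
  qed
  have sub: "v = (\<Sum>j | j \<in> I \<and> d j = i. v \<cdot> \<iota> j \<cdot> \<pi> j)"
    if v: "v \<in> Hom C T W" and 0: "\<forall>j\<in>I. d j \<noteq> i \<longrightarrow> v \<cdot> \<iota> j = 0" for v W i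
  proof -
    have "v = (\<Sum>j\<in>I. v \<cdot> \<iota> j \<cdot> \<pi> j)" using biproduct_expand[OF bip v] .
    also have "\<dots> = (\<Sum>j | j \<in> I \<and> d j = i. v \<cdot> \<iota> j \<cdot> \<pi> j)"
      using B(1) 0 cmp_zero_left[OF B(3)] by (intro sum.mono_neutral_right) auto
    finally show ?thesis .
  qed
  have sube: "v \<cdot> e = (\<Sum>j | j \<in> I \<and> d j = i. v \<cdot> \<iota> j \<cdot> (\<pi> j \<cdot> e))"
    if v: "v \<in> Hom C T W" and 0: "\<forall>j\<in>I. d j \<noteq> i \<longrightarrow> v \<cdot> \<iota> j = 0" for v W i
  proof -
    have "v \<cdot> e = (\<Sum>j | j \<in> I \<and> d j = i. v \<cdot> \<iota> j \<cdot> \<pi> j) \<cdot> e"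
      using sub[OF v 0] by simp
    also have "\<dots> = (\<Sum>j | j \<in> I \<and> d j = i. v \<cdot> \<iota> j \<cdot> \<pi> j \<cdot> e)"
      using B e v cmp_Hom by (intro cmp_sum_left) (simp, blast, blast)
    also have "\<dots> = (\<Sum>j | j \<in> I \<and> d j = i. v \<cdot> \<iota> j \<cdot> (\<pi> j \<cdot> e))"
      using cmp_assoc[OF e B(3) cmp_Hom[OF B(2) v]] by (intro sum.cong) auto
    finally show ?thesis .
  qed
  have lift: "\<exists>w\<in>Hom C Y Z. u = w \<cdot> p"
    if u: "u \<in> Hom C F Z" and 0: "shM C 1 u \<cdot> q = 0" for u Z
  proof -
    have u1: "shM C 1 u \<in> Hom C (shO C 1 F) (shO C 1 Z)" using sh_Hom[OF u] .
    obtain w where w: "w \<in> Hom C (shO C 1 Y) (shO C 1 Z)" "shM C 1 u = w \<cdot> shM C 1 p"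
      using tri_fact3[OF tri u1 0] by blast
    have w': "shM C (- 1) w \<in> Hom C Y Z" using sh_Hom[OF w(1), of "- 1"] shO_inverse(1)[of 1] by simp
    have "u = shM C (- 1) (w \<cdot> shM C 1 p)" using w(2) shM_inverse(1)[OF u, of 1] by simp
    also have "\<dots> = shM C (- 1) w \<cdot> p"
      using sh_cmp[OF sh_Hom[OF p] w(1), of "- 1"] shM_inverse(1)[OF p, of 1] by simp
    finally show ?thesis using w' by blast
  qed
  have vqe: "shM C 1 u \<cdot> q \<in> Hom C T (shO C 1 Z)" "shM C 1 u \<cdot> q \<cdot> e = 0"
    if u: "u \<in> Hom C F Z" for u Z
    using cmp_Hom[OF q sh_Hom[OF u]] cmp_assoc[OF e q sh_Hom[OF u]] tri_comp2[OF tri]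
      cmp_zero_right[OF sh_Hom[OF u]] by simp_all
  have F_ge: "ge t F"
    unfolding ge_def
  proof (intro allI impI ballI)
    fix s Z assume s: "s < t" and Z: "Z \<in> P s"
    have "u = 0" if u: "u \<in> Hom C F Z" for u
    proof -
      define v where "v = shM C 1 u \<cdot> q"
      have v: "v \<in> Hom C T (shO C 1 Z)" "v \<cdot> e = 0" unfolding v_def using vqe[OF u] by auto
      have Z1: "shO C 1 Z \<in> P (s + 1)" using P_shift[OF Z, of 1] by simp
      have vi: "v \<cdot> \<iota> j \<in> Hom C (shO C (d j) X) (shO C 1 Z)" if "j \<in> I" for j
        using cmp_Hom[OF B(2)[OF that] v(1)] .
      \<comment> \<open>Summands of degree at least 1 have phase at least \<open>t + 1\<close>,
        while \<open>Z[1]\<close> has phase below \<open>t + 1\<close>. Only degree 0 is left, and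
        there \<open>v \<cdot> e = 0\<close> is a relation to which \<open>independent_comp\<close>
        applies.\<close>
      have "v \<cdot> \<iota> j = 0" if "j \<in> I" "d j \<noteq> 0" for j
        using P_zero[OF _ X_shift_P Z1 vi[OF that(1)]] d[OF that(1)] that(2) s by simp
      then have 0: "\<forall>j\<in>I. d j \<noteq> 0 \<longrightarrow> v \<cdot> \<iota> j = 0" by blast
      have "\<forall>j\<in>{j \<in> I. d j = 0}. v \<cdot> \<iota> j = 0"
      proof (rule independent_comp[OF _ Y _ _ Z1, of _ "\<lambda>j. \<pi> j \<cdot> e"])
        show "\<pi> j \<cdot> e \<in> Hom C Y X" if "j \<in> {j \<in> I. d j = 0}" for j
          using pe[of j] that by simp
        show "v \<cdot> \<iota> j \<in> Hom C X (shO C 1 Z)" if "j \<in> {j \<in> I. d j = 0}" for j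
          using vi[of j] that by simp
        show "(\<Sum>j\<in>{j \<in> I. d j = 0}. v \<cdot> \<iota> j \<cdot> (\<pi> j \<cdot> e)) = 0"
          using sube[OF v(1) 0] v(2) by simp
      qed (use B(1) s indep in auto)
      then have "(\<Sum>j | j \<in> I \<and> d j = 0. v \<cdot> \<iota> j \<cdot> \<pi> j) = 0"
        using cmp_zero_left[OF B(3)] by (intro sum.neutral) simp
      then have "v = 0" using sub[OF v(1) 0] by simp
      then have "shM C 1 u \<cdot> q = 0" unfolding v_def .
      then obtain w where w: "w \<in> Hom C Y Z" "u = w \<cdot> p" using lift[OF u] by blast
      have "w = 0" using ge_zero[OF Y s Z w(1)] .
      then show ?thesis using w(2) cmp_zero_left[OF p] by simp
    qed
    then show "Hom C F Z = {0}" using zero_Hom by blast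
  qed
  have F_X: "u = 0" if u: "u \<in> Hom C F X" for u
  proof -
    define v where "v = shM C 1 u \<cdot> q"
    have v: "v \<in> Hom C T (shO C 1 X)" "v \<cdot> e = 0" unfolding v_def using vqe[OF u] by auto
    have vi: "v \<cdot> \<iota> j \<in> Hom C (shO C (d j) X) (shO C 1 X)" if "j \<in> I" for j
      using cmp_Hom[OF B(2)[OF that] v(1)] .
    \<comment> \<open>Maps to \<open>X[1]\<close> vanish on summands of degree 0 because X has no
      self-extensions, and on those of degree at least 2 by phase. On degree 1 they are scalars, so
      \<open>v \<cdot> e = 0\<close> becomes a linear relation among basis elements.\<close>
    have "v \<cdot> \<iota> j = 0" if "j \<in> I" "d j \<noteq> 1" for j
      using Hom_X_shift(2)[OF _ vi[OF that(1)]] d[OF that(1)] that(2) by simp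
    then have 0: "\<forall>j\<in>I. d j \<noteq> 1 \<longrightarrow> v \<cdot> \<iota> j = 0" by blast
    have "\<exists>a. v \<cdot> \<iota> j = smul C a (idm C (shO C (d j) X))" if "j \<in> I" for j
      using Hom_X_shift(1)[OF _ vi[OF that]] d[OF that] by simp
    then obtain a where a: "\<And>j. j \<in> I \<Longrightarrow> v \<cdot> \<iota> j = smul C (a j) (idm C (shO C (d j) X))"
      by metis
    have a': "v \<cdot> \<iota> j \<cdot> (\<pi> j \<cdot> e) = smul C (a j) (\<pi> j \<cdot> e)" if "j \<in> I" for j
      using a[OF that] cmp_smul_left[OF pe[OF that] idm_Hom] cmp_idm_left[OF pe[OF that]] by simp
    have "(\<Sum>j | j \<in> I \<and> d j = 1. smul C (a j) (\<pi> j \<cdot> e)) = v \<cdot> e"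
      unfolding sube[OF v(1) 0] using a' by (intro sum.cong) auto
    then have "\<forall>j\<in>I. d j = 1 \<longrightarrow> a j = 0" using indep v(2) by simp
    then have "(\<Sum>j | j \<in> I \<and> d j = 1. v \<cdot> \<iota> j \<cdot> \<pi> j) = 0"
      using a cmp_zero_left[OF B(3)] by (intro sum.neutral) auto
    then have "v = 0" using sub[OF v(1) 0] by simp
    then have "shM C 1 u \<cdot> q = 0" unfolding v_def .
    then obtain w where w: "w \<in> Hom C Y X" "u = w \<cdot> p" using lift[OF u] by blast
    \<comment> \<open>\<open>w\<close> is a combination of the degree 0 components of
      \<open>e\<close>, so it factors through \<open>e\<close>; and
      \<open>e \<cdot> p = 0\<close>.\<close>
    obtain b where b: "w = (\<Sum>j | j \<in> I \<and> d j = 0. smul C (b j) (\<pi> j \<cdot> e))"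
      using span[of w 0] w(1) by auto
    have pi0: "\<pi> j \<in> Hom C T X" if "j \<in> I" "d j = 0" for j using B(3)[OF that(1)] that(2) by simp
    define w' where "w' = (\<Sum>j | j \<in> I \<and> d j = 0. smul C (b j) (\<pi> j))"
    have w': "w' \<in> Hom C T X" unfolding w'_def using pi0 by (intro sum_Hom smul_Hom) auto
    have "w' \<cdot> e = (\<Sum>j | j \<in> I \<and> d j = 0. smul C (b j) (\<pi> j) \<cdot> e)"
      unfolding w'_def using B(1) pi0 by (intro cmp_sum_left[OF _ e] smul_Hom) auto
    also have "\<dots> = w"
      unfolding b using cmp_smul_left[OF e pi0] by (intro sum.cong) auto
    finally have "u = w' \<cdot> (e \<cdot> p)" using w cmp_assoc[OF p e w'] by simp
    then show ?thesis using tri_comp1[OF tri] cmp_zero_right[OF w'] by simp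
  qed
  show ?thesis
  proof (cases "zero_obj C F")
    case True
    then show ?thesis unfolding gt_def zero_obj_def by blast
  next
    case False
    obtain \<eta> A g where A: "A \<in> P \<eta>" "\<not> zero_obj C A" "g \<in> Hom C F A"
      and low: "\<And>U. \<forall>r\<ge>\<eta>. \<forall>B\<in>P r. Hom C B U = {0} \<Longrightarrow> Hom C F U = {0}"
      and inj: "\<And>U h. \<forall>r>\<eta>. \<forall>B\<in>P r. Hom C B U = {0} \<Longrightarrow> h \<in> Hom C A U \<Longrightarrow> h \<cdot> g = 0 \<Longrightarrow> h = 0"
      using min_factor[OF False] by blast
    have "g \<noteq> 0"
    proof
      assume "g = 0"
      then have "idm C A = 0"
        using inj[OF _ idm_Hom] P_Hom[OF _ _ A(1)] cmp_zero_right[OF idm_Hom] by simp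
      then show False using A(2) zero_obj_iff by blast
    qed
    then have "\<not> \<eta> < t" using ge_zero[OF F_ge _ A(1,3)] by blast
    moreover have "\<eta> \<noteq> t"
    proof
      assume \<eta>: "\<eta> = t"
      \<comment> \<open>A nonzero map from the lowest factor to X would give one from
        \<open>F\<close>, since composition with \<open>g\<close> is injective on maps from
        \<open>A\<close> to objects of phase \<open>t\<close>.\<close>
      then obtain s where s: "s \<in> Hom C A X" "s \<noteq> 0"
        using cogenerates[of A] A(1,2) zero_Hom[of A X] by blast
      have "s \<cdot> g = 0" using F_X cmp_Hom[OF A(3) s(1)] by blast
      then show False using inj[of X s] P_Hom[OF _ _ X_P] \<eta> s by blast
    qed
    ultimately have "t < \<eta>" by simp
    have "Hom C F B = {0}" if "r \<le> t" "B \<in> P r" for r B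
    proof (rule low, intro allI impI ballI)
      fix r' B' assume "\<eta> \<le> r'" "B' \<in> P r'"
      then show "Hom C B' B = {0}" using P_Hom[of r r' B' B] that \<open>t < \<eta>\<close> by simp
    qed
    then show ?thesis unfolding gt_def by blast
  qed
qed

end

section \<open>The opposite category\<close>

text \<open>In the opposite category the shift is inverted, so a connecting map is a morphism
  \<open>X[-1] \<rightarrow> Z\<close> of C; shifted by one, it closes the reversed triangle
  \<open>Z \<rightarrow> Y \<rightarrow> X \<rightarrow> Z[1]\<close>. Membership of
  \<open>h\<close> is required separately because \<open>shM\<close> is unconstrained outside the
  Hom spaces. No sign is inserted: only exactness is asked of the result.\<close>

definition opposite :: "('k::field, 'o, 'm::ab_group_add) tricat_data \<Rightarrow> ('k, 'o, 'm) tricat_data" where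
  "opposite C = \<lparr>smul = smul C, Hom = (\<lambda>X Y. Hom C Y X), cmp = (\<lambda>g f. cmp C f g), idm = idm C,
     shO = (\<lambda>i. shO C (- i)), shM = (\<lambda>i. shM C (- i)),
     dtri = (\<lambda>X Y Z f g h. h \<in> Hom C (shO C (- 1) X) Z \<and> dtri C Z Y X g f (shM C 1 h))\<rparr>"

lemma opposite_simps [simp]:
  "smul (opposite C) = smul C" "Hom (opposite C) X Y = Hom C Y X"
  "cmp (opposite C) g f = cmp C f g" "idm (opposite C) = idm C"
  "shO (opposite C) i = shO C (- i)" "shM (opposite C) i = shM C (- i)"
  "dtri (opposite C) X Y Z f g h \<longleftrightarrow> h \<in> Hom C (shO C (- 1) X) Z \<and> dtri C Z Y X g f (shM C 1 h)"
  by (simp_all add: opposite_def)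

lemma zero_obj_opposite [simp]: "zero_obj (opposite C) N \<longleftrightarrow> zero_obj C N"
  by (auto simp: zero_obj_def)

lemma (in linear_category) linear_category_opposite: "linear_category (opposite C)"
  by unfold_locales
    (simp_all add: Hom_subspace idm_Hom cmp_Hom cmp_idm_left cmp_idm_right cmp_assoc
      cmp_add_left cmp_add_right cmp_smul_left cmp_smul_right scale_right_distrib scale_left_distrib)

text \<open>Reversal exchanges \<open>tri_lift1\<close> with \<open>tri_fact1\<close>,
  \<open>tri_lift2\<close> with \<open>tri_fact3\<close>, and \<open>tri_lift3\<close> with
  \<open>tri_fact2\<close>. Where the connecting map is involved the places differ by a shift, which
  is undone after the factorisation has been found.\<close>

lemma (in exact_triangles) exact_triangles_opposite: "exact_triangles (opposite C)"
proof -
  interpret op: linear_category "opposite C" by (rule linear_category_opposite)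
  have unshift: "\<exists>u\<in>Hom C V' W. w = u \<cdot> h"
    if h: "h \<in> Hom C V V'" and w: "w \<in> Hom C V W"
      and u: "u \<in> Hom C (shO C 1 V') (shO C 1 W)" "shM C 1 w = u \<cdot> shM C 1 h" for V V' W w u h
  proof -
    have u': "shM C (- 1) u \<in> Hom C V' W" using sh_Hom[OF u(1), of "- 1"] shO_inverse(1)[of 1] by simp
    have "w = shM C (- 1) (u \<cdot> shM C 1 h)" using u(2) shM_inverse(1)[OF w, of 1] by simp
    also have "\<dots> = shM C (- 1) u \<cdot> h"
      using sh_cmp[OF sh_Hom[OF h] u(1), of "- 1"] shM_inverse(1)[OF h, of 1] by simp
    finally show ?thesis using u' by blast
  qed
  show ?thesis
  proof
    fix X Y Z f g h assume t: "dtri (opposite C) X Y Z f g h"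
    then have h: "h \<in> Hom C (shO C (- 1) X) Z" and T: "dtri C Z Y X g f (shM C 1 h)" by auto
    have H: "g \<in> Hom C Z Y" "f \<in> Hom C Y X" "shM C 1 h \<in> Hom C X (shO C 1 Z)" using tri_Hom[OF T] by auto
    have f1: "shM C (- 1) f \<in> Hom C (shO C (- 1) Y) (shO C (- 1) X)" using sh_Hom[OF H(2)] .
    show "f \<in> Hom (opposite C) X Y \<and> g \<in> Hom (opposite C) Y Z \<and>
        h \<in> Hom (opposite C) Z (shO (opposite C) 1 X)"
      using H h by simp
    show "cmp (opposite C) g f = 0" using tri_comp1[OF T] by simp
    have "shM C 1 (g \<cdot> h) = 0" using sh_cmp[OF h H(1), of 1] tri_comp3[OF T] by simp
    then show "cmp (opposite C) h g = 0" using sh_eq_zero_iff[OF cmp_Hom[OF h H(1)]] by simp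
    have "shM C 1 (h \<cdot> shM C (- 1) f) = 0"
      using sh_cmp[OF f1 h, of 1] shM_inverse(2)[OF H(2), of 1] tri_comp2[OF T] by simp
    then show "cmp (opposite C) (shM (opposite C) 1 f) h = 0"
      using sh_eq_zero_iff[OF cmp_Hom[OF f1 h]] by simp
    fix W w
    show "\<exists>u\<in>Hom (opposite C) W X. w = cmp (opposite C) f u"
      if "w \<in> Hom (opposite C) W Y" "cmp (opposite C) g w = 0"
      using tri_fact1[OF T] that by simp
    show "\<exists>u\<in>Hom (opposite C) Z W. w = cmp (opposite C) u g"
      if "w \<in> Hom (opposite C) Y W" "cmp (opposite C) w f = 0"
      using tri_lift1[OF T] that by simp
    show "\<exists>u\<in>Hom (opposite C) W Y. w = cmp (opposite C) g u"
      if "w \<in> Hom (opposite C) W Z" "cmp (opposite C) h w = 0"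
    proof -
      have w: "w \<in> Hom C Z W" "w \<cdot> h = 0" using that by auto
      have "shM C 1 w \<cdot> shM C 1 h = 0" using sh_cmp[OF h w(1), of 1] w(2) by simp
      then obtain u where "u \<in> Hom C (shO C 1 Y) (shO C 1 W)" "shM C 1 w = u \<cdot> shM C 1 g"
        using tri_fact3[OF T sh_Hom[OF w(1)]] by blast
      then show ?thesis using unshift[OF H(1) w(1)] by simp
    qed
    show "\<exists>u\<in>Hom (opposite C) W Z. w = cmp (opposite C) h u"
      if "w \<in> Hom (opposite C) W (shO (opposite C) 1 X)" "cmp (opposite C) (shM (opposite C) 1 f) w = 0"
    proof -
      have w: "w \<in> Hom C (shO C (- 1) X) W" "w \<cdot> shM C (- 1) f = 0" using that by auto
      have w1: "shM C 1 w \<in> Hom C X (shO C 1 W)" using sh_Hom[OF w(1), of 1] shO_inverse(2)[of 1] by simp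
      have "shM C 1 w \<cdot> f = 0" using sh_cmp[OF f1 w(1), of 1] w(2) shM_inverse(2)[OF H(2), of 1] by simp
      then obtain u where "u \<in> Hom C (shO C 1 Z) (shO C 1 W)" "shM C 1 w = u \<cdot> shM C 1 h"
        using tri_fact2[OF T w1] by blast
      then show ?thesis using unshift[OF h w(1)] by simp
    qed
    show "\<exists>u\<in>Hom (opposite C) (shO (opposite C) 1 X) W. w = cmp (opposite C) u h"
      if "w \<in> Hom (opposite C) Z W" "cmp (opposite C) w g = 0"
    proof -
      have w: "w \<in> Hom C W Z" "g \<cdot> w = 0" using that by auto
      have "shM C 1 g \<cdot> shM C 1 w = 0" using sh_cmp[OF w(1) H(1), of 1] w(2) by simp
      then obtain u where u: "u \<in> Hom C (shO C 1 W) X" "shM C 1 w = shM C 1 h \<cdot> u"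
        using tri_lift3[OF T sh_Hom[OF w(1)]] by blast
      have "w = shM C (- 1) (shM C 1 h \<cdot> u)" using u(2) shM_inverse(1)[OF w(1), of 1] by simp
      also have "\<dots> = h \<cdot> shM C (- 1) u"
        using sh_cmp[OF u(1) H(3), of "- 1"] shM_inverse(1)[OF h, of 1] by simp
      finally show ?thesis using shM_Hom_minus(1)[OF u(1)] by auto
    qed
    show "\<exists>u\<in>Hom (opposite C) (shO (opposite C) 1 Y) W. w = cmp (opposite C) u (shM (opposite C) 1 f)"
      if "w \<in> Hom (opposite C) (shO (opposite C) 1 X) W" "cmp (opposite C) w h = 0"
    proof -
      have w: "w \<in> Hom C W (shO C (- 1) X)" "h \<cdot> w = 0" using that by auto
      have w1: "shM C 1 w \<in> Hom C (shO C 1 W) X" using sh_Hom[OF w(1), of 1] shO_inverse(2)[of 1] by simp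
      have "shM C 1 h \<cdot> shM C 1 w = 0" using sh_cmp[OF w(1) h, of 1] w(2) by simp
      then obtain u where u: "u \<in> Hom C (shO C 1 W) Y" "shM C 1 w = f \<cdot> u"
        using tri_lift2[OF T w1] by blast
      have "w = shM C (- 1) (f \<cdot> u)" using u(2) shM_inverse(1)[OF w(1), of 1] by simp
      also have "\<dots> = shM C (- 1) f \<cdot> shM C (- 1) u" using sh_cmp[OF u(1) H(2)] by simp
      finally show ?thesis using shM_Hom_minus(1)[OF u(1)] by auto
    qed
  next
    have shift_back: "\<exists>h'. h' \<in> Hom C (shO C (- 1) A) B \<and> shM C 1 h' = h"
      if "h \<in> Hom C A (shO C 1 B)" for A B h
      using shM_Hom_minus(2)[OF that] shM_inverse(2)[OF that, of 1] by blast
    show "\<exists>Z g h. dtri (opposite C) X Y Z f g h" if f: "f \<in> Hom (opposite C) X Y" for f X Y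
    proof -
      obtain Z g h where T: "dtri C Z Y X g f h" using fibre_ex[of f Y X] f by auto
      then obtain h' where "h' \<in> Hom C (shO C (- 1) X) Z" "shM C 1 h' = h"
        using shift_back tri_Hom[OF T] by blast
      then show ?thesis using T by auto
    qed
    show "\<exists>X f h. dtri (opposite C) X Y Z f g h" if g: "g \<in> Hom (opposite C) Y Z" for g Y Z
    proof -
      obtain X f h where T: "dtri C Z Y X g f h" using cone_ex[of g Z Y] g by auto
      then obtain h' where "h' \<in> Hom C (shO C (- 1) X) Z" "shM C 1 h' = h"
        using shift_back tri_Hom[OF T] by blast
      then show ?thesis using T by auto
    qed
    show "shO (opposite C) (m + n) X = shO (opposite C) m (shO (opposite C) n X)" for m n X
      using shO_add[of "- m" "- n" X] by simp
    show "shM (opposite C) (m + n) f = shM (opposite C) m (shM (opposite C) n f)"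
      if "f \<in> Hom (opposite C) X Y" for m n X Y f
      using shM_add[of f Y X "- m" "- n"] that by simp
  qed (simp_all add: sh_Hom sh_idm sh_cmp sh_add sh_smul shM_0)
qed

text \<open>Negating phases restores the direction of \<open>P_Hom\<close>, and the inverted shift
  again raises the phase. The axioms on extreme factors, on splittings and on generation are
  exchanged in pairs.\<close>

lemma (in simple_object) simple_object_opposite:
  "simple_object (opposite C) (\<lambda>s. P (- s)) X (- t)"
proof -
  interpret op: exact_triangles "opposite C" by (rule exact_triangles_opposite)
  have mm: "(\<forall>r::real. Q (- r)) = (\<forall>r. Q r)" for Q by (metis minus_minus)
  show ?thesis
  proof
    show "A \<in> P (- s) \<Longrightarrow> shO (opposite C) m A \<in> P (- (s + of_int m))" for A s m
      using P_shift[of A "- s" "- m"] by simp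
    show "r < s \<Longrightarrow> A \<in> P (- s) \<Longrightarrow> B \<in> P (- r) \<Longrightarrow> Hom (opposite C) A B = {0}" for r s A B
      using P_Hom[of "- s" "- r" B A] by simp
    show "\<exists>s A i. A \<in> P (- s) \<and> \<not> zero_obj (opposite C) A \<and> i \<in> Hom (opposite C) A Y \<and>
          (\<forall>U. (\<forall>r\<le>s. \<forall>B\<in>P (- r). Hom (opposite C) U B = {0}) \<longrightarrow> Hom (opposite C) U Y = {0}) \<and>
          (\<forall>U h. (\<forall>r<s. \<forall>B\<in>P (- r). Hom (opposite C) U B = {0}) \<longrightarrow>
             h \<in> Hom (opposite C) U A \<longrightarrow> cmp (opposite C) i h = 0 \<longrightarrow> h = 0)"
      if Y: "\<not> zero_obj (opposite C) Y" for Y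
    proof -
      obtain s A p where *: "A \<in> P s \<and> \<not> zero_obj C A \<and> p \<in> Hom C Y A \<and>
          (\<forall>U. (\<forall>r\<ge>s. \<forall>B\<in>P r. Hom C B U = {0}) \<longrightarrow> Hom C Y U = {0}) \<and>
          (\<forall>U h. (\<forall>r>s. \<forall>B\<in>P r. Hom C B U = {0}) \<longrightarrow> h \<in> Hom C A U \<longrightarrow> h \<cdot> p = 0 \<longrightarrow> h = 0)"
        using min_factor[of Y] Y unfolding zero_obj_opposite by blast
      have "(\<forall>r\<le>- s. \<forall>B\<in>P (- r). Hom C B U = {0}) = (\<forall>r\<ge>s. \<forall>B\<in>P r. Hom C B U = {0})" for U
        using mm[of "\<lambda>r. r \<ge> s \<longrightarrow> (\<forall>B\<in>P r. Hom C B U = {0})"] by (simp add: le_minus_iff[of s])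
      moreover have "(\<forall>r< - s. \<forall>B\<in>P (- r). Hom C B U = {0}) = (\<forall>r>s. \<forall>B\<in>P r. Hom C B U = {0})" for U
        using mm[of "\<lambda>r. r > s \<longrightarrow> (\<forall>B\<in>P r. Hom C B U = {0})"] by (simp add: less_minus_iff[of s])
      ultimately show ?thesis
        using * by (intro exI[of _ "- s"] exI[of _ A] exI[of _ p]) simp
    qed
    show "\<exists>s A p. A \<in> P (- s) \<and> \<not> zero_obj (opposite C) A \<and> p \<in> Hom (opposite C) Y A \<and>
          (\<forall>U. (\<forall>r\<ge>s. \<forall>B\<in>P (- r). Hom (opposite C) B U = {0}) \<longrightarrow> Hom (opposite C) Y U = {0}) \<and>
          (\<forall>U h. (\<forall>r>s. \<forall>B\<in>P (- r). Hom (opposite C) B U = {0}) \<longrightarrow>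
             h \<in> Hom (opposite C) A U \<longrightarrow> cmp (opposite C) h p = 0 \<longrightarrow> h = 0)"
      if Y: "\<not> zero_obj (opposite C) Y" for Y
    proof -
      obtain s A i where *: "A \<in> P s \<and> \<not> zero_obj C A \<and> i \<in> Hom C A Y \<and>
          (\<forall>U. (\<forall>r\<le>s. \<forall>B\<in>P r. Hom C U B = {0}) \<longrightarrow> Hom C U Y = {0}) \<and>
          (\<forall>U h. (\<forall>r<s. \<forall>B\<in>P r. Hom C U B = {0}) \<longrightarrow> h \<in> Hom C U A \<longrightarrow> i \<cdot> h = 0 \<longrightarrow> h = 0)"
        using max_factor[of Y] Y unfolding zero_obj_opposite by blast
      have "(\<forall>r\<ge>- s. \<forall>B\<in>P (- r). Hom C U B = {0}) = (\<forall>r\<le>s. \<forall>B\<in>P r. Hom C U B = {0})" for U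
        using mm[of "\<lambda>r. r \<le> s \<longrightarrow> (\<forall>B\<in>P r. Hom C U B = {0})"] by (simp add: minus_le_iff[of s])
      moreover have "(\<forall>r>- s. \<forall>B\<in>P (- r). Hom C U B = {0}) = (\<forall>r<s. \<forall>B\<in>P r. Hom C U B = {0})" for U
        using mm[of "\<lambda>r. r < s \<longrightarrow> (\<forall>B\<in>P r. Hom C U B = {0})"] by (simp add: minus_less_iff[of s])
      ultimately show ?thesis
        using * by (intro exI[of _ "- s"] exI[of _ A] exI[of _ i]) simp
    qed
    show "Hom (opposite C) X (shO (opposite C) 1 X) = {0}"
      using Ext1_zero Hom_shift_zero_iff[of 1 "shO C (- 1) X" X] shO_inverse(2)[of 1 X] by simp
  qed (use X_P mono_split epi_split generates cogenerates End_scalar in simp_all)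
qed

section \<open>Stability conditions\<close>

locale stability = triangulated_category C
  for C :: "('k::field, 'o, 'm::ab_group_add) tricat_data" (structure)
    and \<tau> :: "'o stab_data" +
  assumes stability: "stability_condition C \<tau>"
begin

abbreviation P :: "real \<Rightarrow> 'o set" where "P \<equiv> semist \<tau>"

lemma charge_tri: "dtri C U V W f g h \<Longrightarrow> charge \<tau> V = charge \<tau> U + charge \<tau> W"
  and P_zero_obj: "zero_obj C N \<Longrightarrow> N \<in> P s"
  and P_iso: "A \<in> P s \<Longrightarrow> isomorphic C A B \<Longrightarrow> B \<in> P s"
  and P_charge: "A \<in> P s \<Longrightarrow> \<not> zero_obj C A \<Longrightarrow>
    \<exists>m>0. charge \<tau> A = of_real m * exp (\<i> * of_real (pi * s))"
  and P_Hom: "r < s \<Longrightarrow> A \<in> P s \<Longrightarrow> B \<in> P r \<Longrightarrow> Hom C A B = {0}"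
  and HN_ex: "\<not> zero_obj C A \<Longrightarrow> \<exists>n \<phi> F. HN_filtration C \<tau> A n \<phi> F"
  and P_succ: "P (s + 1) = shO C 1 ` P s"
  and local_finiteness: "locally_finite C \<tau>"
proof -
  note st = stability[unfolded stability_condition_def full_additive_subcat_def]
  note st1 = st[THEN conjunct1] and st2 = st[THEN conjunct2]
  note st3 = st2[THEN conjunct2] and st4 = st2[THEN conjunct2, THEN conjunct2]
  note st5 = st4[THEN conjunct2]
  show "dtri C U V W f g h \<Longrightarrow> charge \<tau> V = charge \<tau> U + charge \<tau> W"
    using st1 by blast
  show "zero_obj C N \<Longrightarrow> N \<in> P s" "A \<in> P s \<Longrightarrow> isomorphic C A B \<Longrightarrow> B \<in> P s"
    using st2[THEN conjunct1] by blast+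
  show "A \<in> P s \<Longrightarrow> \<not> zero_obj C A \<Longrightarrow>
    \<exists>m>0. charge \<tau> A = of_real m * exp (\<i> * of_real (pi * s))"
    using st3[THEN conjunct1] by blast
  show "P (s + 1) = shO C 1 ` P s"
    using st4[THEN conjunct1] by blast
  show "r < s \<Longrightarrow> A \<in> P s \<Longrightarrow> B \<in> P r \<Longrightarrow> Hom C A B = {0}"
    using st5[THEN conjunct1] by blast
  show "\<not> zero_obj C A \<Longrightarrow> \<exists>n \<phi> F. HN_filtration C \<tau> A n \<phi> F"
    using st5[THEN conjunct2, THEN conjunct1] by blast
  show "locally_finite C \<tau>"
    using st5[THEN conjunct2, THEN conjunct2] .
qed

section \<open>Shifts of semistable objects and long exact Hom sequences\<close>

lemma P_shift: "A \<in> P s \<Longrightarrow> shO C m A \<in> P (s + of_int m)"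
proof (induction m rule: int_induct[where k = 0])
  case base
  then show ?case by (simp add: shO_0)
next
  case (step1 i)
  have "shO C (i + 1) A = shO C 1 (shO C i A)" using shO_plus[of 1 i A] by (simp add: add.commute)
  then show ?case using step1 P_succ[of "s + of_int i"] by (simp add: add.assoc)
next
  case (step2 i)
  have "shO C (i - 1) A = shO C (- 1) (shO C i A)" using shO_plus[of "- 1" i A] by simp
  moreover obtain B where "B \<in> P (s + of_int i - 1)" "shO C i A = shO C 1 B"
    using step2 P_succ[of "s + of_int i - 1"] by auto
  ultimately show ?case using et.shO_inverse(1)[of 1 B] by (simp add: algebra_simps)
qed

lemma P_shift1: "A \<in> P s \<Longrightarrow> shO C 1 A \<in> P (s + 1)"
  and P_unshift1: "A \<in> P s \<Longrightarrow> shO C (- 1) A \<in> P (s - 1)"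
  using P_shift[of A s 1] P_shift[of A s "- 1"] by simp_all

lemma ext_left:
  assumes T: "dtri C A Y B f g h" and 0: "Hom C U A = {0}" "Hom C U B = {0}"
  shows "Hom C U Y = {0}"
proof -
  have "w = 0" if w: "w \<in> Hom C U Y" for w
  proof -
    have f: "f \<in> Hom C A Y" and g: "g \<in> Hom C Y B" using dtri_Hom[OF T] by auto
    have "g \<cdot> w = 0" using cmp_Hom[OF w g] 0(2) by simp
    then obtain u where "u \<in> Hom C U A" "w = f \<cdot> u" using et.tri_lift1[OF T w] by blast
    then show ?thesis using 0(1) cmp_zero_right[OF f] by simp
  qed
  then show ?thesis using zero_Hom by blast
qed

lemma ext_right:
  assumes T: "dtri C A Y B f g h" and 0: "Hom C A U = {0}" "Hom C B U = {0}"
  shows "Hom C Y U = {0}"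
proof -
  have "w = 0" if w: "w \<in> Hom C Y U" for w
  proof -
    have f: "f \<in> Hom C A Y" and g: "g \<in> Hom C Y B" using dtri_Hom[OF T] by auto
    have "w \<cdot> f = 0" using cmp_Hom[OF f w] 0(1) by simp
    then obtain u where "u \<in> Hom C B U" "w = u \<cdot> g" using et.tri_fact1[OF T w] by blast
    then show ?thesis using 0(2) cmp_zero_left[OF g] by simp
  qed
  then show ?thesis using zero_Hom by blast
qed

text \<open>In the long exact sequence, the kernel of composition with \<open>f\<close> is an image
  of \<open>Hom(U[1],B)\<close>. Dually, \<open>second_map_cancel\<close> rests on the vanishing of
  \<open>Hom(A[1],U)\<close>.\<close>

lemma first_map_cancel:
  assumes T: "dtri C A Y B f g h" and 0: "Hom C (shO C 1 U) B = {0}"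
    and x: "x \<in> Hom C U A" "f \<cdot> x = 0"
  shows "x = 0"
proof -
  have f: "f \<in> Hom C A Y" and h: "h \<in> Hom C B (shO C 1 A)" using dtri_Hom[OF T] by auto
  have "shM C 1 f \<cdot> shM C 1 x = 0" using shM_cmp[OF x(1) f, of 1] x(2) by simp
  then obtain u where u: "u \<in> Hom C (shO C 1 U) B" "shM C 1 x = h \<cdot> u"
    using et.tri_lift3[OF T shM_Hom[OF x(1)]] by blast
  then have "shM C 1 x = 0" using 0 cmp_zero_right[OF h] by simp
  then show ?thesis using et.sh_eq_zero_iff[OF x(1)] by blast
qed

lemma second_map_cancel:
  assumes T: "dtri C A Y B f g h" and 0: "Hom C (shO C 1 A) U = {0}"
    and x: "x \<in> Hom C B U" "x \<cdot> g = 0"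
  shows "x = 0"
proof -
  obtain w where "w \<in> Hom C (shO C 1 A) U" "x = w \<cdot> h" using et.tri_fact2[OF T x] by blast
  moreover have "h \<in> Hom C B (shO C 1 A)" using dtri_Hom[OF T] by blast
  ultimately show ?thesis using 0 cmp_zero_left by auto
qed

section \<open>The extreme Harder--Narasimhan factors\<close>

lemma HN_filtrationE:
  assumes "HN_filtration C \<tau> Y n \<phi> A"
  obtains E f g h where "0 < n" "zero_obj C (E 0)" "E n = Y"
    "\<forall>j<n. dtri C (E j) (E (Suc j)) (A j) (f j) (g j) (h j)"
proof -
  note HN = assms[unfolded HN_filtration_def]
  obtain E f g h where "zero_obj C (E 0)" "E n = Y"
    "\<forall>j<n. dtri C (E j) (E (Suc j)) (A j) (f j) (g j) (h j)"
    using HN[THEN conjunct2, THEN conjunct2, THEN conjunct2] by blast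
  then show ?thesis using that[of E f g h] HN[THEN conjunct1] by simp
qed

lemma filtration_left:
  assumes "zero_obj C (E 0)" "\<And>j. j < n \<Longrightarrow> dtri C (E j) (E (Suc j)) (A j) (f j) (g j) (h j)"
    and "k \<le> n" "\<And>j. j < k \<Longrightarrow> Hom C U (A j) = {0}"
  shows "Hom C U (E k) = {0}"
  using assms(3,4)
proof (induction k)
  case 0
  then show ?case using assms(1) by (simp add: zero_obj_def)
next
  case (Suc k)
  then show ?case by (intro ext_left[OF assms(2)[of k]]) simp_all
qed

lemma filtration_right:
  assumes "zero_obj C (E 0)" "\<And>j. j < n \<Longrightarrow> dtri C (E j) (E (Suc j)) (A j) (f j) (g j) (h j)"
    and "k \<le> n" "\<And>j. j < k \<Longrightarrow> Hom C (A j) U = {0}"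
  shows "Hom C (E k) U = {0}"
  using assms(3,4)
proof (induction k)
  case 0
  then show ?case using assms(1) by (simp add: zero_obj_def)
next
  case (Suc k)
  then show ?case by (intro ext_right[OF assms(2)[of k]]) simp_all
qed

lemma HN_Hom_left:
  assumes "HN_filtration C \<tau> Y n \<phi> A" "\<And>j. j < n \<Longrightarrow> Hom C U (A j) = {0}"
  shows "Hom C U Y = {0}"
proof -
  obtain E f g h where "0 < n" and E: "zero_obj C (E 0)" "E n = Y"
    "\<forall>j<n. dtri C (E j) (E (Suc j)) (A j) (f j) (g j) (h j)"
    using HN_filtrationE[OF assms(1)] .
  from filtration_left[where n = n and k = n, OF E(1) E(3)[rule_format] order.refl assms(2)] show ?thesis using E(2) by simp
qed

lemma HN_Hom_right:
  assumes "HN_filtration C \<tau> Y n \<phi> A" "\<And>j. j < n \<Longrightarrow> Hom C (A j) U = {0}"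
  shows "Hom C Y U = {0}"
proof -
  obtain E f g h where "0 < n" and E: "zero_obj C (E 0)" "E n = Y"
    "\<forall>j<n. dtri C (E j) (E (Suc j)) (A j) (f j) (g j) (h j)"
    using HN_filtrationE[OF assms(1)] .
  from filtration_right[where n = n and k = n, OF E(1) E(3)[rule_format] order.refl assms(2)] show ?thesis using E(2) by simp
qed

lemma HN_phase_bounds:
  assumes "HN_filtration C \<tau> Y n \<phi> A" "j < n"
  shows "\<phi> j \<le> \<phi> 0" "\<phi> (n - 1) \<le> \<phi> j"
proof -
  have *: "\<And>i j. i < j \<Longrightarrow> j < n \<Longrightarrow> \<phi> j < \<phi> i"
    using assms(1)[unfolded HN_filtration_def, THEN conjunct2, THEN conjunct1] by blast
  show "\<phi> j \<le> \<phi> 0" using *[of 0 j] assms(2) by (cases "j = 0") auto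
  have "j < n - 1 \<or> j = n - 1" using assms(2) by linarith
  then show "\<phi> (n - 1) \<le> \<phi> j" using *[of j "n - 1"] assms(2) by fastforce
qed

lemma HN_factor:
  assumes "HN_filtration C \<tau> Y n \<phi> A" "j < n"
  shows "A j \<in> P (\<phi> j)" "\<not> zero_obj C (A j)"
  using assms(1)[unfolded HN_filtration_def, THEN conjunct2, THEN conjunct2, THEN conjunct1] assms(2)
  by blast+

lemma HN_upper:
  assumes HN: "HN_filtration C \<tau> Y n \<phi> A" and U: "\<forall>r\<le>\<phi> 0. \<forall>B\<in>P r. Hom C U B = {0}"
  shows "Hom C U Y = {0}"
  using HN_Hom_left[OF HN] HN_phase_bounds(1)[OF HN] HN_factor(1)[OF HN] U by blast

lemma HN_lower:
  assumes HN: "HN_filtration C \<tau> Y n \<phi> A" and U: "\<forall>r\<ge>\<phi> (n - 1). \<forall>B\<in>P r. Hom C B U = {0}"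
  shows "Hom C Y U = {0}"
  using HN_Hom_right[OF HN] HN_phase_bounds(2)[OF HN] HN_factor(1)[OF HN] U by blast

text \<open>Since \<open>E 0\<close> is zero, \<open>A 0\<close> embeds in \<open>E 1\<close> by a
  section of \<open>g 0\<close>; the map wanted is its composite with the maps
  \<open>E k \<rightarrow> E (k+1)\<close>. Each of these is injective on maps from such
  \<open>U\<close>, the obstruction lying in maps from \<open>U\<close> to \<open>A k\<close>
  shifted by -1, whose phase is below \<open>\<phi> 0\<close>.\<close>

lemma HN_max_factor:
  assumes HN: "HN_filtration C \<tau> Y n \<phi> A"
  shows "\<exists>i\<in>Hom C (A 0) Y. \<forall>U x. (\<forall>r<\<phi> 0. \<forall>B\<in>P r. Hom C U B = {0}) \<longrightarrow>
    x \<in> Hom C U (A 0) \<longrightarrow> i \<cdot> x = 0 \<longrightarrow> x = 0"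
proof -
  obtain E f g h where n: "0 < n" and E0: "zero_obj C (E 0)" and En: "E n = Y"
    and T': "\<forall>j<n. dtri C (E j) (E (Suc j)) (A j) (f j) (g j) (h j)"
    using HN_filtrationE[OF HN] .
  note T = T'[rule_format]
  note A = HN_factor(1)[OF HN]
  have "\<exists>i\<in>Hom C (A 0) (E (Suc k)). \<forall>U x. (\<forall>r<\<phi> 0. \<forall>B\<in>P r. Hom C U B = {0}) \<longrightarrow>
    x \<in> Hom C U (A 0) \<longrightarrow> i \<cdot> x = 0 \<longrightarrow> x = 0" if "k < n" for k
    using that
  proof (induction k)
    case 0
    have g: "g 0 \<in> Hom C (E (Suc 0)) (A 0)" and h: "h 0 \<in> Hom C (A 0) (shO C 1 (E 0))"
      using dtri_Hom[OF T[OF n]] by auto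
    have "h 0 = 0" using h E0 et.zero_obj_shift Hom_zero_obj(2) by blast
    then have "h 0 \<cdot> idm C (A 0) = 0" using cmp_zero_left[OF idm_Hom] by simp
    then obtain u where u: "u \<in> Hom C (A 0) (E (Suc 0))" "g 0 \<cdot> u = idm C (A 0)"
      using et.tri_lift2[OF T[OF n] idm_Hom] by auto
    show ?case using split_mono_cancel[OF u(1) g u(2)] u(1) by (intro bexI[of _ u]) blast+
  next
    case (Suc k)
    then obtain i where i: "i \<in> Hom C (A 0) (E (Suc k))"
      and inj: "\<And>U x. \<forall>r<\<phi> 0. \<forall>B\<in>P r. Hom C U B = {0} \<Longrightarrow> x \<in> Hom C U (A 0) \<Longrightarrow> i \<cdot> x = 0 \<Longrightarrow> x = 0"
      by (metis Suc_lessD)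
    note Tk = T[OF Suc.prems]
    have f: "f (Suc k) \<in> Hom C (E (Suc k)) (E (Suc (Suc k)))" using dtri_Hom[OF Tk] by blast
    have "x = 0" if U: "\<forall>r<\<phi> 0. \<forall>B\<in>P r. Hom C U B = {0}" and x: "x \<in> Hom C U (A 0)"
      and 0: "f (Suc k) \<cdot> i \<cdot> x = 0" for U x
    proof -
      have "Hom C U (shO C (- 1) (A (Suc k))) = {0}"
        using U[rule_format, OF _ P_unshift1[OF A[OF Suc.prems]]] HN_phase_bounds(1)[OF HN Suc.prems] by simp
      then have "Hom C (shO C 1 U) (A (Suc k)) = {0}"
        using et.Hom_shift_zero_iff[of 1 U "shO C (- 1) (A (Suc k))"] by simp
      moreover have "f (Suc k) \<cdot> (i \<cdot> x) = 0" using cmp_assoc[OF x i f] 0 by simp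
      ultimately have "i \<cdot> x = 0" using first_map_cancel[OF Tk _ cmp_Hom[OF x i]] by blast
      then show ?thesis using inj U x by blast
    qed
    then show ?case using cmp_Hom[OF i f] by blast
  qed
  from this[of "n - 1"] show ?thesis using n En by simp
qed

text \<open>The filtration is given by subobjects, so at this end the last projection already
  serves. Its cancellation is obstructed only by maps from \<open>E (n - 1)[1]\<close>, which is
  built from the \<open>A j[1]\<close>, all of phase above \<open>\<phi> (n - 1)\<close>.\<close>

lemma HN_min_factor:
  assumes HN: "HN_filtration C \<tau> Y n \<phi> A"
  shows "\<exists>p\<in>Hom C Y (A (n - 1)). \<forall>U x. (\<forall>r>\<phi> (n - 1). \<forall>B\<in>P r. Hom C B U = {0}) \<longrightarrow>
    x \<in> Hom C (A (n - 1)) U \<longrightarrow> x \<cdot> p = 0 \<longrightarrow> x = 0"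
proof -
  obtain E f g h where n: "0 < n" and E0: "zero_obj C (E 0)" and En: "E n = Y"
    and T': "\<forall>j<n. dtri C (E j) (E (Suc j)) (A j) (f j) (g j) (h j)"
    using HN_filtrationE[OF HN] .
  note T = T'[rule_format]
  note A = HN_factor(1)[OF HN]
  have T1: "dtri C (E (n - 1)) Y (A (n - 1)) (f (n - 1)) (g (n - 1)) (h (n - 1))"
    using T[of "n - 1"] n En by simp
  have "x = 0" if U: "\<forall>r>\<phi> (n - 1). \<forall>B\<in>P r. Hom C B U = {0}" and x: "x \<in> Hom C (A (n - 1)) U"
    "x \<cdot> g (n - 1) = 0" for U x
  proof (rule second_map_cancel[OF T1 _ x])
    have "Hom C (A j) (shO C (- 1) U) = {0}" if "j < n - 1" for j
    proof -
      have j: "j < n" using that by simp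
      have "\<phi> (n - 1) < \<phi> j + 1" "shO C 1 (A j) \<in> P (\<phi> j + 1)"
        using HN_phase_bounds(2)[OF HN j] P_shift1[OF A[OF j]] by auto
      then have "Hom C (shO C 1 (A j)) U = {0}" using U by blast
      then show ?thesis using et.Hom_shift_zero_iff[of 1 "A j" "shO C (- 1) U"] by simp
    qed
    then have "Hom C (E (n - 1)) (shO C (- 1) U) = {0}"
      using filtration_right[where k = "n - 1" and n = n, OF E0 T] by simp
    then show "Hom C (shO C 1 (E (n - 1))) U = {0}"
      using et.Hom_shift_zero_iff[of 1 "E (n - 1)" "shO C (- 1) U"] by simp
  qed
  then show ?thesis using dtri_Hom[OF T1] by blast
qed

section \<open>Intrinsic description of the extreme phases\<close>

lemma HN_max_nonzero:
  assumes HN: "HN_filtration C \<tau> Y n \<phi> A"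
  obtains i where "i \<in> Hom C (A 0) Y" "i \<noteq> 0" "A 0 \<in> P (\<phi> 0)"
proof -
  have n: "0 < n" using HN unfolding HN_filtration_def by (rule conjunct1)
  note F = HN_factor[OF HN n]
  obtain i where i: "i \<in> Hom C (A 0) Y" "\<And>U x. \<forall>r<\<phi> 0. \<forall>B\<in>P r. Hom C U B = {0} \<Longrightarrow>
    x \<in> Hom C U (A 0) \<Longrightarrow> i \<cdot> x = 0 \<Longrightarrow> x = 0" using HN_max_factor[OF HN] by blast
  have "i \<noteq> 0"
    using i(2)[OF _ idm_Hom] P_Hom[OF _ F(1)] F(2) cmp_zero_left[OF idm_Hom] by (auto simp: zero_obj_iff)
  then show ?thesis using that i(1) F(1) by blast
qed

lemma HN_min_nonzero:
  assumes HN: "HN_filtration C \<tau> Y n \<phi> A"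
  obtains p where "p \<in> Hom C Y (A (n - 1))" "p \<noteq> 0" "A (n - 1) \<in> P (\<phi> (n - 1))"
proof -
  have n: "n - 1 < n" using HN unfolding HN_filtration_def by simp
  note F = HN_factor[OF HN n]
  obtain p where p: "p \<in> Hom C Y (A (n - 1))" "\<And>U x. \<forall>r>\<phi> (n - 1). \<forall>B\<in>P r. Hom C B U = {0} \<Longrightarrow>
    x \<in> Hom C (A (n - 1)) U \<Longrightarrow> x \<cdot> p = 0 \<Longrightarrow> x = 0" using HN_min_factor[OF HN] by blast
  have "p \<noteq> 0"
    using p(2)[OF _ idm_Hom] P_Hom[OF _ _ F(1)] F(2) cmp_zero_right[OF idm_Hom] by (auto simp: zero_obj_iff)
  then show ?thesis using that p(1) F(1) by blast
qed

text \<open>The right-hand side does not mention the filtration. It therefore shows that the lowest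
  phase is well defined, as the definite description in \<open>phase_minus\<close> demands, and it
  is the bridge to \<open>ge\<close>.\<close>

lemma HN_min_phase_ge_iff:
  assumes HN: "HN_filtration C \<tau> Y n \<phi> A"
  shows "s \<le> \<phi> (n - 1) \<longleftrightarrow> (\<forall>r<s. \<forall>B\<in>P r. Hom C Y B = {0})"
proof
  assume s: "s \<le> \<phi> (n - 1)"
  have "Hom C Y B = {0}" if "r < s" "B \<in> P r" for r B
  proof (rule HN_lower[OF HN], intro allI impI ballI)
    fix r' B' assume "\<phi> (n - 1) \<le> r'" "B' \<in> P r'"
    then show "Hom C B' B = {0}" using P_Hom[of r r' B' B] s that by simp
  qed
  then show "\<forall>r<s. \<forall>B\<in>P r. Hom C Y B = {0}" by blast
next
  assume "\<forall>r<s. \<forall>B\<in>P r. Hom C Y B = {0}"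
  moreover obtain p where "p \<in> Hom C Y (A (n - 1))" "p \<noteq> 0" "A (n - 1) \<in> P (\<phi> (n - 1))"
    using HN_min_nonzero[OF HN] .
  ultimately show "s \<le> \<phi> (n - 1)" by (metis linorder_not_le singletonD)
qed

lemma HN_max_phase_le_iff:
  assumes HN: "HN_filtration C \<tau> Y n \<phi> A"
  shows "\<phi> 0 \<le> s \<longleftrightarrow> (\<forall>r>s. \<forall>B\<in>P r. Hom C B Y = {0})"
proof
  assume s: "\<phi> 0 \<le> s"
  have "Hom C B Y = {0}" if "s < r" "B \<in> P r" for r B
  proof (rule HN_upper[OF HN], intro allI impI ballI)
    fix r' B' assume "r' \<le> \<phi> 0" "B' \<in> P r'"
    then show "Hom C B B' = {0}" using P_Hom[of r' r B B'] s that by simp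
  qed
  then show "\<forall>r>s. \<forall>B\<in>P r. Hom C B Y = {0}" by blast
next
  assume "\<forall>r>s. \<forall>B\<in>P r. Hom C B Y = {0}"
  moreover obtain i where "i \<in> Hom C (A 0) Y" "i \<noteq> 0" "A 0 \<in> P (\<phi> 0)"
    using HN_max_nonzero[OF HN] .
  ultimately show "\<phi> 0 \<le> s" by (metis linorder_not_le singletonD)
qed

lemma phase_minus_eq:
  assumes HN: "HN_filtration C \<tau> Y n \<phi> A"
  shows "phase_minus C \<tau> Y = \<phi> (n - 1)"
  unfolding phase_minus_def
proof (rule the_equality)
  show "\<exists>n' \<phi>' A'. HN_filtration C \<tau> Y n' \<phi>' A' \<and> \<phi> (n - 1) = \<phi>' (n' - 1)" using HN by blast
  fix a assume "\<exists>n' \<phi>' A'. HN_filtration C \<tau> Y n' \<phi>' A' \<and> a = \<phi>' (n' - 1)"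
  then obtain n' \<phi>' A' where HN': "HN_filtration C \<tau> Y n' \<phi>' A'" and a: "a = \<phi>' (n' - 1)" by blast
  show "a = \<phi> (n - 1)"
    unfolding a using HN_min_phase_ge_iff[OF HN] HN_min_phase_ge_iff[OF HN'] by (metis order.antisym order.refl)
qed

lemma phase_plus_eq:
  assumes HN: "HN_filtration C \<tau> Y n \<phi> A"
  shows "phase_plus C \<tau> Y = \<phi> 0"
  unfolding phase_plus_def
proof (rule the_equality)
  show "\<exists>n' \<phi>' A'. HN_filtration C \<tau> Y n' \<phi>' A' \<and> \<phi> 0 = \<phi>' 0" using HN by blast
  fix a assume "\<exists>n' \<phi>' A'. HN_filtration C \<tau> Y n' \<phi>' A' \<and> a = \<phi>' 0"
  then obtain n' \<phi>' A' where HN': "HN_filtration C \<tau> Y n' \<phi>' A'" and a: "a = \<phi>' 0" by blast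
  show "a = \<phi> 0"
    unfolding a using HN_max_phase_le_iff[OF HN] HN_max_phase_le_iff[OF HN'] by (metis order.antisym order.refl)
qed

lemma P_disjoint:
  assumes "A \<in> P r" "A \<in> P s" "\<not> zero_obj C A" shows "r = s"
proof (rule ccontr)
  assume "r \<noteq> s"
  then have "Hom C A A = {0}" using P_Hom[of r s A A] P_Hom[of s r A A] assms by (cases "r < s") auto
  then show False using idm_Hom[of A] assms(3) by (auto simp: zero_obj_iff)
qed

lemma phase_eq: "A \<in> P s \<Longrightarrow> \<not> zero_obj C A \<Longrightarrow> phase \<tau> A = s"
  unfolding phase_def using P_disjoint by (intro the_equality) blast+

section \<open>The categories of semistable objects of a fixed phase\<close>

lemma charge_zero_obj: "zero_obj C N \<Longrightarrow> charge \<tau> N = 0"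
  using charge_tri[OF TR1_idm, of N N] by simp

lemma charge_HN:
  assumes HN: "HN_filtration C \<tau> Y n \<phi> A"
  shows "charge \<tau> Y = (\<Sum>j<n. charge \<tau> (A j))"
proof -
  obtain E f g h where n: "0 < n" and E0: "zero_obj C (E 0)" and En: "E n = Y"
    and T: "\<forall>j<n. dtri C (E j) (E (Suc j)) (A j) (f j) (g j) (h j)"
    using HN_filtrationE[OF HN] .
  have "charge \<tau> (E k) = (\<Sum>j<k. charge \<tau> (A j))" if "k \<le> n" for k
    using that
  proof (induction k)
    case 0
    then show ?case using charge_zero_obj[OF E0] by simp
  next
    case (Suc k)
    then show ?case using charge_tri[OF T[rule_format, of k]] by simp
  qed
  from this[of n] show ?thesis using En by simp
qed

text \<open>Rotating by phase \<open>s\<close> puts the ray of that phase on the positive real axis,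
  so the imaginary part measures the deviation of \<open>r\<close> from \<open>s\<close>.\<close>

lemma P_charge_rotated:
  assumes A: "A \<in> P r" "\<not> zero_obj C A"
  shows "\<exists>m>0. Im (charge \<tau> A * exp (- (\<i> * of_real (pi * s)))) = m * sin (pi * (r - s))"
proof -
  obtain m where m: "m > 0" "charge \<tau> A = of_real m * exp (\<i> * of_real (pi * r))"
    using P_charge[OF A] by blast
  have "charge \<tau> A * exp (- (\<i> * of_real (pi * s))) = of_real m * exp (\<i> * of_real (pi * (r - s)))"
    unfolding m(2) by (simp add: mult.assoc exp_add[symmetric] algebra_simps)
  also have "Im \<dots> = m * sin (pi * (r - s))"
    by (simp add: Im_exp)
  finally show ?thesis using m(1) by blast
qed

lemma P_charge_line:
  assumes "A \<in> P s"
  shows "Im (charge \<tau> A * exp (- (\<i> * of_real (pi * s)))) = 0"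
  using P_charge_rotated[OF assms, of s] charge_zero_obj[of A] by (cases "zero_obj C A") auto

text \<open>All phases lie on one side of \<open>s\<close> at distance less than 1, so the rotated
  charges of the factors have imaginary parts of one sign. These add up to zero, hence all vanish,
  and every phase equals \<open>s\<close>. The sign \<open>\<epsilon>\<close> selects the side:
  phases above \<open>s\<close> occur for cones of monomorphisms, phases below it for fibres of
  epimorphisms.\<close>

lemma semistable_if_charge_on_line:
  fixes \<epsilon> :: real
  assumes HN: "HN_filtration C \<tau> Y n \<phi> A"
    and \<epsilon>: "\<epsilon> = 1 \<or> \<epsilon> = - 1"
    and bounds: "\<And>j. j < n \<Longrightarrow> 0 \<le> \<epsilon> * (\<phi> j - s) \<and> \<epsilon> * (\<phi> j - s) < 1"
    and line: "Im (charge \<tau> Y * exp (- (\<i> * of_real (pi * s)))) = 0"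
  shows "Y \<in> P s"
proof -
  define F where "F j = Im (charge \<tau> (A j) * exp (- (\<i> * of_real (pi * s))))" for j
  have F: "\<exists>m>0. \<epsilon> * F j = m * sin (pi * (\<epsilon> * (\<phi> j - s)))" if jn: "j < n" for j
  proof -
    obtain m where m: "m > 0" "F j = m * sin (pi * (\<phi> j - s))"
      using P_charge_rotated[OF HN_factor[OF HN jn], of s] unfolding F_def by blast
    have "\<epsilon> * F j = m * sin (pi * (\<epsilon> * (\<phi> j - s)))"
      using \<epsilon> by (auto simp: m(2) sin_minus[symmetric] algebra_simps simp del: sin_minus)
    then show ?thesis using m(1) by blast
  qed
  have nonneg: "0 \<le> \<epsilon> * F j" if "j < n" for j
  proof -
    have "0 \<le> sin (pi * (\<epsilon> * (\<phi> j - s)))"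
      using bounds[OF that] by (intro sin_ge_zero) auto
    then show ?thesis using F[OF that] by fastforce
  qed
  have "(\<Sum>j<n. \<epsilon> * F j) = \<epsilon> * Im (charge \<tau> Y * exp (- (\<i> * of_real (pi * s))))"
    unfolding F_def charge_HN[OF HN] sum_distrib_right Im_sum sum_distrib_left ..
  then have "(\<Sum>j<n. \<epsilon> * F j) = 0" using line by simp
  then have F0: "\<epsilon> * F j = 0" if "j < n" for j
    using that nonneg sum_nonneg_eq_0_iff[of "{..<n}" "\<lambda>j. \<epsilon> * F j"] by auto
  have \<phi>: "\<phi> j = s" if "j < n" for j
  proof (rule ccontr)
    assume "\<phi> j \<noteq> s"
    then have "0 < \<epsilon> * (\<phi> j - s)" using bounds[OF that] \<epsilon> by fastforce
    then have "0 < sin (pi * (\<epsilon> * (\<phi> j - s)))"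
      using bounds[OF that] by (intro sin_gt_zero) auto
    then show False using F[OF that] F0[OF that] by fastforce
  qed
  obtain E f g h where n: "0 < n" and E0: "zero_obj C (E 0)" and En: "E n = Y"
    and T: "\<forall>j<n. dtri C (E j) (E (Suc j)) (A j) (f j) (g j) (h j)"
    using HN_filtrationE[OF HN] .
  \<comment> \<open>Phases of distinct factors differ strictly, so equality of all phases leaves a
    single factor.\<close>
  have "\<not> 1 < n"
  proof
    assume "1 < n"
    then have "\<phi> 1 < \<phi> 0" using HN unfolding HN_filtration_def by simp
    then show False using \<phi>[of 0] \<phi>[of 1] \<open>1 < n\<close> by simp
  qed
  with n have n1: "n = 1" by simp
  then have T0: "dtri C (E 0) Y (A 0) (f 0) (g 0) (h 0)" using T En by simp
  note H = dtri_Hom[OF T0]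
  \<comment> \<open>With \<open>E 0\<close> zero, \<open>g 0\<close> has a section and kills
    nothing, so \<open>Y\<close> is isomorphic to its only factor.\<close>
  have "h 0 \<cdot> idm C (A 0) = 0"
    using H E0 et.zero_obj_shift Hom_zero_obj(2) cmp_idm_right by metis
  then obtain u where u: "u \<in> Hom C (A 0) Y" "idm C (A 0) = g 0 \<cdot> u"
    using et.tri_lift2[OF T0 idm_Hom] by blast
  have g0: "g 0 \<in> Hom C Y (A 0)" using H by blast
  have ug: "u \<cdot> g 0 \<in> Hom C Y Y" using cmp_Hom[OF g0 u(1)] .
  have "g 0 \<cdot> (u \<cdot> g 0 - idm C Y) = 0"
    using cmp_diff_right[OF ug idm_Hom g0] cmp_assoc[OF g0 u(1) g0] u(2)
      cmp_idm_left[OF g0] cmp_idm_right[OF g0] by simp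
  then obtain v where v: "v \<in> Hom C Y (E 0)" "u \<cdot> g 0 - idm C Y = f 0 \<cdot> v"
    using et.tri_lift1[OF T0 diff_Hom[OF ug idm_Hom]] by blast
  have "f 0 = 0" using Hom_zero_obj(1)[OF E0] H by blast
  then have "u \<cdot> g 0 = idm C Y" using v cmp_zero_left[OF v(1)] by simp
  then have "isomorphic C (A 0) Y"
    unfolding isomorphic_def iso_mor_def using u g0 by metis
  then show ?thesis using P_iso[of "A 0" s Y] HN_factor(1)[OF HN n] \<phi>[OF n] by simp
qed

section \<open>Monomorphisms and epimorphisms between semistable objects of one phase\<close>

definition mono_at :: "real \<Rightarrow> 'o \<Rightarrow> 'm \<Rightarrow> bool" where
  "mono_at s A f \<longleftrightarrow> (\<forall>U\<in>P s. \<forall>x\<in>Hom C U A. f \<cdot> x = 0 \<longrightarrow> x = 0)"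

definition epi_at :: "real \<Rightarrow> 'o \<Rightarrow> 'm \<Rightarrow> bool" where
  "epi_at s B g \<longleftrightarrow> (\<forall>U\<in>P s. \<forall>x\<in>Hom C B U. x \<cdot> g = 0 \<longrightarrow> x = 0)"

text \<open>The phases of \<open>Q\<close> lie in \<open>[s,s+1)\<close>. A factor of phase below
  \<open>s\<close> receives no maps from \<open>E\<close> or \<open>A[1]\<close>, hence none from
  \<open>Q\<close>. A factor of phase at least \<open>s + 1\<close> can map to \<open>Q\<close> only
  through \<open>A[1]\<close>, which \<open>f\<close> being a monomorphism forbids. The charge of
  \<open>Q\<close> is a difference of charges on the line of phase \<open>s\<close>, so
  \<open>semistable_if_charge_on_line\<close> applies.\<close>

lemma mono_cone:
  assumes A: "A \<in> P s" and E: "E \<in> P s" and T: "dtri C A E Q f g h" and f: "mono_at s A f"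
  shows "Q \<in> P s"
proof (cases "zero_obj C Q")
  case True
  then show ?thesis by (rule P_zero_obj)
next
  case False
  then obtain n \<phi> F where HN: "HN_filtration C \<tau> Q n \<phi> F" using HN_ex by blast
  have H: "f \<in> Hom C A E" "g \<in> Hom C E Q" "h \<in> Hom C Q (shO C 1 A)" using dtri_Hom[OF T] by auto
  have "\<not> \<phi> (n - 1) < s"
  proof
    assume less: "\<phi> (n - 1) < s"
    obtain p where p: "p \<in> Hom C Q (F (n - 1))" "p \<noteq> 0" "F (n - 1) \<in> P (\<phi> (n - 1))"
      using HN_min_nonzero[OF HN] .
    have "p \<cdot> g = 0" using P_Hom[OF less E p(3)] cmp_Hom[OF H(2) p(1)] by simp
    moreover have "Hom C (shO C 1 A) (F (n - 1)) = {0}"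
      using P_Hom[OF _ P_shift1[OF A] p(3)] less by simp
    ultimately show False using second_map_cancel[OF T _ p(1)] p(2) by blast
  qed
  moreover have "\<not> s + 1 \<le> \<phi> 0"
  proof
    assume le: "s + 1 \<le> \<phi> 0"
    obtain i where i: "i \<in> Hom C (F 0) Q" "i \<noteq> 0" "F 0 \<in> P (\<phi> 0)" using HN_max_nonzero[OF HN] .
    have hi: "h \<cdot> i \<in> Hom C (F 0) (shO C 1 A)" using cmp_Hom[OF i(1) H(3)] .
    have "h \<cdot> i = 0"
    proof (cases "\<phi> 0 = s + 1")
      case False
      then show ?thesis using P_Hom[OF _ i(3) P_shift1[OF A]] le hi by simp
    next
      \<comment> \<open>Only at phase \<open>s + 1\<close> can a map to \<open>A[1]\<close> survive;
        shifted back, it is a map within \<open>P s\<close> that \<open>f\<close> kills.\<close>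
      case True
      then have U: "shO C (- 1) (F 0) \<in> P s" using P_unshift1[OF i(3)] by simp
      have x: "shM C (- 1) (h \<cdot> i) \<in> Hom C (shO C (- 1) (F 0)) A"
        using et.shM_Hom_minus(2)[OF hi] .
      have "shM C 1 (f \<cdot> shM C (- 1) (h \<cdot> i)) = shM C 1 f \<cdot> (h \<cdot> i)"
        using shM_cmp[OF x H(1), of 1] et.shM_inverse(2)[OF hi, of 1] by simp
      also have "\<dots> = 0"
        using cmp_assoc[OF i(1) H(3) shM_Hom[OF H(1)]] et.tri_comp3[OF T] cmp_zero_left[OF i(1)] by simp
      finally have "f \<cdot> shM C (- 1) (h \<cdot> i) = 0"
        using et.sh_eq_zero_iff[OF cmp_Hom[OF x H(1)]] by blast
      then have "shM C (- 1) (h \<cdot> i) = 0" using f U x unfolding mono_at_def by blast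
      then show ?thesis using et.sh_eq_zero_iff[OF hi] by blast
    qed
    then obtain y where y: "y \<in> Hom C (F 0) E" "i = g \<cdot> y" using et.tri_lift2[OF T i(1)] by blast
    then show False using P_Hom[OF _ i(3) E] le i(2) cmp_zero_right[OF H(2)] by simp
  qed
  ultimately have b: "0 \<le> \<phi> j - s \<and> \<phi> j - s < 1" if "j < n" for j
    using HN_phase_bounds[OF HN that] by linarith
  have "charge \<tau> Q = charge \<tau> E - charge \<tau> A" using charge_tri[OF T] by simp
  then have "Im (charge \<tau> Q * exp (- (\<i> * of_real (pi * s)))) = 0"
    using P_charge_line[OF A] P_charge_line[OF E] by (simp add: left_diff_distrib)
  then show ?thesis using semistable_if_charge_on_line[OF HN, of 1 s] b by simp
qed

text \<open>Dually to \<open>mono_cone\<close>, the phases of \<open>K\<close> lie in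
  \<open>(s-1,s]\<close>. The critical phase is now \<open>s - 1\<close>, where the shifted
  projection of \<open>K\<close> to its lowest factor gives a map from \<open>B\<close> that
  vanishes after composition with \<open>g\<close>.\<close>

lemma epi_fibre:
  assumes E: "E \<in> P s" and B: "B \<in> P s" and T: "dtri C K E B f g h" and g: "epi_at s B g"
  shows "K \<in> P s"
proof (cases "zero_obj C K")
  case True
  then show ?thesis by (rule P_zero_obj)
next
  case False
  then obtain n \<phi> F where HN: "HN_filtration C \<tau> K n \<phi> F" using HN_ex by blast
  have H: "f \<in> Hom C K E" "g \<in> Hom C E B" "h \<in> Hom C B (shO C 1 K)" using dtri_Hom[OF T] by auto
  have "\<not> s < \<phi> 0"
  proof
    assume less: "s < \<phi> 0"
    obtain i where i: "i \<in> Hom C (F 0) K" "i \<noteq> 0" "F 0 \<in> P (\<phi> 0)" using HN_max_nonzero[OF HN] .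
    have "f \<cdot> i = 0" using P_Hom[OF less i(3) E] cmp_Hom[OF i(1) H(1)] by simp
    moreover have "Hom C (shO C 1 (F 0)) B = {0}"
      using P_Hom[OF _ P_shift1[OF i(3)] B] less by simp
    ultimately show False using first_map_cancel[OF T _ i(1)] i(2) by blast
  qed
  moreover have "\<not> \<phi> (n - 1) \<le> s - 1"
  proof
    assume le: "\<phi> (n - 1) \<le> s - 1"
    obtain p where p: "p \<in> Hom C K (F (n - 1))" "p \<noteq> 0" "F (n - 1) \<in> P (\<phi> (n - 1))"
      using HN_min_nonzero[OF HN] .
    have p1: "shM C 1 p \<in> Hom C (shO C 1 K) (shO C 1 (F (n - 1)))" using shM_Hom[OF p(1)] .
    have F1: "shO C 1 (F (n - 1)) \<in> P (\<phi> (n - 1) + 1)" using P_shift1[OF p(3)] .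
    have ph: "shM C 1 p \<cdot> h \<in> Hom C B (shO C 1 (F (n - 1)))" using cmp_Hom[OF H(3) p1] .
    have "shM C 1 p \<cdot> h = 0"
    proof (cases "\<phi> (n - 1) = s - 1")
      case False
      then show ?thesis using P_Hom[OF _ B F1] le ph by simp
    next
      case True
      have "shM C 1 p \<cdot> h \<cdot> g = 0"
        using cmp_assoc[OF H(2,3) p1] et.tri_comp2[OF T] cmp_zero_right[OF p1] by simp
      then show ?thesis using g F1 True ph unfolding epi_at_def by simp
    qed
    then obtain w where w: "w \<in> Hom C (shO C 1 E) (shO C 1 (F (n - 1)))" "shM C 1 p = w \<cdot> shM C 1 f"
      using et.tri_fact3[OF T p1] by blast
    have "w = 0" using P_Hom[OF _ P_shift1[OF E] F1] le w(1) by simp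
    then have "shM C 1 p = 0" using w(2) cmp_zero_left[OF shM_Hom[OF H(1)]] by simp
    then show False using p(2) et.sh_eq_zero_iff[OF p(1)] by blast
  qed
  ultimately have b: "0 \<le> - 1 * (\<phi> j - s) \<and> - 1 * (\<phi> j - s) < 1" if "j < n" for j
    unfolding mult_minus1 using HN_phase_bounds[OF HN that] by linarith
  have "charge \<tau> K = charge \<tau> E - charge \<tau> B" using charge_tri[OF T] by simp
  then have "Im (charge \<tau> K * exp (- (\<i> * of_real (pi * s)))) = 0"
    using P_charge_line[OF B] P_charge_line[OF E] by (simp add: left_diff_distrib)
  then show ?thesis using semistable_if_charge_on_line[OF HN _ b] by simp
qed

lemma mono_first:
  assumes "dtri C A E B f g h" "B \<in> P s" shows "mono_at s A f"
  unfolding mono_at_def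
proof (intro ballI impI)
  fix U x assume U: "U \<in> P s" and x: "x \<in> Hom C U A" "f \<cdot> x = 0"
  show "x = 0" using first_map_cancel[OF assms(1) P_Hom[OF _ P_shift1[OF U] assms(2)] x] by simp
qed

lemma epi_second:
  assumes "dtri C A E B f g h" "A \<in> P s" shows "epi_at s B g"
  unfolding epi_at_def
proof (intro ballI impI)
  fix U x assume U: "U \<in> P s" and x: "x \<in> Hom C B U" "x \<cdot> g = 0"
  show "x = 0" using second_map_cancel[OF assms(1) P_Hom[OF _ P_shift1[OF assms(2)] U] x] by simp
qed

lemma mono_comp:
  assumes "f \<in> Hom C A B" "g \<in> Hom C B E" "mono_at s A f" "mono_at s B g"
  shows "mono_at s A (g \<cdot> f)"
  using assms cmp_assoc[OF _ assms(1,2)] cmp_Hom[OF _ assms(1)] unfolding mono_at_def by metis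

lemma epi_comp:
  assumes "f \<in> Hom C A B" "g \<in> Hom C B E" "epi_at s B f" "epi_at s E g"
  shows "epi_at s E (g \<cdot> f)"
  using assms cmp_assoc[OF assms(1,2)] cmp_Hom[OF assms(2)] unfolding epi_at_def by metis

lemma mono_in_iff: "mono_in C (P s) A E f \<longleftrightarrow> f \<in> Hom C A E \<and> mono_at s A f"
proof
  assume m: "mono_in C (P s) A E f"
  then have f: "f \<in> Hom C A E" unfolding mono_in_def by blast
  have "x = 0" if "U \<in> P s" "x \<in> Hom C U A" "f \<cdot> x = 0" for U x
    using m that cmp_zero_right[OF f] zero_Hom[of U A] unfolding mono_in_def by metis
  then show "f \<in> Hom C A E \<and> mono_at s A f" using f unfolding mono_at_def by blast
next
  assume m: "f \<in> Hom C A E \<and> mono_at s A f"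
  have "u = v" if "U \<in> P s" "u \<in> Hom C U A" "v \<in> Hom C U A" "f \<cdot> u = f \<cdot> v" for U u v
  proof -
    have "f \<cdot> (u - v) = 0" using cmp_diff_right[OF that(2,3) m[THEN conjunct1]] that(4) by simp
    then have "u - v = 0" using m that diff_Hom[OF that(2,3)] unfolding mono_at_def by blast
    then show ?thesis by simp
  qed
  then show "mono_in C (P s) A E f" using m unfolding mono_in_def by blast
qed

text \<open>Stability with the phase made explicit, and in the form that tests monomorphisms against
  zero only.\<close>

definition simple :: "real \<Rightarrow> 'o \<Rightarrow> bool" where
  "simple s E \<longleftrightarrow> E \<in> P s \<and> \<not> zero_obj C E \<and>
     (\<forall>A\<in>P s. \<forall>f\<in>Hom C A E. mono_at s A f \<longrightarrow> zero_obj C A \<or> iso_mor C A E f)"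

lemma stable_obj_iff: "stable_obj C \<tau> E \<longleftrightarrow> (\<exists>s. simple s E)"
  unfolding stable_obj_def simple_def mono_in_iff by blast

text \<open>The fibre of \<open>f\<close> is a subobject of X in \<open>P s\<close>. If it is zero,
  the identity of X factors through \<open>f\<close>; if it is all of X, then \<open>f = 0\<close>,
  which an epimorphism onto a nonzero object cannot be.\<close>

lemma simple_epi_split:
  assumes X: "simple s X" and A: "A \<in> P s" "\<not> zero_obj C A" and f: "f \<in> Hom C X A" "epi_at s A f"
  shows "\<exists>k\<in>Hom C A X. k \<cdot> f = idm C X"
proof -
  have XP: "X \<in> P s" using X unfolding simple_def by blast
  obtain K j h where T: "dtri C K X A j f h" using et.fibre_ex[OF f(1)] by blast
  have K: "K \<in> P s" using epi_fibre[OF XP A(1) T f(2)] .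
  have H: "j \<in> Hom C K X" using dtri_Hom[OF T] by blast
  consider "zero_obj C K" | "iso_mor C K X j"
    using X K H mono_first[OF T A(1)] unfolding simple_def by blast
  then show ?thesis
  proof cases
    case 1
    then have "j = 0" using Hom_zero_obj(1) H by blast
    then have "idm C X \<cdot> j = 0" using cmp_zero_right[OF idm_Hom] by simp
    then show ?thesis using et.tri_fact1[OF T idm_Hom] by metis
  next
    case 2
    then obtain k where k: "k \<in> Hom C X K" "j \<cdot> k = idm C X" unfolding iso_mor_def by blast
    have "f = f \<cdot> j \<cdot> k" using cmp_assoc[OF k(1) H f(1)] k(2) cmp_idm_right[OF f(1)] by simp
    then have "idm C A \<cdot> f = 0"
      using et.tri_comp1[OF T] cmp_zero_left[OF k(1)] cmp_zero_right[OF idm_Hom] by simp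
    then have "idm C A = 0" using f(2) A(1) idm_Hom unfolding epi_at_def by blast
    then show ?thesis using A(2) zero_obj_iff by blast
  qed
qed

section \<open>Finite length, simple subobjects and simple quotients\<close>

lemma extension_closure_Hom_left:
  assumes "W \<in> extension_closure C S" "\<And>A. A \<in> S \<Longrightarrow> Hom C A U = {0}"
  shows "Hom C W U = {0}"
  using assms(1)
proof induction
  case (zero N)
  then show ?case by (simp add: zero_obj_def)
qed (use assms(2) ext_right in blast)+

lemma extension_closure_Hom_right:
  assumes "W \<in> extension_closure C S" "\<And>A. A \<in> S \<Longrightarrow> Hom C U A = {0}"
  shows "Hom C U W = {0}"
  using assms(1)
proof induction
  case (zero N)
  then show ?case by (simp add: zero_obj_def)
qed (use assms(2) ext_left in blast)+

text \<open>Exactness of Hom gives the factorisations; their uniqueness needs that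
  \<open>W[1]\<close> has no maps to \<open>B\<close> and \<open>A[1]\<close> none to
  \<open>W\<close>. Both hold for all \<open>W\<close> with phases within \<open>\<eta>\<close> of
  \<open>s\<close>, because the shift moves phases by 1, which exceeds
  \<open>\<eta>\<close>.\<close>

lemma strict_monoI:
  assumes \<eta>: "0 < \<eta>" "\<eta> < 1" and P: "A \<in> P s" "E \<in> P s" "B \<in> P s" and T: "dtri C A E B f g h"
  defines "S \<equiv> semist_interval C \<tau> {s - \<eta> <..< s + \<eta>}"
  shows "strict_mono_in C S A E f"
proof -
  have inS: "D \<in> S" if "D \<in> P s" for D
    unfolding S_def semist_interval_def using that \<eta>(1) by (intro extension_closure.base) auto
  have H: "f \<in> Hom C A E" "g \<in> Hom C E B" "h \<in> Hom C B (shO C 1 A)" using dtri_Hom[OF T] by auto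
  have left: "Hom C (shO C 1 W) B = {0}" if "W \<in> S" for W
  proof -
    have "Hom C W (shO C (- 1) B) = {0}"
    proof (rule extension_closure_Hom_left[OF that[unfolded S_def semist_interval_def]])
      fix D assume "D \<in> (\<Union>r\<in>{s - \<eta> <..< s + \<eta>}. P r)"
      then obtain r where "s - \<eta> < r" "D \<in> P r" by auto
      then show "Hom C D (shO C (- 1) B) = {0}"
        using P_Hom[OF _ _ P_unshift1[OF P(3)], of r D] \<eta>(2) by simp
    qed
    then show ?thesis using et.Hom_shift_zero_iff[of 1 W "shO C (- 1) B"] by simp
  qed
  have right: "Hom C (shO C 1 A) W = {0}" if "W \<in> S" for W
  proof (rule extension_closure_Hom_right[OF that[unfolded S_def semist_interval_def]])
    fix D assume "D \<in> (\<Union>r\<in>{s - \<eta> <..< s + \<eta>}. P r)"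
    then obtain r where "r < s + \<eta>" "D \<in> P r" by auto
    then show "Hom C (shO C 1 A) D = {0}"
      using P_Hom[OF _ P_shift1[OF P(1)], of r D] \<eta>(2) by simp
  qed
  have "\<exists>!u. u \<in> Hom C W A \<and> f \<cdot> u = w" if "W \<in> S" "w \<in> Hom C W E" "g \<cdot> w = 0" for W w
  proof (rule ex_ex1I)
    show "\<exists>u. u \<in> Hom C W A \<and> f \<cdot> u = w" using et.tri_lift1[OF T that(2,3)] by blast
    fix u v assume uv: "u \<in> Hom C W A \<and> f \<cdot> u = w" "v \<in> Hom C W A \<and> f \<cdot> v = w"
    then have "f \<cdot> (u - v) = 0" using cmp_diff_right[of u W A v f E] H(1) by simp
    then have "u - v = 0" using first_map_cancel[OF T left[OF that(1)] diff_Hom[of u W A v]] uv by blast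
    then show "u = v" by simp
  qed
  moreover have "\<exists>!u. u \<in> Hom C B W \<and> u \<cdot> g = w" if "W \<in> S" "w \<in> Hom C E W" "w \<cdot> f = 0" for W w
  proof (rule ex_ex1I)
    show "\<exists>u. u \<in> Hom C B W \<and> u \<cdot> g = w" using et.tri_fact1[OF T that(2,3)] by blast
    fix u v assume uv: "u \<in> Hom C B W \<and> u \<cdot> g = w" "v \<in> Hom C B W \<and> v \<cdot> g = w"
    then have "(u - v) \<cdot> g = 0" using cmp_diff_left[of g E B u W v] H(2) by simp
    then have "u - v = 0" using second_map_cancel[OF T right[OF that(1)] diff_Hom[of u B W v]] uv by blast
    then show "u = v" by simp
  qed
  ultimately show ?thesis
    unfolding strict_mono_in_def kernel_in_def cokernel_in_def
    using inS P H et.tri_comp1[OF T] by blast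
qed

text \<open>Local finiteness concerns the intervals around \<open>s\<close>, and
  \<open>strict_monoI\<close> carries chains of \<open>P s\<close> over to them. A single
  isomorphism in the chain is all that the contradictions below require.\<close>

lemma subobject_chains_stabilise:
  assumes E: "E \<in> P s" and T: "\<And>n. \<exists>B g h. B \<in> P s \<and> dtri C (A n) E B (i n) g h"
    and A: "\<And>n. A n \<in> P s"
  shows "(\<And>n. u n \<in> Hom C (A (Suc n)) (A n) \<and> i n \<cdot> u n = i (Suc n)) \<Longrightarrow>
      \<exists>n. iso_mor C (A (Suc n)) (A n) (u n)"
    and "(\<And>n. u n \<in> Hom C (A n) (A (Suc n)) \<and> i (Suc n) \<cdot> u n = i n) \<Longrightarrow>
      \<exists>n. iso_mor C (A n) (A (Suc n)) (u n)"
proof -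
  obtain \<eta> where \<eta>: "\<eta> > 0" "\<eta> < 1/2"
    and fin: "\<And>t. finite_length_cat C (semist_interval C \<tau> {t - \<eta> <..< t + \<eta>})"
    using local_finiteness unfolding locally_finite_def by blast
  define S where "S = semist_interval C \<tau> {s - \<eta> <..< s + \<eta>}"
  have "strict_mono_in C S (A n) E (i n)" for n
    using T[of n] strict_monoI[OF \<eta>(1) _ A E] \<eta>(2) unfolding S_def by auto
  moreover have "E \<in> S"
    unfolding S_def semist_interval_def using E \<eta>(1) by (intro extension_closure.base) auto
  ultimately have
    "((\<forall>n. u n \<in> Hom C (A (Suc n)) (A n) \<and> i n \<cdot> u n = i (Suc n)) \<longrightarrow>
        (\<exists>N. \<forall>n\<ge>N. iso_mor C (A (Suc n)) (A n) (u n))) \<and>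
     ((\<forall>n. u n \<in> Hom C (A n) (A (Suc n)) \<and> i (Suc n) \<cdot> u n = i n) \<longrightarrow>
        (\<exists>N. \<forall>n\<ge>N. iso_mor C (A n) (A (Suc n)) (u n)))"
    using fin[of s] unfolding S_def finite_length_cat_def by blast
  then show "(\<And>n. u n \<in> Hom C (A (Suc n)) (A n) \<and> i n \<cdot> u n = i (Suc n)) \<Longrightarrow>
      \<exists>n. iso_mor C (A (Suc n)) (A n) (u n)"
    "(\<And>n. u n \<in> Hom C (A n) (A (Suc n)) \<and> i (Suc n) \<cdot> u n = i n) \<Longrightarrow>
      \<exists>n. iso_mor C (A n) (A (Suc n)) (u n)"
    by blast+
qed

text \<open>If no simple object mapped nontrivially to \<open>Z\<close>, every nonzero subobject
  would contain a strictly smaller nonzero one, and dependent choice would produce an infinite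
  descending chain.\<close>

lemma simple_subobject:
  assumes Z: "Z \<in> P s" "\<not> zero_obj C Z"
  shows "\<exists>A i. simple s A \<and> i \<in> Hom C A Z \<and> i \<noteq> 0"
proof (rule ccontr)
  assume no: "\<not> ?thesis"
  \<comment> \<open>\<open>R\<close> describes pairs of a nonzero subobject of \<open>Z\<close> in
    \<open>P s\<close> and its inclusion; \<open>N p q\<close> says that \<open>q\<close> is
    strictly smaller than \<open>p\<close>.\<close>
  define R where "R p \<longleftrightarrow> fst p \<in> P s \<and> \<not> zero_obj C (fst p) \<and> snd p \<in> Hom C (fst p) Z \<and>
    mono_at s (fst p) (snd p)" for p
  define N where "N p q \<longleftrightarrow> (\<exists>u\<in>Hom C (fst q) (fst p). snd p \<cdot> u = snd q \<and>
    \<not> iso_mor C (fst q) (fst p) u)" for p q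
  have "R (Z, idm C Z)"
    unfolding R_def mono_at_def using Z idm_Hom cmp_idm_left by auto
  moreover have "\<exists>q. R q \<and> N p q" if p: "R p" for p
  proof -
    obtain A i where pA: "p = (A, i)" by fastforce
    have A: "A \<in> P s" "\<not> zero_obj C A" "i \<in> Hom C A Z" "mono_at s A i" using p pA unfolding R_def by auto
    have "i \<noteq> 0"
    proof
      assume "i = 0"
      then have "i \<cdot> idm C A = 0" using cmp_zero_left[OF idm_Hom] by simp
      then show False using A idm_Hom zero_obj_iff unfolding mono_at_def by blast
    qed
    then have "\<not> simple s A" using no A(3) by blast
    then obtain B f where B: "B \<in> P s" "f \<in> Hom C B A" "mono_at s B f" "\<not> zero_obj C B" "\<not> iso_mor C B A f"
      using A unfolding simple_def by blast
    have "R (B, i \<cdot> f)"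
      unfolding R_def using B A mono_comp[OF B(2) A(3)] cmp_Hom[OF B(2) A(3)] by simp
    moreover have "N p (B, i \<cdot> f)" unfolding N_def pA using B by auto
    ultimately show ?thesis by blast
  qed
  ultimately obtain F where F: "\<And>n::nat. R (F n)" "\<And>n. N (F n) (F (Suc n))"
    using dependent_nat_choice[of "\<lambda>_. R" "\<lambda>_. N"] by metis
  have "\<forall>n. \<exists>u. u \<in> Hom C (fst (F (Suc n))) (fst (F n)) \<and> snd (F n) \<cdot> u = snd (F (Suc n)) \<and>
      \<not> iso_mor C (fst (F (Suc n))) (fst (F n)) u"
    using F(2) unfolding N_def by blast
  then obtain u where u: "\<And>n. u n \<in> Hom C (fst (F (Suc n))) (fst (F n)) \<and> snd (F n) \<cdot> u n = snd (F (Suc n))"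
    "\<And>n. \<not> iso_mor C (fst (F (Suc n))) (fst (F n)) (u n)" by metis
  have "\<exists>B g h. B \<in> P s \<and> dtri C (fst (F n)) Z B (snd (F n)) g h" for n
    using F(1)[of n] TR1_cone mono_cone Z(1) unfolding R_def by metis
  then show False
    using subobject_chains_stabilise(1)[where A = "\<lambda>n. fst (F n)" and i = "\<lambda>n. snd (F n)" and u = u, OF Z(1) _ _ u(1)]
      F(1) u(2) unfolding R_def by blast
qed

text \<open>The chain condition is about subobjects, so quotients are recorded by their kernels.
  Passing from a quotient that is not simple to a proper quotient of it enlarges the kernel
  strictly, and the ascending chain condition gives the contradiction.\<close>

lemma simple_quotient:
  assumes Z: "Z \<in> P s" "\<not> zero_obj C Z"
  shows "\<exists>B p. simple s B \<and> p \<in> Hom C Z B \<and> p \<noteq> 0"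
proof (rule ccontr)
  assume no: "\<not> ?thesis"
  define R where "R x \<longleftrightarrow> (\<exists>B p h. fst x \<in> P s \<and> B \<in> P s \<and> \<not> zero_obj C B \<and>
    dtri C (fst x) Z B (snd x) p h)" for x
  define N where "N x y \<longleftrightarrow> (\<exists>u\<in>Hom C (fst x) (fst y). snd y \<cdot> u = snd x \<and>
    \<not> iso_mor C (fst x) (fst y) u)" for x y
  \<comment> \<open>The chain starts with \<open>Z\<close> as a quotient of itself, so its first
    kernel is a zero object.\<close>
  obtain K j h where K: "dtri C K Z Z j (idm C Z) h" using et.fibre_ex[OF idm_Hom] by blast
  have "epi_at s Z (idm C Z)" unfolding epi_at_def using cmp_idm_right by auto
  then have "R (K, j)" unfolding R_def using epi_fibre[OF Z(1,1) K] Z K by auto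
  moreover have "\<exists>y. R y \<and> N x y" if x: "R x" for x
  proof -
    obtain A i where xA: "x = (A, i)" by fastforce
    obtain B p h where A: "A \<in> P s" "B \<in> P s" "\<not> zero_obj C B" and T: "dtri C A Z B i p h"
      using x xA unfolding R_def by auto
    have p: "p \<in> Hom C Z B" and i: "i \<in> Hom C A Z" using dtri_Hom[OF T] by auto
    have ep: "epi_at s B p" using epi_second[OF T A(1)] .
    have "p \<noteq> 0"
    proof
      assume "p = 0"
      then have "idm C B \<cdot> p = 0" using cmp_zero_right[OF idm_Hom] by simp
      then show False using A ep idm_Hom zero_obj_iff unfolding epi_at_def by blast
    qed
    then have "\<not> simple s B" using no p by blast
    then obtain D f where D: "D \<in> P s" "f \<in> Hom C D B" "mono_at s D f" "\<not> zero_obj C D" "\<not> iso_mor C D B f"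
      using A unfolding simple_def by blast
    obtain B' q k where T': "dtri C D B B' f q k" using TR1_cone[OF D(2)] by blast
    have q: "q \<in> Hom C B B'" using dtri_Hom[OF T'] by blast
    have B': "B' \<in> P s" using mono_cone[OF D(1) A(2) T' D(3)] .
    \<comment> \<open>If the cone of \<open>f\<close> vanished, \<open>f\<close> would have a
      section and, being a monomorphism, would be an isomorphism.\<close>
    have B'0: "\<not> zero_obj C B'"
    proof
      assume 0: "zero_obj C B'"
      then have "q \<cdot> idm C B = 0" using Hom_zero_obj(2)[OF 0] cmp_Hom[OF idm_Hom q] by blast
      then obtain r where r: "r \<in> Hom C B D" "idm C B = f \<cdot> r" using et.tri_lift1[OF T' idm_Hom] by blast
      have rf: "r \<cdot> f \<in> Hom C D D" using cmp_Hom[OF D(2) r(1)] .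
      have "f \<cdot> (r \<cdot> f - idm C D) = 0"
        using cmp_diff_right[OF rf idm_Hom D(2)] cmp_assoc[OF D(2) r(1) D(2)] r(2)
          cmp_idm_left[OF D(2)] cmp_idm_right[OF D(2)] by simp
      then have "r \<cdot> f - idm C D = 0"
        using D(1,3) diff_Hom[OF rf idm_Hom] unfolding mono_at_def by blast
      then show False using D(2,5) r unfolding iso_mor_def by auto
    qed
    have qp: "q \<cdot> p \<in> Hom C Z B'" using cmp_Hom[OF p q] .
    have eq: "epi_at s B' (q \<cdot> p)" using epi_comp[OF p q ep epi_second[OF T' D(1)]] .
    obtain A' i' h' where T'': "dtri C A' Z B' i' (q \<cdot> p) h'" using et.fibre_ex[OF qp] by blast
    have A': "A' \<in> P s" using epi_fibre[OF Z(1) B' T'' eq] .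
    have i': "i' \<in> Hom C A' Z" using dtri_Hom[OF T''] by blast
    have "q \<cdot> p \<cdot> i = 0"
      using cmp_assoc[OF i p q] et.tri_comp1[OF T] cmp_zero_right[OF q] by simp
    then obtain u where u: "u \<in> Hom C A A'" "i = i' \<cdot> u" using et.tri_lift1[OF T'' i] by blast
    \<comment> \<open>Equal kernels would make \<open>p\<close> factor through
      \<open>q \<cdot> p\<close>. As \<open>p\<close> is an epimorphism, \<open>q\<close> would then
      have a left inverse, and \<open>q \<cdot> f = 0\<close> would give \<open>f = 0\<close>,
      although \<open>D\<close> is a nonzero subobject.\<close>
    have "\<not> iso_mor C A A' u"
    proof
      assume "iso_mor C A A' u"
      then obtain v where v: "v \<in> Hom C A' A" "u \<cdot> v = idm C A'" unfolding iso_mor_def by blast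
      have "i' = i \<cdot> v" using u(2) cmp_assoc[OF v(1) u(1) i'] v(2) cmp_idm_right[OF i'] by simp
      then have "p \<cdot> i' = 0"
        using cmp_assoc[OF v(1) i p] et.tri_comp1[OF T] cmp_zero_left[OF v(1)] by simp
      then obtain w where w: "w \<in> Hom C B' B" "p = w \<cdot> (q \<cdot> p)" using et.tri_fact1[OF T'' p] by blast
      have wq: "w \<cdot> q \<in> Hom C B B" using cmp_Hom[OF q w(1)] .
      have "(w \<cdot> q - idm C B) \<cdot> p = 0"
        using cmp_diff_left[OF p wq idm_Hom] cmp_assoc[OF p q w(1)] w(2) cmp_idm_left[OF p] by simp
      then have "w \<cdot> q - idm C B = 0"
        using ep A(2) diff_Hom[OF wq idm_Hom] unfolding epi_at_def by blast
      then have "f = w \<cdot> (q \<cdot> f)" using cmp_assoc[OF D(2) q w(1)] cmp_idm_left[OF D(2)] by simp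
      then have "f \<cdot> idm C D = 0"
        using et.tri_comp1[OF T'] cmp_zero_right[OF w(1)] cmp_zero_left[OF idm_Hom] by simp
      then show False using D idm_Hom zero_obj_iff unfolding mono_at_def by blast
    qed
    then have "N x (A', i')" unfolding N_def xA using u by auto
    moreover have "R (A', i')" unfolding R_def using A' B' B'0 T'' by auto
    ultimately show ?thesis by blast
  qed
  ultimately obtain F where F: "\<And>n::nat. R (F n)" "\<And>n. N (F n) (F (Suc n))"
    using dependent_nat_choice[of "\<lambda>_. R" "\<lambda>_. N"] by metis
  have "\<forall>n. \<exists>u. u \<in> Hom C (fst (F n)) (fst (F (Suc n))) \<and> snd (F (Suc n)) \<cdot> u = snd (F n) \<and>
      \<not> iso_mor C (fst (F n)) (fst (F (Suc n))) u"
    using F(2) unfolding N_def by blast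
  then obtain u where u: "\<And>n. u n \<in> Hom C (fst (F n)) (fst (F (Suc n))) \<and> snd (F (Suc n)) \<cdot> u n = snd (F n)"
    "\<And>n. \<not> iso_mor C (fst (F n)) (fst (F (Suc n))) (u n)" by metis
  have "\<exists>B g h. B \<in> P s \<and> dtri C (fst (F n)) Z B (snd (F n)) g h" "fst (F n) \<in> P s" for n
    using F(1)[of n] unfolding R_def by blast+
  then show False
    using subobject_chains_stabilise(2)[where A = "\<lambda>n. fst (F n)" and i = "\<lambda>n. snd (F n)" and u = u, OF Z(1) _ _ u(1)]
      u(2) by blast
qed

end

section \<open>The spherical twist\<close>

text \<open>This puts a homogeneous basis into the indexed form of \<open>span\<close> and
  \<open>indep\<close> in \<open>coevaluation_fibre_gt\<close>. Each \<open>B i\<close> is finite as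
  a slice of the index set of a biproduct.\<close>

lemma (in linear_category) homogeneous_basis_sums:
  assumes B: "homogeneous_basis C U V B" and fin: "finite (SIGMA i:UNIV. B i)"
  shows "f \<in> Hom_deg C i U V \<Longrightarrow>
      \<exists>a. f = (\<Sum>j | j \<in> (SIGMA i:UNIV. B i) \<and> fst j = i. smul C (a j) (snd j))"
    and "(\<Sum>j | j \<in> (SIGMA i:UNIV. B i) \<and> fst j = i. smul C (a j) (snd j)) = 0 \<Longrightarrow>
      \<forall>j\<in>(SIGMA i:UNIV. B i). fst j = i \<longrightarrow> a j = 0"
proof -
  have set: "{j \<in> (SIGMA i:UNIV. B i). fst j = i} = Pair i ` B i" by auto
  have sum: "(\<Sum>j | j \<in> (SIGMA i:UNIV. B i) \<and> fst j = i. smul C (a j) (snd j)) =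
      (\<Sum>b\<in>B i. smul C (a (i, b)) b)" for a
    unfolding set by (subst sum.reindex) (auto simp: inj_on_def)
  have finB: "finite (B i)"
  proof -
    have "finite (Pair i ` B i)" by (rule finite_subset[OF _ fin]) auto
    then show ?thesis by (rule finite_imageD) (simp add: inj_on_def)
  qed
  have ind: "independent (B i)" and span: "span (B i) = Hom_deg C i U V"
    using B unfolding homogeneous_basis_def by auto
  show "\<exists>a. f = (\<Sum>j | j \<in> (SIGMA i:UNIV. B i) \<and> fst j = i. smul C (a j) (snd j))"
    if f: "f \<in> Hom_deg C i U V"
  proof -
    obtain u where u: "f = (\<Sum>b\<in>B i. smul C (u b) b)"
      using f unfolding span[symmetric] span_finite[OF finB] by auto
    show ?thesis unfolding sum by (rule exI[of _ "\<lambda>j. u (snd j)"]) (simp add: u)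
  qed
  show "\<forall>j\<in>(SIGMA i:UNIV. B i). fst j = i \<longrightarrow> a j = 0"
    if "(\<Sum>j | j \<in> (SIGMA i:UNIV. B i) \<and> fst j = i. smul C (a j) (snd j)) = 0"
    using that ind dependent_finite[OF finB] unfolding sum by auto
qed

lemma (in linear_category) isomorphic_Hom_nonzero:
  assumes "isomorphic C A X"
  shows "i \<in> Hom C A Z \<Longrightarrow> i \<noteq> 0 \<Longrightarrow> Hom C X Z \<noteq> {0}"
    and "p \<in> Hom C Z A \<Longrightarrow> p \<noteq> 0 \<Longrightarrow> Hom C Z X \<noteq> {0}"
proof -
  obtain f g where f: "f \<in> Hom C A X" and g: "g \<in> Hom C X A" and gf: "g \<cdot> f = idm C A"
    using assms unfolding isomorphic_def iso_mor_def by blast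
  show "Hom C X Z \<noteq> {0}" if i: "i \<in> Hom C A Z" "i \<noteq> 0"
  proof
    assume "Hom C X Z = {0}"
    then have "i \<cdot> g = 0" using cmp_Hom[OF g i(1)] by simp
    then have "i \<cdot> (g \<cdot> f) = 0" using cmp_assoc[OF f g i(1)] cmp_zero_left[OF f] by simp
    then show False using gf cmp_idm_right[OF i(1)] i(2) by simp
  qed
  show "Hom C Z X \<noteq> {0}" if p: "p \<in> Hom C Z A" "p \<noteq> 0"
  proof
    assume "Hom C Z X = {0}"
    then have "f \<cdot> p = 0" using cmp_Hom[OF p(1) f] by simp
    then have "(g \<cdot> f) \<cdot> p = 0" using cmp_assoc[OF p(1) f g] cmp_zero_right[OF g] by simp
    then show False using gf cmp_idm_left[OF p(1)] p(2) by simp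
  qed
qed

text \<open>In \<open>k[x]/(x^2)\<close> with \<open>x\<close> of degree 2, degree 0 is the line
  spanned by the unit and degree 1 is zero; the grading isomorphism transports both
  statements.\<close>

lemma (in triangulated_category) spherical_End_Ext1:
  assumes "spherical C X"
  shows "f \<in> Hom C X X \<Longrightarrow> \<exists>c. f = smul C c (idm C X)" and "Hom C X (shO C 1 X) = {0}"
proof -
  obtain \<Phi> :: "int \<Rightarrow> 'm \<Rightarrow> 'k \<times> 'k" where
    lin: "\<And>i. linear_on (smul C) HS2_smul (Hom_deg C i X X) (\<Phi> i)"
    and bij: "\<And>i. bij_betw (\<Phi> i) (Hom_deg C i X X) (HS2 i)" and one: "\<Phi> 0 (idm C X) = (1, 0)"
    using assms unfolding spherical_def by blast
  have deg0: "Hom_deg C 0 X X = Hom C X X" by (simp add: Hom_deg_def shO_0)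
  show "\<exists>c. f = smul C c (idm C X)" if f: "f \<in> Hom C X X"
  proof -
    have "\<Phi> 0 f \<in> HS2 0" using bij[of 0] f deg0 bij_betwE by blast
    then obtain c where c: "\<Phi> 0 f = (c, 0)" by (auto simp: HS2_def)
    have "\<Phi> 0 (smul C c (idm C X)) = HS2_smul c (\<Phi> 0 (idm C X))"
      using lin[of 0] idm_Hom[of X] unfolding linear_on_def deg0 by blast
    also have "\<dots> = \<Phi> 0 f" unfolding one c by (simp add: HS2_smul_def)
    finally show ?thesis
      using bij_betw_imp_inj_on[OF bij[of 0]] f smul_Hom[OF idm_Hom] unfolding deg0 by (metis inj_onD)
  qed
  have "f = 0" if "f \<in> Hom_deg C 1 X X" for f
  proof -
    have 0: "0 \<in> Hom_deg C 1 X X" unfolding Hom_deg_def by (rule zero_Hom)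
    have "\<Phi> 1 f = \<Phi> 1 0" using bij_betwE[OF bij[of 1]] that 0 by (simp add: HS2_def)
    then show ?thesis using bij_betw_imp_inj_on[OF bij[of 1]] that 0 by (metis inj_onD)
  qed
  then show "Hom C X (shO C 1 X) = {0}" unfolding Hom_deg_def using zero_Hom by blast
qed

text \<open>The uniqueness of X enters in the last two conditions on \<open>P s\<close>: the simple
  subobject and the simple quotient of an object are isomorphic to X, so X both generates and
  cogenerates.\<close>

lemma (in stability) simple_object:
  assumes X: "simple s X" and uniq: "\<And>A. simple s A \<Longrightarrow> isomorphic C A X" and sph: "spherical C X"
  shows "simple_object C P X s"
proof unfold_locales
  show "A \<in> P r \<Longrightarrow> shO C m A \<in> P (r + of_int m)" for A r m by (rule P_shift)
  show "r < q \<Longrightarrow> A \<in> P q \<Longrightarrow> B \<in> P r \<Longrightarrow> Hom C A B = {0}" for r q A B by (rule P_Hom)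
  show "\<exists>r A i. A \<in> P r \<and> \<not> zero_obj C A \<and> i \<in> Hom C A Y \<and>
      (\<forall>U. (\<forall>q\<le>r. \<forall>B\<in>P q. Hom C U B = {0}) \<longrightarrow> Hom C U Y = {0}) \<and>
      (\<forall>U h. (\<forall>q<r. \<forall>B\<in>P q. Hom C U B = {0}) \<longrightarrow> h \<in> Hom C U A \<longrightarrow> i \<cdot> h = 0 \<longrightarrow> h = 0)"
    if nz: "\<not> zero_obj C Y" for Y
  proof -
    obtain n \<phi> F where HN: "HN_filtration C \<tau> Y n \<phi> F" using HN_ex[OF nz] by blast
    have n: "0 < n" using HN unfolding HN_filtration_def by (rule conjunct1)
    obtain i where i: "i \<in> Hom C (F 0) Y" "\<forall>U h. (\<forall>q<\<phi> 0. \<forall>B\<in>P q. Hom C U B = {0}) \<longrightarrow>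
        h \<in> Hom C U (F 0) \<longrightarrow> i \<cdot> h = 0 \<longrightarrow> h = 0"
      using HN_max_factor[OF HN] by blast
    show ?thesis
      using HN_factor[OF HN n] i HN_upper[OF HN]
      by (intro exI[of _ "\<phi> 0"] exI[of _ "F 0"] exI[of _ i]) blast
  qed
  show "\<exists>r A p. A \<in> P r \<and> \<not> zero_obj C A \<and> p \<in> Hom C Y A \<and>
      (\<forall>U. (\<forall>q\<ge>r. \<forall>B\<in>P q. Hom C B U = {0}) \<longrightarrow> Hom C Y U = {0}) \<and>
      (\<forall>U h. (\<forall>q>r. \<forall>B\<in>P q. Hom C B U = {0}) \<longrightarrow> h \<in> Hom C A U \<longrightarrow> h \<cdot> p = 0 \<longrightarrow> h = 0)"
    if nz: "\<not> zero_obj C Y" for Y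
  proof -
    obtain n \<phi> F where HN: "HN_filtration C \<tau> Y n \<phi> F" using HN_ex[OF nz] by blast
    have "0 < n" using HN unfolding HN_filtration_def by (rule conjunct1)
    then have n: "n - 1 < n" by simp
    obtain p where p: "p \<in> Hom C Y (F (n - 1))" "\<forall>U h. (\<forall>q>\<phi> (n - 1). \<forall>B\<in>P q. Hom C B U = {0}) \<longrightarrow>
        h \<in> Hom C (F (n - 1)) U \<longrightarrow> h \<cdot> p = 0 \<longrightarrow> h = 0"
      using HN_min_factor[OF HN] by blast
    show ?thesis
      using HN_factor[OF HN n] p HN_lower[OF HN]
      by (intro exI[of _ "\<phi> (n - 1)"] exI[of _ "F (n - 1)"] exI[of _ p]) blast
  qed
  show "X \<in> P s" using X unfolding simple_def by blast
  show "\<exists>k\<in>Hom C X A. f \<cdot> k = idm C X"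
    if A: "A \<in> P s" "\<not> zero_obj C A" and f: "f \<in> Hom C A X"
      and m: "\<And>U h. U \<in> P s \<Longrightarrow> h \<in> Hom C U A \<Longrightarrow> f \<cdot> h = 0 \<Longrightarrow> h = 0" for A f
  proof -
    have "mono_at s A f" unfolding mono_at_def using m by blast
    then have "iso_mor C A X f" using X A f unfolding simple_def by blast
    then show ?thesis unfolding iso_mor_def by blast
  qed
  show "\<exists>k\<in>Hom C A X. k \<cdot> f = idm C X"
    if A: "A \<in> P s" "\<not> zero_obj C A" and f: "f \<in> Hom C X A"
      and m: "\<And>U h. U \<in> P s \<Longrightarrow> h \<in> Hom C A U \<Longrightarrow> h \<cdot> f = 0 \<Longrightarrow> h = 0" for A f
  proof -
    have "epi_at s A f" unfolding epi_at_def using m by blast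
    then show ?thesis using simple_epi_split[OF X A f] by blast
  qed
  show "Hom C X A \<noteq> {0}" if "A \<in> P s" "\<not> zero_obj C A" for A
    using simple_subobject[OF that] uniq isomorphic_Hom_nonzero(1) by blast
  show "Hom C A X \<noteq> {0}" if "A \<in> P s" "\<not> zero_obj C A" for A
    using simple_quotient[OF that] uniq isomorphic_Hom_nonzero(2) by blast
qed (use spherical_End_Ext1[OF sph] in blast)+

text \<open>The extreme phases of the twisted object are meaningful only if it is nonzero. A linear
  functor preserves the equation \<open>idm = 0\<close>, so it sends zero objects to zero objects,
  and \<open>Y\<close> is recovered from its image up to isomorphism.\<close>

lemma (in linear_category) inverse_autoequivalence_nonzero:
  assumes "linear_functor C F" "comp_iso_identity C F G" "\<not> zero_obj C Y"
  shows "\<not> zero_obj C (omap G Y)"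
proof
  assume 0: "zero_obj C (omap G Y)"
  have "linear_on (smul C) (smul C) (Hom C (omap G Y) (omap G Y)) (mmap F)"
    and idF: "mmap F (idm C (omap G Y)) = idm C (omap F (omap G Y))"
    using assms(1) unfolding linear_functor_def by blast+
  then have "mmap F (0 + 0) = mmap F 0 + mmap F 0"
    using zero_Hom[of "omap G Y" "omap G Y"] unfolding linear_on_def by blast
  then have "mmap F 0 = 0" by simp
  then have "zero_obj C (omap F (omap G Y))" using 0 idF by (simp add: zero_obj_iff)
  moreover obtain \<theta> where "iso_mor C (omap F (omap G Y)) Y \<theta>"
    using assms(2) unfolding comp_iso_identity_def by blast
  ultimately show False using iso_mor_zero_obj assms(3) by blast
qed

theorem proposition3p2:
  fixes C :: "('k::field, 'o, 'm::ab_group_add) tricat_data"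
    and \<tau> :: "'o stab_data"
    and X Y :: 'o
    and \<sigma> \<sigma>' :: "('o, 'm) endofunctor"
  assumes "triangulated_category C" and "Hom_finite C" and "calabi_yau 2 C"
    and "stability_condition C \<tau>"
    and "spherical C X" and "spherical_twist C X \<sigma> \<sigma>'"
    and "stable_obj C \<tau> X"
    and "\<And>X'. stable_obj C \<tau> X' \<Longrightarrow> phase \<tau> X' = phase \<tau> X \<Longrightarrow> isomorphic C X' X"
    and "\<not> zero_obj C Y"
  shows "(phase \<tau> X \<le> phase_minus C \<tau> Y \<longrightarrow> phase \<tau> X < phase_minus C \<tau> (omap \<sigma>' Y)) \<and>
         (phase_plus C \<tau> Y \<le> phase \<tau> X \<longrightarrow> phase_plus C \<tau> (omap \<sigma> Y) < phase \<tau> X)"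
proof -
  interpret stability C \<tau>
    using assms(1,4) by (simp add: stability_def stability_axioms_def)
  obtain t where X: "simple t X" using assms(7) stable_obj_iff by blast
  have phase_simple: "phase \<tau> A = s" if "simple s A" for A s
    using that phase_eq unfolding simple_def by blast
  have t: "phase \<tau> X = t" using phase_simple[OF X] .
  have "isomorphic C A X" if "simple t A" for A
    using assms(8)[of A] that phase_simple[OF that] t stable_obj_iff by auto
  then interpret SO: simple_object C P X t
    using simple_object[OF X _ assms(5)] by blast
  interpret OP: simple_object "opposite C" "\<lambda>s. P (- s)" X "- t"
    by (rule SO.simple_object_opposite)
  have inv: "linear_functor C \<sigma>" "linear_functor C \<sigma>'" "comp_iso_identity C \<sigma>' \<sigma>" "comp_iso_identity C \<sigma> \<sigma>'"
    using assms(6) unfolding spherical_twist_def inverse_autoequivalences_def exact_functor_def by blast+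
  obtain n \<phi> A where HN: "HN_filtration C \<tau> Y n \<phi> A" using HN_ex[OF assms(9)] by blast
  have "t < phase_minus C \<tau> (omap \<sigma>' Y)" if le: "t \<le> phase_minus C \<tau> Y"
  proof -
    obtain T e p q where ev: "coevaluation C X Y T e" and T: "dtri C (omap \<sigma>' Y) Y T p e q"
      using assms(6) unfolding spherical_twist_def by blast
    obtain B \<iota> \<pi> where B: "homogeneous_basis C Y X B"
      and bip: "is_biproduct C (SIGMA i:UNIV. B i) (\<lambda>(i, b). shO C i X) T \<iota> \<pi>"
      and comp: "\<And>i b. b \<in> B i \<Longrightarrow> \<pi> (i, b) \<cdot>\<^bsub>C\<^esub> e = b"
      using ev unfolding coevaluation_def by blast
    let ?I = "SIGMA i:UNIV. B i"
    have fin: "finite ?I" using bip unfolding is_biproduct_def by blast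
    have sums: "(\<Sum>j | j \<in> ?I \<and> fst j = i. smul C (a j) (\<pi> j \<cdot>\<^bsub>C\<^esub> e)) =
        (\<Sum>j | j \<in> ?I \<and> fst j = i. smul C (a j) (snd j))" for i a
      using comp by (intro sum.cong) auto
    have "SO.ge t Y"
      using HN_min_phase_ge_iff[OF HN, of t] le unfolding SO.ge_def phase_minus_eq[OF HN] by blast
    then have gt: "SO.gt t (omap \<sigma>' Y)"
    proof (rule SO.coevaluation_fibre_gt[where I = ?I and d = fst, OF _ _ T])
      show "is_biproduct C ?I (\<lambda>j. shO C (fst j) X) T \<iota> \<pi>"
        using bip by (simp add: case_prod_unfold)
      show "\<exists>a. f = (\<Sum>j | j \<in> ?I \<and> fst j = i. smul C (a j) (\<pi> j \<cdot>\<^bsub>C\<^esub> e))"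
        if "f \<in> Hom C Y (shO C i X)" for i f
        using homogeneous_basis_sums(1)[OF B fin, of f i] that unfolding sums Hom_deg_def by blast
      show "\<forall>j\<in>?I. fst j = i \<longrightarrow> a j = 0"
        if "(\<Sum>j | j \<in> ?I \<and> fst j = i. smul C (a j) (\<pi> j \<cdot>\<^bsub>C\<^esub> e)) = 0" for i a
        using homogeneous_basis_sums(2)[OF B fin] that unfolding sums by blast
    qed
    have "\<not> zero_obj C (omap \<sigma>' Y)"
      using inverse_autoequivalence_nonzero[OF inv(1,4) assms(9)] .
    then obtain m \<psi> F where HN': "HN_filtration C \<tau> (omap \<sigma>' Y) m \<psi> F" using HN_ex by blast
    obtain r where r: "r \<in> Hom C (omap \<sigma>' Y) (F (m - 1))" "r \<noteq> 0" "F (m - 1) \<in> P (\<psi> (m - 1))"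
      using HN_min_nonzero[OF HN'] .
    have "\<not> \<psi> (m - 1) \<le> t" using gt r unfolding SO.gt_def by blast
    then show ?thesis unfolding phase_minus_eq[OF HN'] by simp
  qed
  moreover have "phase_plus C \<tau> (omap \<sigma> Y) < t" if le: "phase_plus C \<tau> Y \<le> t"
  proof -
    obtain T e p q where ev: "evaluation C X Y T e" and T: "dtri C T Y (omap \<sigma> Y) e p q"
      using assms(6) unfolding spherical_twist_def by blast
    obtain B \<iota> \<pi> where B: "homogeneous_basis C X Y B"
      and bip: "is_biproduct C (SIGMA i:UNIV. B i) (\<lambda>(i, b). shO C (- i) X) T \<iota> \<pi>"
      and comp: "\<And>i b. b \<in> B i \<Longrightarrow> e \<cdot>\<^bsub>C\<^esub> \<iota> (i, b) = shM C (- i) b"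
      using ev unfolding evaluation_def by blast
    let ?I = "SIGMA i:UNIV. B i"
    have fin: "finite ?I" using bip unfolding is_biproduct_def by blast
    have q: "q \<in> Hom C (omap \<sigma> Y) (shO C 1 T)" using dtri_Hom[OF T] by blast
    \<comment> \<open>Read backwards, the evaluation triangle presents
      \<open>omap \<sigma> Y\<close> as the fibre of \<open>e : Y \<rightarrow> T\<close> in the
      opposite category.\<close>
    have T': "dtri (opposite C) (omap \<sigma> Y) Y T p e (shM C (- 1) q)"
      using T et.shM_Hom_minus(2)[OF q] et.shM_inverse(2)[OF q, of 1] by simp
    have B_Hom: "b \<in> Hom C X (shO C i Y)" if "b \<in> B i" for i b
      using B that span_superset unfolding homogeneous_basis_def Hom_deg_def by blast
    \<comment> \<open>The components of evaluation are the basis elements shifted by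
      \<open>- i\<close>, so linear relations among them correspond to relations in the basis. The
      induction over \<open>J\<close> keeps partial sums in a Hom space, where \<open>shM\<close> is
      known to be additive.\<close>
    have sums: "(\<Sum>j | j \<in> ?I \<and> fst j = i. smul C (a j) (e \<cdot>\<^bsub>C\<^esub> \<iota> j)) =
        shM C (- i) (\<Sum>j | j \<in> ?I \<and> fst j = i. smul C (a j) (snd j))" for i a
    proof -
      have "shM C (- i) (\<Sum>j\<in>J. smul C (a j) (snd j)) = (\<Sum>j\<in>J. smul C (a j) (e \<cdot>\<^bsub>C\<^esub> \<iota> j))"
        if "finite J" "J \<subseteq> {j \<in> ?I. fst j = i}" for J
        using that
      proof induction
        case empty
        then show ?case by simp
      next
        case (insert j J)
        have j: "snd j \<in> Hom C X (shO C i Y)" and ej: "e \<cdot>\<^bsub>C\<^esub> \<iota> j = shM C (- i) (snd j)"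
          using insert.prems B_Hom[of "snd j" i] comp[of "snd j" i] by (cases j, force)+
        have "(\<Sum>j\<in>J. smul C (a j) (snd j)) \<in> Hom C X (shO C i Y)"
          using insert.prems B_Hom by (intro sum_Hom smul_Hom) auto
        then show ?case
          using insert shM_add[OF smul_Hom[OF j]] shM_smul[OF j] ej by simp
      qed
      moreover have "finite {j \<in> ?I. fst j = i}" using fin by simp
      ultimately show ?thesis by simp
    qed
    have "OP.ge (- t) Y"
      unfolding OP.ge_def
    proof (intro allI impI ballI)
      fix r D assume r: "r < - t" and D: "D \<in> P (- r)"
      have "\<forall>r>t. \<forall>B\<in>P r. Hom C B Y = {0}"
        using HN_max_phase_le_iff[OF HN, of t] le unfolding phase_plus_eq[OF HN] by simp
      moreover have "t < - r" using r by simp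
      ultimately show "Hom (opposite C) Y D = {0}" using D by simp
    qed
    then have gt: "OP.gt (- t) (omap \<sigma> Y)"
    \<comment> \<open>Inclusions and projections of \<open>T\<close> trade places, and
      \<open>X[-i]\<close> is the shift of X by \<open>i\<close> in the opposite category, so the
      degree function is again \<open>fst\<close>.\<close>
    proof (rule OP.coevaluation_fibre_gt[where I = ?I and d = fst and \<iota> = \<pi> and \<pi> = \<iota>, OF _ _ T'])
      show "is_biproduct (opposite C) ?I (\<lambda>j. shO (opposite C) (fst j) X) T \<pi> \<iota>"
        using bip unfolding is_biproduct_def by (auto simp: case_prod_unfold)
      show "\<exists>a. f = (\<Sum>j | j \<in> ?I \<and> fst j = i. smul (opposite C) (a j) (cmp (opposite C) (\<iota> j) e))"
        if "f \<in> Hom (opposite C) Y (shO (opposite C) i X)" for i f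
      proof -
        have f: "f \<in> Hom C (shO C (- i) X) Y" using that by simp
        then have "shM C i f \<in> Hom_deg C i X Y"
          using shM_Hom[OF f, of i] unfolding Hom_deg_def by simp
        then obtain a where "shM C i f = (\<Sum>j | j \<in> ?I \<and> fst j = i. smul C (a j) (snd j))"
          using homogeneous_basis_sums(1)[OF B fin] by blast
        then have "f = (\<Sum>j | j \<in> ?I \<and> fst j = i. smul C (a j) (e \<cdot>\<^bsub>C\<^esub> \<iota> j))"
          unfolding sums using et.shM_inverse(1)[OF f, of i] by simp
        then show ?thesis by auto
      qed
      show "\<forall>j\<in>?I. fst j = i \<longrightarrow> a j = 0"
        if "(\<Sum>j | j \<in> ?I \<and> fst j = i. smul (opposite C) (a j) (cmp (opposite C) (\<iota> j) e)) = 0" for i a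
      proof -
        have "(\<Sum>j | j \<in> ?I \<and> fst j = i. smul C (a j) (snd j)) \<in> Hom C X (shO C i Y)"
          using B_Hom by (intro sum_Hom smul_Hom) auto
        then have "(\<Sum>j | j \<in> ?I \<and> fst j = i. smul C (a j) (snd j)) = 0"
          using that sums et.sh_eq_zero_iff by simp
        then show ?thesis by (rule homogeneous_basis_sums(2)[OF B fin])
      qed
    qed
    have "\<not> zero_obj C (omap \<sigma> Y)"
      using inverse_autoequivalence_nonzero[OF inv(2,3) assms(9)] .
    then obtain m \<psi> F where HN': "HN_filtration C \<tau> (omap \<sigma> Y) m \<psi> F" using HN_ex by blast
    obtain r where r: "r \<in> Hom C (F 0) (omap \<sigma> Y)" "r \<noteq> 0" "F 0 \<in> P (\<psi> 0)"
      using HN_max_nonzero[OF HN'] .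
    have "\<not> - \<psi> 0 \<le> - t" using gt r unfolding OP.gt_def by fastforce
    then show ?thesis unfolding phase_plus_eq[OF HN'] by simp
  qed
  ultimately show ?thesis unfolding t by blast
qed

end
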